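(* Assume $\sigma>0$, and let $u_{hb},v_{hb}\in V_{hb}^0$ be two solutions of the Dynamic Diffusion problem $$B(w_{hb},z_{hb})+D_h(w_{hb};w_{hb},z_{hb})=(f,z_{hb})\qquad\forall z_{hb}\in V_{hb}^0$$ (with unknown $w_{hb}\in V_{hb}^0$). Define $L_h:=\max_{T\in\mathcal T_h}L_T$, where $$L_T=\chi_T\frac{\mu(h_T)}{\tau}C_{\kappa,1}(a_T+q_T).$$ Let $C_0>0$ be such that $\|w\|_1\le C_0|w|_1$ for all $w\in H_0^1(\Omega)$. If $$\frac{C_0L_h\|f\|_0}{2\sqrt{\sigma}\,\varepsilon^{3/2}}<1,$$ then $u_{hb}=v_{hb}$. Hence the discrete solution of the Dynamic Diffusion problem is unique (any two solutions coincide).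
   Context: Data. $\Omega\subset\mathbb R^d$, $d\in\{2,3\}$, is a bounded polygonal ($d=2$) or polyhedral ($d=3$) domain with Lipschitz boundary; $\varepsilon>0$, $\boldsymbol\beta\in[W^{1,\infty}(\Omega)]^d$ with $\nabla\cdot\boldsymbol\beta=0$, $\sigma\ge0$ a constant, $f\in L^2(\Omega)$. $(\cdot,\cdot)$ and $(\cdot,\cdot)_T$ are the $L^2$ inner products over $\Omega$ and $T$, $\|\cdot\|_0,\|\cdot\|_{0,T}$ the corresponding norms; $|v|_1=\|\nabla v\|_0$, $\|v\|_1^2=\|v\|_0^2+|v|_1^2$, and likewise with subscript $T$. $\|\boldsymbol\beta\|_{0,\infty,T}$ is the essential supremum over $T$ of the Euclidean norm of $\boldsymbol\beta$. $$B(w,v)=\varepsilon(\nabla w,\nabla v)+(\boldsymbol\beta\cdot\nabla w,v)+\sigma(w,v).$$ Discrete spaces. $\mathcal T_h$ is a conforming, shape-regular triangulation of $\Omega$ into simplices; $h_T=\operatorname{diam}(T)$, $h=\max_Th_T$. $V_h^0=\{v\in H_0^1(\Omega): v|_T\in\mathbb P_1(T)\ \forall T\in\mathcal T_h\}$; $V_b=\bigoplus_T\operatorname{span}\{\psi_T\}$, where $\psi_T\in H_0^1(T)$ is the standard simplex bubble of degree $d+1$ (product of the barycentric coordinates of $T$, up to scaling), extended by zero; $V_{hb}^0=V_h^0\oplus V_b$. $\kappa_h:V_{hb}^0\to V_h^0$ is the projection $\kappa_h(v_h+v_b)=v_h$ for $v_h\in V_h^0$, $v_b\in V_b$. It is $L^2$-stable: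 there is $C_\kappa>0$ independent of $h$ with $\|\kappa_h(v_{hb})\|_{0,T}\le C_\kappa\|v_{hb}\|_{0,T}$ for all $v_{hb}\in V_{hb}^0$, $T\in\mathcal T_h$. Set $C_{\kappa,1}:=\max\{C_\kappa,1\}$. Artificial diffusion. For $v_h\in V_h^0$, $R_T(v_h)=\boldsymbol\beta\cdot\nabla v_h+\sigma v_h-f$ on $T$. $Pe_T=\|\boldsymbol\beta\|_{0,\infty,T}h_T/(2\varepsilon)$; $\chi_T=1$ if $Pe_T>1$, $\chi_T=0$ if $Pe_T\le1$. Fix $\tau>0$ and numbers $\mu(h_T)>0$ with $\mu(h_T)\le C_\mu h_T$, $C_\mu$ independent of $h$. For $\sigma>0$, $$\xi_T(v_h)=\chi_T\,\mu(h_T)\frac{\|R_T(v_h)\|_{0,T}}{\|v_h\|_{1,T}+\tau},$$ and $$D_h(z_{hb};u_{hb},v_{hb})=\sum_{T\in\mathcal T_h}\xi_T(\kappa_h(z_{hb}))(\nabla u_{hb},\nabla v_{hb})_T .$$ Constants (for $\sigma>0$): $a_T=(\|\boldsymbol\beta\|_{0,\infty,T}^2+\sigma^2)^{1/2}$, $q_T=\|\boldsymbol\beta\|_{0,\infty,T}+\sigma+\tau^{-1}\|f\|_{0,T}$. *)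

theory Defs
  imports "HOL-Probability.Essential_Supremum"
begin

section \<open>Lebesgue and Sobolev spaces\<close>

text \<open>Elements of the spaces below are functions on the whole space that represent classes modulo
  equality almost everywhere in the domain; values outside the domain are irrelevant. Equality
  in such a space is therefore equality almost everywhere in the domain.\<close>

definition L2 :: "'a::euclidean_space set \<Rightarrow> ('a \<Rightarrow> 'b::euclidean_space) set" where
  "L2 S = {f. f \<in> borel_measurable (lebesgue_on S) \<and> integrable (lebesgue_on S) (\<lambda>x. f x \<bullet> f x)}"

definition l2inner :: "'a::euclidean_space set \<Rightarrow> ('a \<Rightarrow> 'b::euclidean_space) \<Rightarrow> ('a \<Rightarrow> 'b) \<Rightarrow> real" where
  "l2inner S f g = (LINT x|lebesgue_on S. f x \<bullet> g x)"

definition l2norm :: "'a::euclidean_space set \<Rightarrow> ('a \<Rightarrow> 'b::euclidean_space) \<Rightarrow> real" where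
  "l2norm S f = sqrt (l2inner S f f)"

definition linfnorm :: "'a::euclidean_space set \<Rightarrow> ('a \<Rightarrow> 'b::euclidean_space) \<Rightarrow> real" where
  "linfnorm S f = real_of_ereal (esssup (lebesgue_on S) (\<lambda>x. ereal (norm (f x))))"

definition Linf :: "'a::euclidean_space set \<Rightarrow> ('a \<Rightarrow> 'b::euclidean_space) set" where
  "Linf S = {f. f \<in> borel_measurable (lebesgue_on S) \<and>
                esssup (lebesgue_on S) (\<lambda>x. ereal (norm (f x))) < \<infinity>}"

primrec Ck :: "nat \<Rightarrow> ('a::euclidean_space \<Rightarrow> real) \<Rightarrow> bool" where
  "Ck 0 f \<longleftrightarrow> continuous_on UNIV f"
| "Ck (Suc k) f \<longleftrightarrow> (\<forall>x. f differentiable (at x)) \<and>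
                   (\<forall>i\<in>Basis. Ck k (\<lambda>x. frechet_derivative f (at x) i))"

definition test_functions :: "'a::euclidean_space set \<Rightarrow> ('a \<Rightarrow> real) set" where
  "test_functions \<Omega> = {\<phi>. (\<forall>k. Ck k \<phi>) \<and> (\<exists>K. compact K \<and> K \<subseteq> \<Omega> \<and> (\<forall>x. x \<notin> K \<longrightarrow> \<phi> x = 0))}"

definition loc_integrable :: "'a::euclidean_space set \<Rightarrow> ('a \<Rightarrow> 'b::euclidean_space) \<Rightarrow> bool" where
  "loc_integrable \<Omega> f \<longleftrightarrow> (\<forall>K. compact K \<and> K \<subseteq> \<Omega> \<longrightarrow> integrable (lebesgue_on K) f)"

definition has_weak_grad ::
    "'a::euclidean_space set \<Rightarrow> ('a \<Rightarrow> real) \<Rightarrow> ('a \<Rightarrow> 'a) \<Rightarrow> bool" where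
  "has_weak_grad \<Omega> u g \<longleftrightarrow> loc_integrable \<Omega> u \<and> loc_integrable \<Omega> g \<and>
     (\<forall>\<phi>\<in>test_functions \<Omega>. \<forall>i\<in>Basis.
        (LINT x|lebesgue_on \<Omega>. u x * frechet_derivative \<phi> (at x) i)
          = - (LINT x|lebesgue_on \<Omega>. (g x \<bullet> i) * \<phi> x))"

text \<open>The weak gradient is unique up to a null set of \<open>\<Omega>\<close>; a representative is chosen.\<close>

definition wgrad :: "'a::euclidean_space set \<Rightarrow> ('a \<Rightarrow> real) \<Rightarrow> 'a \<Rightarrow> 'a" where
  "wgrad \<Omega> u = (SOME g. has_weak_grad \<Omega> u g)"

definition H1 :: "'a::euclidean_space set \<Rightarrow> ('a \<Rightarrow> real) set" where
  "H1 \<Omega> = {u \<in> L2 \<Omega>. \<exists>g\<in>L2 \<Omega>. has_weak_grad \<Omega> u g}"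

definition W1inf :: "'a::euclidean_space set \<Rightarrow> ('a \<Rightarrow> real) set" where
  "W1inf \<Omega> = {u \<in> Linf \<Omega>. \<exists>g\<in>Linf \<Omega>. has_weak_grad \<Omega> u g}"

definition wdiv :: "'a::euclidean_space set \<Rightarrow> ('a \<Rightarrow> 'a) \<Rightarrow> 'a \<Rightarrow> real" where
  "wdiv \<Omega> b x = (\<Sum>i\<in>Basis. wgrad \<Omega> (\<lambda>y. b y \<bullet> i) x \<bullet> i)"

text \<open>Norms over a subset \<open>T\<close> of the closure of \<open>\<Omega>\<close> of functions on \<open>\<Omega>\<close>; the gradient is the weak
  gradient on \<open>\<Omega>\<close>. The cases used are \<open>T = \<Omega>\<close> and \<open>T\<close> a closed mesh cell, which differs from
  its intersection with \<open>\<Omega>\<close> by a null set.\<close>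

definition h1semi :: "'a::euclidean_space set \<Rightarrow> 'a set \<Rightarrow> ('a \<Rightarrow> real) \<Rightarrow> real" where
  "h1semi \<Omega> T v = l2norm T (wgrad \<Omega> v)"

definition h1norm :: "'a::euclidean_space set \<Rightarrow> 'a set \<Rightarrow> ('a \<Rightarrow> real) \<Rightarrow> real" where
  "h1norm \<Omega> T v = sqrt ((l2norm T v)\<^sup>2 + (h1semi \<Omega> T v)\<^sup>2)"

definition H10 :: "'a::euclidean_space set \<Rightarrow> ('a \<Rightarrow> real) set" where
  "H10 \<Omega> = {u \<in> H1 \<Omega>. \<exists>\<phi>. (\<forall>n. \<phi> n \<in> test_functions \<Omega>) \<and>
              (\<lambda>n::nat. h1norm \<Omega> \<Omega> (\<lambda>x. u x - \<phi> n x)) \<longlonglongrightarrow> 0}"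


section \<open>Domains and triangulations\<close>

text \<open>Near each boundary point the domain is the strict epigraph, in direction \<open>e\<close>, of a Lipschitz
  function of the component orthogonal to \<open>e\<close>.\<close>

definition lipschitz_boundary :: "'a::euclidean_space set \<Rightarrow> bool" where
  "lipschitz_boundary \<Omega> \<longleftrightarrow> (\<forall>x\<in>frontier \<Omega>. \<exists>U e g L. open U \<and> x \<in> U \<and> norm e = 1 \<and>
     L-lipschitz_on {z. z \<bullet> e = 0} (g :: 'a \<Rightarrow> real) \<and>
     \<Omega> \<inter> U = {y \<in> U. g (y - (y \<bullet> e) *\<^sub>R e) < y \<bullet> e})"

definition polytopal_boundary :: "'a::euclidean_space set \<Rightarrow> bool" where
  "polytopal_boundary \<Omega> \<longleftrightarrow> (\<exists>F. finite F \<and> frontier \<Omega> = \<Union>F \<and>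
     (\<forall>P\<in>F. polytope P \<and> aff_dim P = int DIM('a) - 1))"

definition polytopal_lipschitz_domain :: "'a::euclidean_space set \<Rightarrow> bool" where
  "polytopal_lipschitz_domain \<Omega> \<longleftrightarrow> \<Omega> \<noteq> {} \<and> open \<Omega> \<and> connected \<Omega> \<and> bounded \<Omega> \<and>
     polytopal_boundary \<Omega> \<and> lipschitz_boundary \<Omega>"

text \<open>Conformity (two cells meet in a common, possibly empty, face) is part of \<open>triangulation\<close>.\<close>

definition triangulation_of :: "'a::euclidean_space set \<Rightarrow> 'a set set \<Rightarrow> bool" where
  "triangulation_of \<Omega> \<T> \<longleftrightarrow> triangulation \<T> \<and> (\<forall>T\<in>\<T>. int DIM('a) simplex T) \<and> \<Union>\<T> = closure \<Omega>"

definition mesh_size :: "'a::euclidean_space set set \<Rightarrow> real" where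
  "mesh_size \<T> = Max (diameter ` \<T>)"

definition inradius :: "'a::euclidean_space set \<Rightarrow> real" where
  "inradius T = Sup {r. 0 \<le> r \<and> (\<exists>c. cball c r \<subseteq> T)}"

definition shape_regular :: "'i set \<Rightarrow> ('i \<Rightarrow> 'a::euclidean_space set set) \<Rightarrow> bool" where
  "shape_regular H \<T> \<longleftrightarrow> (\<exists>\<gamma>>0. \<forall>h\<in>H. \<forall>T\<in>\<T> h. diameter T \<le> \<gamma> * inradius T)"


section \<open>Discrete spaces\<close>

definition vertices :: "'a::euclidean_space set \<Rightarrow> 'a set" where
  "vertices T = {v. v extreme_point_of T}"

text \<open>\<open>barycentric T x v\<close> is the barycentric coordinate of \<open>x\<close> at the vertex \<open>v\<close> of a simplex \<open>T\<close> of
  full dimension.\<close>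

definition barycentric :: "'a::euclidean_space set \<Rightarrow> 'a \<Rightarrow> 'a \<Rightarrow> real" where
  "barycentric T x = (THE c. (\<forall>v. v \<notin> vertices T \<longrightarrow> c v = 0) \<and>
     (\<Sum>v\<in>vertices T. c v) = 1 \<and> (\<Sum>v\<in>vertices T. c v *\<^sub>R v) = x)"

definition bubble :: "'a::euclidean_space set \<Rightarrow> 'a \<Rightarrow> real" where
  "bubble T x = (if x \<in> T then \<Prod>v\<in>vertices T. barycentric T x v else 0)"

definition Vh :: "'a::euclidean_space set \<Rightarrow> 'a set set \<Rightarrow> ('a \<Rightarrow> real) set" where
  "Vh \<Omega> \<T> = {v \<in> H10 \<Omega>. \<forall>T\<in>\<T>. \<exists>a c. AE x in lebesgue_on T. v x = a \<bullet> x + c}"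

definition Vb :: "'a::euclidean_space set set \<Rightarrow> ('a \<Rightarrow> real) set" where
  "Vb \<T> = range (\<lambda>c x. \<Sum>T\<in>\<T>. c T * bubble T x)"

definition Vhb :: "'a::euclidean_space set \<Rightarrow> 'a set set \<Rightarrow> ('a \<Rightarrow> real) set" where
  "Vhb \<Omega> \<T> = {\<lambda>x. vh x + vb x | vh vb. vh \<in> Vh \<Omega> \<T> \<and> vb \<in> Vb \<T>}"

text \<open>A nonzero combination of bubbles is not piecewise affine even almost everywhere, so the
  decomposition is unique pointwise. As \<open>Vh\<close> is closed under changes on null sets of \<open>\<Omega>\<close>,
  the projection respects equality almost everywhere.\<close>

definition kappa :: "'a::euclidean_space set \<Rightarrow> 'a set set \<Rightarrow> ('a \<Rightarrow> real) \<Rightarrow> 'a \<Rightarrow> real" where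
  "kappa \<Omega> \<T> v = (THE vh. vh \<in> Vh \<Omega> \<T> \<and> (\<exists>vb\<in>Vb \<T>. v = (\<lambda>x. vh x + vb x)))"


section \<open>The Dynamic Diffusion method\<close>

definition bilin :: "'a::euclidean_space set \<Rightarrow> real \<Rightarrow> ('a \<Rightarrow> 'a) \<Rightarrow> real \<Rightarrow>
    ('a \<Rightarrow> real) \<Rightarrow> ('a \<Rightarrow> real) \<Rightarrow> real" where
  "bilin \<Omega> \<epsilon> \<beta> \<sigma> w v = \<epsilon> * l2inner \<Omega> (wgrad \<Omega> w) (wgrad \<Omega> v)
     + l2inner \<Omega> (\<lambda>x. \<beta> x \<bullet> wgrad \<Omega> w x) v + \<sigma> * l2inner \<Omega> w v"

definition residual :: "'a::euclidean_space set \<Rightarrow> ('a \<Rightarrow> 'a) \<Rightarrow> real \<Rightarrow> ('a \<Rightarrow> real) \<Rightarrow>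
    ('a \<Rightarrow> real) \<Rightarrow> 'a \<Rightarrow> real" where
  "residual \<Omega> \<beta> \<sigma> f v x = \<beta> x \<bullet> wgrad \<Omega> v x + \<sigma> * v x - f x"

definition peclet :: "real \<Rightarrow> ('a::euclidean_space \<Rightarrow> 'a) \<Rightarrow> 'a set \<Rightarrow> real" where
  "peclet \<epsilon> \<beta> T = linfnorm T \<beta> * diameter T / (2 * \<epsilon>)"

definition chi :: "real \<Rightarrow> ('a::euclidean_space \<Rightarrow> 'a) \<Rightarrow> 'a set \<Rightarrow> real" where
  "chi \<epsilon> \<beta> T = (if peclet \<epsilon> \<beta> T > 1 then 1 else 0)"

definition xi :: "'a::euclidean_space set \<Rightarrow> real \<Rightarrow> ('a \<Rightarrow> 'a) \<Rightarrow> real \<Rightarrow> ('a \<Rightarrow> real) \<Rightarrow>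
    real \<Rightarrow> (real \<Rightarrow> real) \<Rightarrow> 'a set \<Rightarrow> ('a \<Rightarrow> real) \<Rightarrow> real" where
  "xi \<Omega> \<epsilon> \<beta> \<sigma> f \<tau> \<mu> T v = chi \<epsilon> \<beta> T * \<mu> (diameter T) *
     (l2norm T (residual \<Omega> \<beta> \<sigma> f v) / (h1norm \<Omega> T v + \<tau>))"

definition Dh :: "'a::euclidean_space set \<Rightarrow> 'a set set \<Rightarrow> real \<Rightarrow> ('a \<Rightarrow> 'a) \<Rightarrow> real \<Rightarrow>
    ('a \<Rightarrow> real) \<Rightarrow> real \<Rightarrow> (real \<Rightarrow> real) \<Rightarrow> ('a \<Rightarrow> real) \<Rightarrow> ('a \<Rightarrow> real) \<Rightarrow> ('a \<Rightarrow> real) \<Rightarrow> real" where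
  "Dh \<Omega> \<T> \<epsilon> \<beta> \<sigma> f \<tau> \<mu> z u v =
     (\<Sum>T\<in>\<T>. xi \<Omega> \<epsilon> \<beta> \<sigma> f \<tau> \<mu> T (kappa \<Omega> \<T> z) * l2inner T (wgrad \<Omega> u) (wgrad \<Omega> v))"

definition dd_solution :: "'a::euclidean_space set \<Rightarrow> 'a set set \<Rightarrow> real \<Rightarrow> ('a \<Rightarrow> 'a) \<Rightarrow> real \<Rightarrow>
    ('a \<Rightarrow> real) \<Rightarrow> real \<Rightarrow> (real \<Rightarrow> real) \<Rightarrow> ('a \<Rightarrow> real) \<Rightarrow> bool" where
  "dd_solution \<Omega> \<T> \<epsilon> \<beta> \<sigma> f \<tau> \<mu> w \<longleftrightarrow> w \<in> Vhb \<Omega> \<T> \<and>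
     (\<forall>z\<in>Vhb \<Omega> \<T>. bilin \<Omega> \<epsilon> \<beta> \<sigma> w z + Dh \<Omega> \<T> \<epsilon> \<beta> \<sigma> f \<tau> \<mu> w w z = l2inner \<Omega> f z)"

definition aT :: "('a::euclidean_space \<Rightarrow> 'a) \<Rightarrow> real \<Rightarrow> 'a set \<Rightarrow> real" where
  "aT \<beta> \<sigma> T = sqrt ((linfnorm T \<beta>)\<^sup>2 + \<sigma>\<^sup>2)"

definition qT :: "('a::euclidean_space \<Rightarrow> 'a) \<Rightarrow> real \<Rightarrow> ('a \<Rightarrow> real) \<Rightarrow> real \<Rightarrow> 'a set \<Rightarrow> real" where
  "qT \<beta> \<sigma> f \<tau> T = linfnorm T \<beta> + \<sigma> + l2norm T f / \<tau>"

definition LT :: "real \<Rightarrow> ('a::euclidean_space \<Rightarrow> 'a) \<Rightarrow> real \<Rightarrow> ('a \<Rightarrow> real) \<Rightarrow> real \<Rightarrow>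
    (real \<Rightarrow> real) \<Rightarrow> real \<Rightarrow> 'a set \<Rightarrow> real" where
  "LT \<epsilon> \<beta> \<sigma> f \<tau> \<mu> C\<^sub>\<kappa> T =
     chi \<epsilon> \<beta> T * (\<mu> (diameter T) / \<tau>) * max C\<^sub>\<kappa> 1 * (aT \<beta> \<sigma> T + qT \<beta> \<sigma> f \<tau> T)"

definition Lh :: "'a::euclidean_space set set \<Rightarrow> real \<Rightarrow> ('a \<Rightarrow> 'a) \<Rightarrow> real \<Rightarrow> ('a \<Rightarrow> real) \<Rightarrow> real \<Rightarrow>
    (real \<Rightarrow> real) \<Rightarrow> real \<Rightarrow> real" where
  "Lh \<T> \<epsilon> \<beta> \<sigma> f \<tau> \<mu> C\<^sub>\<kappa> = Max (LT \<epsilon> \<beta> \<sigma> f \<tau> \<mu> C\<^sub>\<kappa> ` \<T>)"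

end

theory Submission
  imports Defs "HOL-Computational_Algebra.Polynomial"
begin

text \<open>
  The proof tests the difference of the two discrete equations with the difference \<open>e = u - v\<close> of the
  two solutions. Bars denote the \<open>H\<^sup>1\<close> seminorm, \<open>\<parallel>e\<parallel>\<^sub>0\<close> the \<open>L\<^sup>2\<close> norm and \<open>\<parallel>e\<parallel>\<close> the full \<open>H\<^sup>1\<close> norm.
  Since \<open>\<beta>\<close> has divergence zero, the convective term \<open>(\<beta> \<cdot> \<nabla>e, e)\<close> vanishes (\<open>convection_skew\<close>), and
  \<open>\<epsilon> |e|\<^sup>2 + \<sigma> \<parallel>e\<parallel>\<^sub>0\<^sup>2\<close> is at most the sum over the cells of \<open>(\<xi>\<^sub>T(\<kappa>v) - \<xi>\<^sub>T(\<kappa>u)) (\<nabla>v, \<nabla>e)\<^sub>T\<close>; the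
  remaining part \<open>- \<xi>\<^sub>T(\<kappa>u) |e|\<^sub>T\<^sup>2\<close> of the artificial diffusion has a sign and is dropped.

  The coefficient \<open>\<xi>\<^sub>T\<close> is Lipschitz continuous in the \<open>H\<^sup>1(T)\<close> norm: the residual is affine in its
  argument and grows at most like the denominator \<open>\<parallel>v\<parallel> + \<tau>\<close> of \<open>\<xi>\<^sub>T\<close> (\<open>xi_Lipschitz\<close>). The projection
  \<open>\<kappa>\<close> is linear and bounded on every cell, in \<open>L\<^sup>2\<close> by assumption and in the \<open>H\<^sup>1\<close> seminorm by
  orthogonality (\<open>kappa_h1semi_le\<close>). Hence the sum is at most
  \<open>L\<^sub>h |v| \<parallel>e\<parallel> |e| \<le> C\<^sub>0 L\<^sub>h |v| |e|\<^sup>2\<close>. Testing the equation of \<open>v\<close> with \<open>v\<close> bounds \<open>|v|\<close> by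
  \<open>\<parallel>f\<parallel>\<^sub>0 / (2 sqrt (\<sigma> \<epsilon>))\<close> (\<open>solution_h1semi_le\<close>). Under the smallness assumption the right-hand side is
  absorbed by \<open>\<epsilon> |e|\<^sup>2\<close>, which leaves \<open>\<sigma> \<parallel>e\<parallel>\<^sub>0\<^sup>2 \<le> 0\<close>.

  Most of the text supplies the Sobolev facts used here. Three of them carry the weight.

  Weak gradients are unique almost everywhere (\<open>has_weak_grad_unique\<close>), so that the representative
  chosen by \<^const>\<open>wgrad\<close> is immaterial, linear up to null sets, and constant on cells where the
  function is affine. This rests on smooth functions whose supports lie in a given box.

  Bubbles lie in \<open>H\<^sub>0\<^sup>1\<close> (\<open>full_simplex.bubble_H10\<close>). They are products of positive parts of barycentric
  coordinates; replacing the positive part by smooth functions that vanish near \<open>0\<close> gives test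
  functions that converge boundedly together with their gradients. The same limit shows that the
  gradient of a bubble has mean zero on its cell, which is the orthogonality behind the bound for \<open>\<kappa>\<close>.

  The splitting of a discrete function into a piecewise affine part and bubbles is unique
  (\<open>mesh.decomposition_unique\<close>), so that \<^const>\<open>kappa\<close> is well defined and linear.
\<close>

section \<open>Square integrable functions\<close>

lemma AE_notin_negligible: "negligible N \<Longrightarrow> AE x in lebesgue. x \<notin> N"
  by (rule AE_not_in) (simp add: negligible_iff_null_sets)

text \<open>Cells are closed and may touch the boundary of the domain, while functions matter only inside the
  domain. The following transfer rules therefore ask for an inclusion up to a null set.\<close>

lemma AE_lebesgue_on_subset:
  assumes "T \<in> sets lebesgue" "S \<in> sets lebesgue" "negligible (T - S)"
    and "AE x in lebesgue_on S. P x"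
  shows "AE x in lebesgue_on T. P x"
proof -
  have "AE x in lebesgue. x \<notin> T - S"
    using assms(3) by (rule AE_notin_negligible)
  moreover have "AE x in lebesgue. x \<in> S \<longrightarrow> P x"
    using assms(2,4) by (simp add: AE_restrict_space_iff)
  ultimately have "AE x in lebesgue. x \<in> T \<longrightarrow> P x"
    by eventually_elim auto
  then show ?thesis
    using assms(1) by (simp add: AE_restrict_space_iff)
qed

lemma borel_measurable_lebesgue_on_subset:
  fixes f :: "'a::euclidean_space \<Rightarrow> 'b::euclidean_space"
  assumes T: "T \<in> sets lebesgue" and S: "S \<in> sets lebesgue" and neg: "negligible (T - S)"
    and f: "f \<in> borel_measurable (lebesgue_on S)"
  shows "f \<in> borel_measurable (lebesgue_on T)"
proof -
  have "f \<in> borel_measurable (lebesgue_on (T \<inter> S))"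
    by (rule measurable_restrict_mono[OF f]) auto
  then have "(\<lambda>x. if x \<in> T \<inter> S then f x else 0) \<in> borel_measurable lebesgue"
    by (intro borel_measurable_if_I) (use T S in auto)
  moreover have "AE x in lebesgue. (if x \<in> T \<inter> S then f x else 0) = (if x \<in> T then f x else 0)"
  proof -
    have "AE x in lebesgue. x \<notin> T - S"
      using neg by (rule AE_notin_negligible)
    then show ?thesis by eventually_elim auto
  qed
  ultimately have "(\<lambda>x. if x \<in> T then f x else 0) \<in> borel_measurable lebesgue"
    by (rule borel_measurable_AE)
  then show ?thesis
    using T borel_measurable_if by blast
qed

lemma integrable_lebesgue_on_subset:
  fixes f :: "'a::euclidean_space \<Rightarrow> 'b::euclidean_space"
  assumes T: "T \<in> sets lebesgue" and S: "S \<in> sets lebesgue" and neg: "negligible (T - S)"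
    and f: "integrable (lebesgue_on S) f"
  shows "integrable (lebesgue_on T) f"
proof -
  have m: "f \<in> borel_measurable (lebesgue_on T)"
    using borel_measurable_lebesgue_on_subset[OF T S neg] f borel_measurable_integrable by blast
  have "AE x in lebesgue. x \<notin> T - S"
    using neg by (rule AE_notin_negligible)
  then have *: "AE x in lebesgue. norm (if x \<in> T then f x else 0) \<le> norm (if x \<in> S then f x else 0)"
    by eventually_elim auto
  have "integrable lebesgue (\<lambda>x. if x \<in> T then f x else 0)"
    by (rule Bochner_Integration.integrable_bound[OF _ _ *])
      (use f m S T in \<open>auto simp: Lebesgue_Measure.integrable_restrict_UNIV borel_measurable_if\<close>)
  then show ?thesis
    using T by (simp add: Lebesgue_Measure.integrable_restrict_UNIV)
qed

lemma integral_lebesgue_on_cong_negligible: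
  fixes f :: "'a::euclidean_space \<Rightarrow> 'b::euclidean_space"
  assumes T: "T \<in> sets lebesgue" and S: "S \<in> sets lebesgue"
    and "negligible (T - S)" "negligible (S - T)"
  shows "integral\<^sup>L (lebesgue_on T) f = integral\<^sup>L (lebesgue_on S) f"
proof (cases "integrable (lebesgue_on S) f")
  case True
  have iT: "integrable (lebesgue_on T) f"
    using integrable_lebesgue_on_subset[OF T S] assms True by blast
  have "AE x in lebesgue. x \<notin> T - S" "AE x in lebesgue. x \<notin> S - T"
    using assms by (blast intro: AE_notin_negligible)+
  then have *: "AE x in lebesgue. (if x \<in> T then f x else 0) = (if x \<in> S then f x else 0)"
    by eventually_elim auto
  have "integral\<^sup>L lebesgue (\<lambda>x. if x \<in> T then f x else 0) = integral\<^sup>L lebesgue (\<lambda>x. if x \<in> S then f x else 0)"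
    by (rule integral_cong_AE[OF _ _ *])
      (use iT True S T in \<open>auto simp: borel_measurable_if\<close>)
  then show ?thesis
    using T S by (simp add: Lebesgue_Measure.integral_restrict_UNIV)
next
  case False
  then have "\<not> integrable (lebesgue_on T) f"
    using integrable_lebesgue_on_subset[OF S T] assms by blast
  with False show ?thesis
    by (simp add: not_integrable_integral_eq)
qed

lemma integral_lebesgue_on_subset_le:
  fixes F :: "'a::euclidean_space \<Rightarrow> real"
  assumes T: "T \<in> sets lebesgue" and S: "S \<in> sets lebesgue" and neg: "negligible (T - S)"
    and F: "integrable (lebesgue_on S) F" and nn: "\<And>x. 0 \<le> F x"
  shows "integral\<^sup>L (lebesgue_on T) F \<le> integral\<^sup>L (lebesgue_on S) F"
proof -
  have eq: "T - T \<inter> S = T - S" "T \<inter> S - T = {}" by auto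
  have "integral\<^sup>L (lebesgue_on T) F = integral\<^sup>L (lebesgue_on (T \<inter> S)) F"
    by (rule integral_lebesgue_on_cong_negligible) (use T S neg eq in auto)
  also have "\<dots> \<le> integral\<^sup>L (lebesgue_on S) F"
    by (rule integral_mono_lebesgue_on_AE) (use T S F nn in auto)
  finally show ?thesis .
qed

text \<open>Cells of a mesh overlap in null sets only, so integrals over the cells add up to at most the
  integral over the domain.\<close>

lemma sum_integral_le_of_almost_disjoint:
  fixes F :: "'a::euclidean_space \<Rightarrow> real"
  assumes fin: "finite \<T>" and T: "\<And>T. T \<in> \<T> \<Longrightarrow> T \<in> sets lebesgue" and S: "S \<in> sets lebesgue"
    and neg: "\<And>T. T \<in> \<T> \<Longrightarrow> negligible (T - S)"
    and disj: "\<And>T T'. T \<in> \<T> \<Longrightarrow> T' \<in> \<T> \<Longrightarrow> T \<noteq> T' \<Longrightarrow> negligible (T \<inter> T')"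
    and F: "integrable (lebesgue_on S) F" and nn: "\<And>x. 0 \<le> F x"
  shows "(\<Sum>T\<in>\<T>. integral\<^sup>L (lebesgue_on T) F) \<le> integral\<^sup>L (lebesgue_on S) F"
proof -
  define N where "N = (\<Union>T\<in>\<T>. T - S) \<union> \<Union>((\<lambda>(T, T'). T \<inter> T') ` {(T, T') \<in> \<T> \<times> \<T>. T \<noteq> T'})"
  have "negligible N"
    unfolding N_def using fin neg disj
    by (intro negligible_Un negligible_Union)
      (auto intro!: finite_imageI finite_subset[OF _ finite_cartesian_product[OF fin fin]])
  then have N: "AE x in lebesgue. x \<notin> N"
    by (rule AE_notin_negligible)
  have "(\<Sum>T\<in>\<T>. integral\<^sup>L (lebesgue_on T) F)
      = (\<Sum>T\<in>\<T>. integral\<^sup>L lebesgue (\<lambda>x. if x \<in> T then F x else 0))"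
    using T by (intro sum.cong) (auto simp: Lebesgue_Measure.integral_restrict_UNIV)
  also have "\<dots> = integral\<^sup>L lebesgue (\<lambda>x. \<Sum>T\<in>\<T>. if x \<in> T then F x else 0)"
  proof (rule Bochner_Integration.integral_sum[symmetric])
    show "integrable lebesgue (\<lambda>x. if x \<in> T then F x else 0)" if "T \<in> \<T>" for T
      using integrable_lebesgue_on_subset[OF T[OF that] S neg[OF that] F] T[OF that]
      by (simp add: Lebesgue_Measure.integrable_restrict_UNIV)
  qed
  also have "\<dots> \<le> integral\<^sup>L lebesgue (\<lambda>x. if x \<in> S then F x else 0)"
  proof (rule integral_mono_AE')
    show "integrable lebesgue (\<lambda>x. if x \<in> S then F x else 0)"
      using F S by (simp add: Lebesgue_Measure.integrable_restrict_UNIV)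
    show "AE x in lebesgue. (\<Sum>T\<in>\<T>. if x \<in> T then F x else 0) \<le> (if x \<in> S then F x else 0)"
      using N
    proof eventually_elim
      case (elim x)
      show ?case
      proof (cases "\<exists>T\<in>\<T>. x \<in> T")
        case True
        then obtain T0 where T0: "T0 \<in> \<T>" "x \<in> T0" by blast
        have "x \<notin> T" if "T \<in> \<T> - {T0}" for T
          using elim T0 that unfolding N_def by blast
        then have "(\<Sum>T\<in>\<T>. if x \<in> T then F x else 0) = F x"
          using fin T0 by (simp add: sum.remove[OF fin T0(1)])
        moreover have "x \<in> S" using elim T0 unfolding N_def by blast
        ultimately show ?thesis by simp
      next
        case False
        then have "(\<Sum>T\<in>\<T>. if x \<in> T then F x else 0) = 0" by (intro sum.neutral) auto
        then show ?thesis using nn by auto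
      qed
    qed
    show "AE x in lebesgue. 0 \<le> (if x \<in> S then F x else 0)" using nn by auto
  qed
  also have "\<dots> = integral\<^sup>L (lebesgue_on S) F"
    using S by (simp add: Lebesgue_Measure.integral_restrict_UNIV)
  finally show ?thesis .
qed

lemma L2_measurable: "f \<in> L2 S \<Longrightarrow> f \<in> borel_measurable (lebesgue_on S)"
  by (simp add: L2_def)

lemma L2_integrable_inner:
  assumes "f \<in> L2 S" "g \<in> L2 S"
  shows "integrable (lebesgue_on S) (\<lambda>x. f x \<bullet> g x)"
proof (rule Bochner_Integration.integrable_bound)
  show "integrable (lebesgue_on S) (\<lambda>x. f x \<bullet> f x + g x \<bullet> g x)"
    using assms by (auto simp: L2_def)
  show "(\<lambda>x. f x \<bullet> g x) \<in> borel_measurable (lebesgue_on S)"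
    using assms by (auto simp: L2_def)
  have "norm (f x \<bullet> g x) \<le> norm (f x \<bullet> f x + g x \<bullet> g x)" for x
  proof -
    have "0 \<le> (f x - g x) \<bullet> (f x - g x)" "0 \<le> (f x + g x) \<bullet> (f x + g x)" by simp_all
    then show ?thesis
      by (simp add: inner_diff inner_add inner_commute)
  qed
  then show "AE x in lebesgue_on S. norm (f x \<bullet> g x) \<le> norm (f x \<bullet> f x + g x \<bullet> g x)" by simp
qed

lemma L2_add [intro]:
  assumes "f \<in> L2 S" "g \<in> L2 S"
  shows "(\<lambda>x. f x + g x) \<in> L2 S"
  using assms L2_integrable_inner[OF assms] L2_integrable_inner[OF assms(2,1)]
  by (auto simp: L2_def inner_add)

lemma L2_scaleR [intro]:
  assumes "f \<in> L2 S"
  shows "(\<lambda>x. c *\<^sub>R f x) \<in> L2 S"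
  using assms by (auto simp: L2_def)

lemma L2_mult [intro]:
  fixes f :: "'a::euclidean_space \<Rightarrow> real"
  shows "f \<in> L2 S \<Longrightarrow> (\<lambda>x. c * f x) \<in> L2 S"
  using L2_scaleR[of f S c] by simp

lemma L2_diff [intro]:
  assumes "f \<in> L2 S" "g \<in> L2 S"
  shows "(\<lambda>x. f x - g x) \<in> L2 S"
  using L2_add[OF assms(1) L2_scaleR[OF assms(2), of "-1"]] by simp

lemma L2_zero [simp]: "(\<lambda>x. 0) \<in> L2 S"
  by (simp add: L2_def)

lemma L2_cong_AE:
  assumes "f \<in> L2 S" "g \<in> borel_measurable (lebesgue_on S)" "AE x in lebesgue_on S. f x = g x"
  shows "g \<in> L2 S"
proof -
  have "integrable (lebesgue_on S) (\<lambda>x. g x \<bullet> g x) \<longleftrightarrow> integrable (lebesgue_on S) (\<lambda>x. f x \<bullet> f x)"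
    by (rule integrable_cong_AE) (use assms in \<open>auto simp: L2_def\<close>)
  then show ?thesis using assms by (simp add: L2_def)
qed

lemma L2_subset:
  assumes "T \<in> sets lebesgue" "S \<in> sets lebesgue" "negligible (T - S)" "f \<in> L2 S"
  shows "f \<in> L2 T"
  using assms borel_measurable_lebesgue_on_subset[OF assms(1-3)] integrable_lebesgue_on_subset[OF assms(1-3)]
  by (auto simp: L2_def)

lemma L2_bounded:
  assumes S: "S \<in> sets lebesgue" "bounded S"
    and "f \<in> borel_measurable (lebesgue_on S)" "\<And>x. x \<in> S \<Longrightarrow> norm (f x) \<le> B"
  shows "f \<in> L2 S"
proof -
  interpret finite_measure "lebesgue_on S"
    using S by (simp add: bounded_set_imp_lmeasurable finite_measure_lebesgue_on)
  have "integrable (lebesgue_on S) (\<lambda>x. f x \<bullet> f x)"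
  proof (rule integrable_const_bound)
    have "f x \<bullet> f x \<le> B\<^sup>2" if "x \<in> S" for x
      using assms(4)[OF that] by (metis norm_ge_zero power_mono power2_norm_eq_inner)
    then show "AE x in lebesgue_on S. norm (f x \<bullet> f x) \<le> B\<^sup>2" by (auto intro!: AE_I2)
  qed (use assms in auto)
  then show ?thesis using assms by (simp add: L2_def)
qed

lemma l2inner_cong_AE:
  assumes "f \<in> L2 S" "g \<in> L2 S" "f' \<in> L2 S" "g' \<in> L2 S"
    "AE x in lebesgue_on S. f x = f' x" "AE x in lebesgue_on S. g x = g' x"
  shows "l2inner S f g = l2inner S f' g'"
  unfolding l2inner_def
  by (rule integral_cong_AE) (use assms in \<open>auto simp: L2_def\<close>)

lemma l2norm_cong_AE:
  assumes "f \<in> L2 S" "g \<in> L2 S" "AE x in lebesgue_on S. f x = g x"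
  shows "l2norm S f = l2norm S g"
  unfolding l2norm_def using l2inner_cong_AE assms by metis

lemma l2inner_commute: "l2inner S f g = l2inner S g f"
  by (simp add: l2inner_def inner_commute)

lemma l2inner_add_left:
  assumes "f \<in> L2 S" "g \<in> L2 S" "k \<in> L2 S"
  shows "l2inner S (\<lambda>x. f x + g x) k = l2inner S f k + l2inner S g k"
  unfolding l2inner_def
  by (simp add: inner_add_left Bochner_Integration.integral_add L2_integrable_inner assms)

lemma l2inner_scaleR_left: "l2inner S (\<lambda>x. c *\<^sub>R f x) k = c * l2inner S f k"
  unfolding l2inner_def by simp

lemma l2inner_diff_left:
  assumes "f \<in> L2 S" "g \<in> L2 S" "k \<in> L2 S"
  shows "l2inner S (\<lambda>x. f x - g x) k = l2inner S f k - l2inner S g k"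
  unfolding l2inner_def
  by (simp add: inner_diff_left Bochner_Integration.integral_diff L2_integrable_inner assms)

lemma l2inner_add_right:
  assumes "f \<in> L2 S" "g \<in> L2 S" "k \<in> L2 S"
  shows "l2inner S k (\<lambda>x. f x + g x) = l2inner S k f + l2inner S k g"
  using l2inner_add_left[OF assms] by (simp add: l2inner_commute)

lemma l2inner_diff_right:
  assumes "f \<in> L2 S" "g \<in> L2 S" "k \<in> L2 S"
  shows "l2inner S k (\<lambda>x. f x - g x) = l2inner S k f - l2inner S k g"
  using l2inner_diff_left[OF assms] by (simp add: l2inner_commute)

lemma l2inner_nonneg [simp]: "0 \<le> l2inner S f f"
  by (simp add: l2inner_def)

lemma l2norm_nonneg [simp]: "0 \<le> l2norm S f"
  by (simp add: l2norm_def)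

lemma l2norm_power2: "(l2norm S f)\<^sup>2 = l2inner S f f"
  by (simp add: l2norm_def)

text \<open>The quadratic \<open>\<parallel>s f - t g\<parallel>\<^sup>2\<close> in \<open>s\<close> and \<open>t\<close> is nonnegative; its discriminant gives the inequality.\<close>

lemma l2inner_Cauchy_Schwarz:
  assumes f: "f \<in> L2 S" and g: "g \<in> L2 S"
  shows "\<bar>l2inner S f g\<bar> \<le> l2norm S f * l2norm S g"
proof -
  define a b c where "a = l2inner S f f" and "b = l2inner S f g" and "c = l2inner S g g"
  have a: "0 \<le> a" and c: "0 \<le> c" by (simp_all add: a_def c_def)
  have quad: "0 \<le> s\<^sup>2 * a - 2 * s * t * b + t\<^sup>2 * c" for s t
  proof -
    have "0 \<le> l2inner S (\<lambda>x. s *\<^sub>R f x - t *\<^sub>R g x) (\<lambda>x. s *\<^sub>R f x - t *\<^sub>R g x)" by simp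
    also have "\<dots> = s\<^sup>2 * a - 2 * s * t * b + t\<^sup>2 * c"
    proof -
      let ?F = "\<lambda>x. s *\<^sub>R f x" and ?G = "\<lambda>x. t *\<^sub>R g x"
      have L: "?F \<in> L2 S" "?G \<in> L2 S" "(\<lambda>x. ?F x - ?G x) \<in> L2 S" using f g by auto
      have "l2inner S ?F ?F = s\<^sup>2 * a" "l2inner S ?F ?G = s * t * b"
        "l2inner S ?G ?F = s * t * b" "l2inner S ?G ?G = t\<^sup>2 * c"
        by (simp_all add: l2inner_def a_def b_def c_def power2_eq_square inner_commute)
      then show ?thesis
        using L by (simp add: l2inner_diff_left[OF L(1,2,3)] l2inner_diff_right[OF L(1,2,1)]
          l2inner_diff_right[OF L(1,2,2)] algebra_simps)
    qed
    finally show ?thesis .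
  qed
  have "b\<^sup>2 \<le> a * c"
  proof (cases "c = 0")
    case True
    have "b = 0"
    proof (rule ccontr)
      assume "b \<noteq> 0"
      have "0 \<le> 1\<^sup>2 * a - 2 * 1 * ((a + 1) / b) * b + ((a + 1) / b)\<^sup>2 * c" by (rule quad)
      then have "0 \<le> a - 2 * (a + 1)" using True \<open>b \<noteq> 0\<close> by simp
      with a show False by simp
    qed
    then show ?thesis using True by simp
  next
    case False
    then have "c > 0" using c by simp
    have "0 \<le> c * (c * a - b\<^sup>2)"
      using quad[of c b] by (simp add: algebra_simps power2_eq_square)
    then show ?thesis using \<open>c > 0\<close> by (simp add: zero_le_mult_iff mult.commute)
  qed
  then have "sqrt (b\<^sup>2) \<le> sqrt (a * c)" by (rule real_sqrt_le_mono)
  then show ?thesis by (simp add: real_sqrt_mult a_def b_def c_def l2norm_def)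
qed

lemma l2norm_triangle:
  assumes f: "f \<in> L2 S" and g: "g \<in> L2 S"
  shows "l2norm S (\<lambda>x. f x + g x) \<le> l2norm S f + l2norm S g"
proof (rule power2_le_imp_le)
  have "(l2norm S (\<lambda>x. f x + g x))\<^sup>2 = l2inner S f f + 2 * l2inner S f g + l2inner S g g"
    using f g by (simp add: l2norm_power2 l2inner_add_left l2inner_add_right L2_add l2inner_commute[of S g f])
  also have "\<dots> \<le> (l2norm S f)\<^sup>2 + 2 * (l2norm S f * l2norm S g) + (l2norm S g)\<^sup>2"
    using l2inner_Cauchy_Schwarz[OF f g] by (simp add: l2norm_power2)
  finally show "(l2norm S (\<lambda>x. f x + g x))\<^sup>2 \<le> (l2norm S f + l2norm S g)\<^sup>2"
    by (simp add: power2_sum)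
qed simp

lemma l2norm_scaleR: "l2norm S (\<lambda>x. c *\<^sub>R f x) = \<bar>c\<bar> * l2norm S f"
  by (simp add: l2norm_def l2inner_def real_sqrt_mult flip: mult.assoc)

lemma l2norm_mult: "l2norm S (\<lambda>x. c * f x :: real) = \<bar>c\<bar> * l2norm S f"
  using l2norm_scaleR[of S c f] by simp

lemma l2norm_minus: "l2norm S (\<lambda>x. - f x) = l2norm S f"
  by (simp add: l2norm_def l2inner_def)

lemma l2norm_triangle_diff:
  assumes "f \<in> L2 S" "g \<in> L2 S"
  shows "l2norm S (\<lambda>x. f x - g x) \<le> l2norm S f + l2norm S g"
  using l2norm_triangle[OF assms(1) L2_scaleR[OF assms(2), of "-1"]] by (simp add: l2norm_minus)

lemma l2norm_le_bound:
  assumes f: "f \<in> L2 S" and g: "g \<in> L2 S" and B: "0 \<le> B"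
    and le: "AE x in lebesgue_on S. norm (f x) \<le> B * norm (g x)"
  shows "l2norm S f \<le> B * l2norm S g"
proof (rule power2_le_imp_le)
  have "l2inner S f f \<le> (LINT x|lebesgue_on S. B\<^sup>2 * (g x \<bullet> g x))"
    unfolding l2inner_def
  proof (rule integral_mono_AE)
    show "AE x in lebesgue_on S. f x \<bullet> f x \<le> B\<^sup>2 * (g x \<bullet> g x)"
      using le
    proof eventually_elim
      case (elim x)
      then have "(norm (f x))\<^sup>2 \<le> (B * norm (g x))\<^sup>2" by (simp add: power_mono)
      then show ?case by (simp add: power_mult_distrib power2_norm_eq_inner)
    qed
  qed (use f g in \<open>auto simp: L2_def\<close>)
  then show "(l2norm S f)\<^sup>2 \<le> (B * l2norm S g)\<^sup>2"
    by (simp add: power_mult_distrib l2norm_power2 l2inner_def)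
qed (use B in simp)

lemma l2norm_subset_le:
  assumes "T \<in> sets lebesgue" "S \<in> sets lebesgue" "negligible (T - S)" "f \<in> L2 S"
  shows "l2norm T f \<le> l2norm S f"
  unfolding l2norm_def l2inner_def
  using assms integral_lebesgue_on_subset_le[OF assms(1-3), of "\<lambda>x. f x \<bullet> f x"]
  by (auto simp: L2_def)

lemma l2inner_cong_negligible:
  assumes "T \<in> sets lebesgue" "S \<in> sets lebesgue" "negligible (T - S)" "negligible (S - T)"
  shows "l2inner T f g = l2inner S f g"
  unfolding l2inner_def by (rule integral_lebesgue_on_cong_negligible) (use assms in auto)

lemma l2norm_eq_0_imp_AE:
  assumes "f \<in> L2 S" "l2norm S f = 0"
  shows "AE x in lebesgue_on S. f x = 0"
proof -
  have "AE x in lebesgue_on S. f x \<bullet> f x = 0"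
    using assms integral_nonneg_eq_0_iff_AE[of "lebesgue_on S" "\<lambda>x. f x \<bullet> f x"]
    by (auto simp: L2_def l2norm_def l2inner_def)
  then show ?thesis by simp
qed

text \<open>Bounded convergence. Together with the same fact for gradients it turns pointwise approximation
  by test functions into approximation in the \<open>H\<^sup>1\<close> norm.\<close>

lemma l2norm_tendsto_0_bounded:
  fixes F :: "nat \<Rightarrow> 'a::euclidean_space \<Rightarrow> 'b::euclidean_space"
  assumes S: "S \<in> sets lebesgue" "bounded S"
    and F: "\<And>n. F n \<in> borel_measurable (lebesgue_on S)"
    and lim: "\<And>x. x \<in> S \<Longrightarrow> (\<lambda>n. F n x) \<longlonglongrightarrow> 0"
    and bd: "\<And>n x. x \<in> S \<Longrightarrow> norm (F n x) \<le> B"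
  shows "(\<lambda>n. l2norm S (F n)) \<longlonglongrightarrow> 0"
proof -
  interpret finite_measure "lebesgue_on S"
    using S by (simp add: bounded_set_imp_lmeasurable finite_measure_lebesgue_on)
  have "(\<lambda>n. LINT x|lebesgue_on S. F n x \<bullet> F n x) \<longlonglongrightarrow> (LINT x|lebesgue_on S. 0)"
  proof (rule integral_dominated_convergence[where w="\<lambda>_. B\<^sup>2"])
    show "AE x in lebesgue_on S. (\<lambda>n. F n x \<bullet> F n x) \<longlonglongrightarrow> 0"
    proof (rule AE_I2)
      fix x assume "x \<in> space (lebesgue_on S)"
      then have "(\<lambda>n. F n x \<bullet> F n x) \<longlonglongrightarrow> 0 \<bullet> (0::'b)" by (intro tendsto_inner lim) auto
      then show "(\<lambda>n. F n x \<bullet> F n x) \<longlonglongrightarrow> 0" by simp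
    qed
    have "F n x \<bullet> F n x \<le> B\<^sup>2" if "x \<in> S" for n x
      using bd[OF that] by (metis norm_ge_zero power_mono power2_norm_eq_inner)
    then show "AE x in lebesgue_on S. norm (F n x \<bullet> F n x) \<le> B\<^sup>2" for n by (auto intro!: AE_I2)
  qed (use F in auto)
  then have "(\<lambda>n. sqrt (LINT x|lebesgue_on S. F n x \<bullet> F n x)) \<longlonglongrightarrow> sqrt 0"
    by (intro tendsto_real_sqrt) simp
  then show ?thesis by (simp add: l2norm_def l2inner_def)
qed

section \<open>Smooth functions\<close>

definition smooth :: "('a::euclidean_space \<Rightarrow> real) \<Rightarrow> bool" where
  "smooth f \<longleftrightarrow> (\<forall>k. Ck k f)"

definition grad :: "('a::euclidean_space \<Rightarrow> real) \<Rightarrow> 'a \<Rightarrow> 'a" where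
  "grad f x = (\<Sum>i\<in>Basis. frechet_derivative f (at x) i *\<^sub>R i)"

lemma grad_inner: "i \<in> Basis \<Longrightarrow> grad f x \<bullet> i = frechet_derivative f (at x) i"
  by (simp add: grad_def inner_sum_left_Basis)

lemma frechet_derivative_eqI: "(f has_derivative f') (at x) \<Longrightarrow> frechet_derivative f (at x) = f'"
  by (metis frechet_derivative_at)

lemma Ck_SucI:
  assumes "\<And>x. (f has_derivative f' x) (at x)" "\<And>i. i \<in> Basis \<Longrightarrow> Ck k (\<lambda>x. f' x i)"
  shows "Ck (Suc k) f"
proof -
  have "(\<lambda>x. frechet_derivative f (at x) i) = (\<lambda>x. f' x i)" for i
    by (simp add: frechet_derivative_eqI[OF assms(1)])
  moreover have "f differentiable at x" for x
    using assms(1) by (auto simp: differentiable_def)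
  ultimately show ?thesis using assms(2) by simp
qed

lemma Ck_SucD:
  assumes "Ck (Suc k) f"
  shows "(f has_derivative frechet_derivative f (at x)) (at x)"
    and "i \<in> Basis \<Longrightarrow> Ck k (\<lambda>x. frechet_derivative f (at x) i)"
  using assms by (auto simp: frechet_derivative_works)

lemma Ck_Suc_imp: "Ck (Suc k) f \<Longrightarrow> Ck k f"
proof (induction k arbitrary: f)
  case 0
  then have "f differentiable at x" for x by simp
  then show ?case
    by (auto intro!: continuous_at_imp_continuous_on differentiable_imp_continuous_within)
next
  case (Suc k)
  then show ?case
    by (metis Ck.simps(2))
qed

lemma Ck_const [simp]: "Ck k (\<lambda>x. c)"
proof (induction k arbitrary: c)
  case (Suc k)
  show ?case
    by (rule Ck_SucI[where f' = "\<lambda>_ _. 0"]) (use Suc in auto)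
qed simp

lemma Ck_affine [simp]: "Ck k (\<lambda>x. a \<bullet> x + c)"
proof (cases k)
  case (Suc m)
  show ?thesis unfolding Suc
    by (rule Ck_SucI[where f' = "\<lambda>_ h. a \<bullet> h"]) (auto intro!: derivative_eq_intros)
qed (auto intro!: continuous_intros)

lemma Ck_add: "Ck k f \<Longrightarrow> Ck k g \<Longrightarrow> Ck k (\<lambda>x. f x + g x)"
proof (induction k arbitrary: f g)
  case 0
  then show ?case by (auto intro!: continuous_intros)
next
  case (Suc k)
  show ?case
    by (rule Ck_SucI[where f' = "\<lambda>x h. frechet_derivative f (at x) h + frechet_derivative g (at x) h"])
      (use Ck_SucD[OF Suc.prems(1)] Ck_SucD[OF Suc.prems(2)] Suc.IH in
        \<open>auto intro!: has_derivative_add\<close>)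
qed

lemma Ck_mult: "Ck k f \<Longrightarrow> Ck k g \<Longrightarrow> Ck k (\<lambda>x. f x * g x)"
proof (induction k arbitrary: f g)
  case 0
  then show ?case by (auto intro!: continuous_intros)
next
  case (Suc k)
  show ?case
    by (rule Ck_SucI[where f' = "\<lambda>x h. f x * frechet_derivative g (at x) h + frechet_derivative f (at x) h * g x"])
      (use Ck_SucD[OF Suc.prems(1)] Ck_SucD[OF Suc.prems(2)] Suc.IH Ck_Suc_imp[OF Suc.prems(1)]
        Ck_Suc_imp[OF Suc.prems(2)] in
        \<open>auto intro!: has_derivative_mult Ck_add\<close>)
qed

lemma smooth_const [simp]: "smooth (\<lambda>x. c)"
  and smooth_affine [simp]: "smooth (\<lambda>x. a \<bullet> x + c)"
  and smooth_add: "smooth f \<Longrightarrow> smooth g \<Longrightarrow> smooth (\<lambda>x. f x + g x)"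
  and smooth_mult: "smooth f \<Longrightarrow> smooth g \<Longrightarrow> smooth (\<lambda>x. f x * g x)"
  by (auto simp: smooth_def intro: Ck_add Ck_mult)

lemma smooth_prod: "(\<And>i. i \<in> I \<Longrightarrow> smooth (f i)) \<Longrightarrow> smooth (\<lambda>x. \<Prod>i\<in>I. f i x)"
  by (induction I rule: infinite_finite_induct) (auto intro: smooth_mult)

lemma smooth_has_derivative: "smooth f \<Longrightarrow> (f has_derivative frechet_derivative f (at x)) (at x)"
  unfolding smooth_def using Ck_SucD(1) by blast

lemma smooth_continuous: "smooth f \<Longrightarrow> continuous_on A f"
  unfolding smooth_def using Ck.simps(1) continuous_on_subset by blast

lemma smooth_partial: "smooth f \<Longrightarrow> i \<in> Basis \<Longrightarrow> smooth (\<lambda>x. frechet_derivative f (at x) i)"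
  unfolding smooth_def using Ck_SucD(2) by blast

lemma continuous_on_grad: "smooth f \<Longrightarrow> continuous_on A (grad f)"
  unfolding grad_def by (intro continuous_intros) (auto intro: smooth_continuous smooth_partial)

lemma grad_eqI:
  assumes "(f has_derivative (\<lambda>h. d \<bullet> h)) (at x)"
  shows "grad f x = d"
  using assms by (simp add: grad_def frechet_derivative_eqI euclidean_representation)

lemma grad_works:
  assumes "smooth f"
  shows "(f has_derivative (\<lambda>h. grad f x \<bullet> h)) (at x)"
proof -
  let ?D = "frechet_derivative f (at x)"
  have D: "(f has_derivative ?D) (at x)" by (rule smooth_has_derivative[OF assms])
  then interpret bounded_linear ?D by (rule has_derivative_bounded_linear)
  have "?D h = grad f x \<bullet> h" for h
  proof -
    have "?D h = ?D (\<Sum>i\<in>Basis. (h \<bullet> i) *\<^sub>R i)" by (simp add: euclidean_representation)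
    also have "\<dots> = (\<Sum>i\<in>Basis. (h \<bullet> i) * ?D i)" by (simp add: sum scaleR)
    also have "\<dots> = grad f x \<bullet> h"
      by (simp add: grad_def inner_sum_left inner_commute[of h] mult.commute)
    finally show ?thesis .
  qed
  then have "?D = (\<lambda>h. grad f x \<bullet> h)" by auto
  with D show ?thesis by simp
qed

lemma grad_affine: "grad (\<lambda>x. a \<bullet> x + c) x = a"
  by (rule grad_eqI) (auto intro!: derivative_eq_intros)

lemma grad_mult:
  "smooth f \<Longrightarrow> smooth g \<Longrightarrow> grad (\<lambda>x. f x * g x) x = f x *\<^sub>R grad g x + g x *\<^sub>R grad f x"
  by (rule grad_eqI) (auto intro!: derivative_eq_intros grad_works simp: inner_add_left algebra_simps)

subsection \<open>Flat functions\<close>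

text \<open>The functions \<open>t \<mapsto> p(1/t) exp(-1/t)\<close>, continued by \<open>0\<close> to \<open>t \<le> 0\<close>, are closed under
  differentiation; this makes all of them smooth at \<open>0\<close>.\<close>

definition flat :: "real poly \<Rightarrow> real \<Rightarrow> real" where
  "flat p t = (if t \<le> 0 then 0 else poly p (1 / t) * exp (- 1 / t))"

text \<open>With \<open>y = 1/t\<close> this is the decay of \<open>p(y) exp(-y)\<close> at infinity.\<close>

lemma flat_tendsto_0: "(flat p \<longlongrightarrow> 0) (at_right 0)"
proof -
  have "((\<lambda>y. \<Sum>i\<le>degree p. coeff p i * (y ^ i / exp y)) \<longlongrightarrow> (\<Sum>i\<le>degree p. coeff p i * 0)) at_top"
    by (intro tendsto_intros tendsto_power_div_exp_0)
  then have "((\<lambda>y. poly p y * exp (- y)) \<longlongrightarrow> 0) at_top"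
    by (simp add: poly_altdef exp_minus sum_distrib_right divide_inverse mult.assoc)
  then have "((\<lambda>t. poly p (inverse t) * exp (- inverse t)) \<longlongrightarrow> 0) (at_right 0)"
    by (rule filterlim_compose[OF _ filterlim_inverse_at_top_right])
  moreover have "eventually (\<lambda>t. poly p (inverse t) * exp (- inverse t) = flat p t) (at_right 0)"
    using eventually_at_right_less[of 0] by eventually_elim (auto simp: flat_def inverse_eq_divide)
  ultimately show ?thesis by (rule Lim_transform_eventually)
qed

text \<open>The chain rule gives \<open>1/t\<^sup>2\<close> times \<open>p - p'\<close>, evaluated at \<open>1/t\<close>. At \<open>0\<close> the difference quotient of
  \<open>flat p\<close> is itself a flat function, for the polynomial \<open>p\<close> times the variable, and tends to \<open>0\<close>.\<close>

lemma flat_has_derivative: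
  "(flat p has_real_derivative flat ([:0, 0, 1:] * (p - pderiv p)) t) (at t)"
proof -
  consider "t < 0" | "t = 0" | "t > 0" by linarith
  then show ?thesis
  proof cases
    case 1
    have "((\<lambda>_. 0) has_real_derivative 0) (at t)" by simp
    then have "(flat p has_real_derivative 0) (at t)"
      by (rule DERIV_cong_ev[THEN iffD1, rotated -1, OF _ refl _ refl])
        (use 1 in \<open>auto simp: flat_def eventually_nhds intro!: exI[of _ "{..<0}"]\<close>)
    with 1 show ?thesis by (simp add: flat_def)
  next
    case 2
    have "((\<lambda>h. (flat p (0 + h) - flat p 0) / h) \<longlongrightarrow> 0) (at 0)"
    proof (rule filterlim_split_at)
      have "eventually (\<lambda>h. 0 = (flat p (0 + h) - flat p 0) / h) (at_left (0::real))"
        unfolding eventually_at_filter by (auto simp: flat_def)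
      then show "((\<lambda>h. (flat p (0 + h) - flat p 0) / h) \<longlongrightarrow> 0) (at_left 0)"
        by (rule Lim_transform_eventually[OF tendsto_const])
      have "eventually (\<lambda>h. flat (p * [:0, 1:]) h = (flat p (0 + h) - flat p 0) / h) (at_right (0::real))"
        unfolding eventually_at_filter by (auto simp: flat_def)
      then show "((\<lambda>h. (flat p (0 + h) - flat p 0) / h) \<longlongrightarrow> 0) (at_right 0)"
        by (rule Lim_transform_eventually[OF flat_tendsto_0])
    qed
    then show ?thesis
      using 2 by (simp add: DERIV_def flat_def)
  next
    case 3
    have "((\<lambda>t. poly p (1 / t) * exp (- 1 / t)) has_real_derivative
        poly p (1 / t) * (exp (- 1 / t) * (1 / t\<^sup>2)) + (poly (pderiv p) (1 / t) * (- 1 / t\<^sup>2)) * exp (- 1 / t)) (at t)"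
      using 3 by (auto intro!: derivative_eq_intros DERIV_chain2[OF poly_DERIV] simp: power2_eq_square)
    moreover have "poly p (1 / t) * (exp (- 1 / t) * (1 / t\<^sup>2)) + (poly (pderiv p) (1 / t) * (- 1 / t\<^sup>2)) * exp (- 1 / t)
      = flat ([:0, 0, 1:] * (p - pderiv p)) t"
      using 3 by (simp add: flat_def power2_eq_square field_simps)
    ultimately have "((\<lambda>t. poly p (1 / t) * exp (- 1 / t)) has_real_derivative flat ([:0, 0, 1:] * (p - pderiv p)) t) (at t)"
      by simp
    then show ?thesis
      by (rule DERIV_cong_ev[THEN iffD1, rotated -1, OF _ refl _ refl])
        (use 3 in \<open>auto simp: flat_def eventually_nhds intro!: exI[of _ "{0<..}"]\<close>)
  qed
qed

lemma smooth_flat: "smooth (\<lambda>x. flat p (a \<bullet> x + c))"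
proof -
  have D: "((\<lambda>x. flat p (a \<bullet> x + c)) has_derivative
      (\<lambda>h. flat ([:0, 0, 1:] * (p - pderiv p)) (a \<bullet> x + c) * (a \<bullet> h))) (at x)" for p x
  proof -
    have "(flat p has_derivative (\<lambda>h. flat ([:0, 0, 1:] * (p - pderiv p)) (a \<bullet> x + c) * h)) (at (a \<bullet> x + c))"
      using flat_has_derivative[of p "a \<bullet> x + c"] by (simp add: has_field_derivative_def)
    then show ?thesis
      by (rule has_derivative_compose[where f = "\<lambda>x. a \<bullet> x + c" and f' = "\<lambda>h. a \<bullet> h", rotated])
        (auto intro!: derivative_eq_intros)
  qed
  have "Ck k (\<lambda>x. flat p (a \<bullet> x + c))" for k
  proof (induction k arbitrary: p)
    case 0
    show ?case
      using has_derivative_continuous_on[OF has_derivative_at_withinI[OF D]] by simp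
  next
    case (Suc k)
    show ?case
      by (rule Ck_SucI[OF D]) (intro Ck_mult Suc.IH Ck_const)
  qed
  then show ?thesis by (simp add: smooth_def)
qed

lemma flat_1_bounds: "0 \<le> flat 1 t" "flat 1 t \<le> 1"
  by (auto simp: flat_def)

lemma flat_1_scaled_tendsto: "(\<lambda>n. flat 1 (real n * s)) \<longlonglongrightarrow> (if s > 0 then 1 else 0)"
proof (cases "s > 0")
  case True
  have "(\<lambda>n. exp (- (inverse s * (1 / real n)))) \<longlonglongrightarrow> exp (- (inverse s * 0))"
    by (intro tendsto_intros lim_1_over_n)
  moreover have "eventually (\<lambda>n. exp (- (inverse s * (1 / real n))) = flat 1 (real n * s)) sequentially"
    using eventually_gt_at_top[of 0] by eventually_elim (use True in \<open>auto simp: flat_def field_simps mult_le_0_iff\<close>)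
  ultimately show ?thesis using True by (simp add: Lim_transform_eventually)
next
  case False
  then have "flat 1 (real n * s) = 0" for n by (simp add: flat_def mult_le_0_iff)
  with False show ?thesis by simp
qed

section \<open>Test functions and integration by parts\<close>

lemma test_functions_smooth: "\<phi> \<in> test_functions \<Omega> \<Longrightarrow> smooth \<phi>"
  by (simp add: test_functions_def smooth_def)

lemma test_functions_support:
  assumes "\<phi> \<in> test_functions \<Omega>"
  obtains K where "compact K" "K \<subseteq> \<Omega>" "\<And>x. x \<notin> K \<Longrightarrow> \<phi> x = 0"
  using assms by (auto simp: test_functions_def)

lemma test_functionsI:
  "smooth \<phi> \<Longrightarrow> compact K \<Longrightarrow> K \<subseteq> \<Omega> \<Longrightarrow> (\<And>x. x \<notin> K \<Longrightarrow> \<phi> x = 0) \<Longrightarrow> \<phi> \<in> test_functions \<Omega>"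
  by (auto simp: test_functions_def smooth_def)

lemma test_functions_mono: "S \<subseteq> \<Omega> \<Longrightarrow> test_functions S \<subseteq> test_functions \<Omega>"
  by (auto simp: test_functions_def)

lemma test_functions_mult_smooth:
  assumes "smooth f" "\<phi> \<in> test_functions \<Omega>"
  shows "(\<lambda>x. f x * \<phi> x) \<in> test_functions \<Omega>"
  using assms(2)
  by (rule test_functions_support)
    (auto intro!: test_functionsI smooth_mult assms test_functions_smooth[OF assms(2)])

lemma test_functions_add:
  assumes "\<phi> \<in> test_functions \<Omega>" "\<psi> \<in> test_functions \<Omega>"
  shows "(\<lambda>x. \<phi> x + \<psi> x) \<in> test_functions \<Omega>"
proof -
  obtain K where K: "compact K" "K \<subseteq> \<Omega>" "\<And>x. x \<notin> K \<Longrightarrow> \<phi> x = 0"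
    using test_functions_support[OF assms(1)] by metis
  obtain L where L: "compact L" "L \<subseteq> \<Omega>" "\<And>x. x \<notin> L \<Longrightarrow> \<psi> x = 0"
    using test_functions_support[OF assms(2)] by metis
  have "smooth (\<lambda>x. \<phi> x + \<psi> x)"
    using assms[THEN test_functions_smooth] by (rule smooth_add)
  then show ?thesis
    by (rule test_functionsI[of _ "K \<union> L" \<Omega>]) (use K L in \<open>auto intro!: compact_Un\<close>)
qed

lemma grad_eq_0_outside:
  assumes "compact K" "\<And>x. x \<notin> K \<Longrightarrow> \<phi> x = 0" "x \<notin> K"
  shows "grad \<phi> x = 0"
proof (rule grad_eqI)
  have "((\<lambda>_. 0) has_derivative (\<lambda>h. 0 \<bullet> h)) (at x)" by simp
  then show "(\<phi> has_derivative (\<lambda>h. 0 \<bullet> h)) (at x)"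
    by (rule has_derivative_transform_within_open[where s = "- K"])
      (use assms in \<open>auto simp: compact_imp_closed open_Compl\<close>)
qed

lemma integrable_continuous_compact_support:
  fixes f :: "'a::euclidean_space \<Rightarrow> 'b::euclidean_space"
  assumes "continuous_on UNIV f" "compact K" "\<And>x. x \<notin> K \<Longrightarrow> f x = 0"
  shows "integrable lborel f"
proof -
  have "integrable lborel (\<lambda>x. indicator K x *\<^sub>R f x)"
    by (rule borel_integrable_compact) (use assms continuous_on_subset[OF assms(1)] in auto)
  moreover have "(\<lambda>x. indicator K x *\<^sub>R f x) = f"
    using assms(3) by (auto simp: indicator_def)
  ultimately show ?thesis by simp
qed

lemma loc_integrable_continuous:
  fixes f :: "'a::euclidean_space \<Rightarrow> 'b::euclidean_space"
  assumes "continuous_on UNIV f"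
  shows "loc_integrable \<Omega> f"
  unfolding loc_integrable_def
proof (intro allI impI)
  fix K :: "'a set" assume K: "compact K \<and> K \<subseteq> \<Omega>"
  have "integrable lborel (\<lambda>x. indicator K x *\<^sub>R f x)"
    by (rule borel_integrable_compact) (use continuous_on_subset[OF assms] K in auto)
  then have "integrable lebesgue (\<lambda>x. indicator K x *\<^sub>R f x)"
    by (simp add: integrable_completion)
  then show "integrable (lebesgue_on K) f"
    using K by (simp add: integrable_restrict_space lmeasurable_compact fmeasurableD)
qed

lemma integral_lborel_translate:
  fixes f :: "'a::euclidean_space \<Rightarrow> real"
  assumes [measurable]: "f \<in> borel_measurable borel"
  shows "(LINT x|lborel. f (c + x)) = (LINT x|lborel. f x)"
proof -
  have "(LINT x|distr lborel borel ((+) c). f x) = (LINT x|lborel. f (c + x))"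
    by (rule integral_distr) auto
  then show ?thesis by (simp add: lborel_distr_plus)
qed

lemma integrable_lborel_translate:
  fixes f :: "'a::euclidean_space \<Rightarrow> real"
  assumes "integrable lborel f"
  shows "integrable lborel (\<lambda>x. f (c + x))"
proof -
  have [measurable]: "f \<in> borel_measurable borel" using assms by auto
  have "integrable (distr lborel borel ((+) c)) f = integrable lborel (\<lambda>x. f (c + x))"
    by (rule integrable_distr_eq) auto
  then show ?thesis using assms by (simp add: lborel_distr_plus)
qed

text \<open>Translation invariance of the Lebesgue measure makes every difference quotient integrate
  to zero; the partial derivative is their dominated limit.\<close>

lemma integral_partial_derivative_eq_0:
  fixes \<eta> :: "'a::euclidean_space \<Rightarrow> real"
  assumes \<eta>: "smooth \<eta>" and K: "compact K" "\<And>x. x \<notin> K \<Longrightarrow> \<eta> x = 0" and i: "i \<in> Basis"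
  shows "(LINT x|lborel. grad \<eta> x \<bullet> i) = 0"
proof -
  have cont: "continuous_on UNIV \<eta>" using \<eta> by (rule smooth_continuous)
  have gcont: "continuous_on A (\<lambda>x. grad \<eta> x \<bullet> i)" for A
    using \<eta> by (intro continuous_intros continuous_on_grad)
  have [measurable]: "\<eta> \<in> borel_measurable borel" "(\<lambda>x. grad \<eta> x \<bullet> i) \<in> borel_measurable borel"
    using cont gcont borel_measurable_continuous_onI by blast+
  have \<eta>int: "integrable lborel \<eta>"
    using integrable_continuous_compact_support[OF cont K] by blast
  obtain R where R: "K \<subseteq> cball 0 R"
    using bounded_subset_ballD[OF compact_imp_bounded[OF K(1)], of 0] ball_subset_cball by blast
  obtain M where M: "\<And>x. \<bar>grad \<eta> x \<bullet> i\<bar> \<le> M" and "0 \<le> M"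
  proof -
    have "compact ((\<lambda>x. grad \<eta> x \<bullet> i) ` K)" using K(1) gcont by (rule compact_continuous_image[rotated])
    then obtain B where B: "\<forall>y\<in>(\<lambda>x. grad \<eta> x \<bullet> i) ` K. norm y \<le> B"
      using compact_imp_bounded bounded_iff by metis
    have "\<bar>grad \<eta> x \<bullet> i\<bar> \<le> max B 0" for x
      using B grad_eq_0_outside[of K \<eta> x, OF K] by (cases "x \<in> K") fastforce+
    then show ?thesis using that[of "max B 0"] by simp
  qed
  define F where "F n x = real (Suc n) * (\<eta> ((1 / real (Suc n)) *\<^sub>R i + x) - \<eta> x)" for n x
  have line: "((\<lambda>t. \<eta> (t *\<^sub>R i + x)) has_real_derivative grad \<eta> (t *\<^sub>R i + x) \<bullet> i) (at t)" for x t
  proof -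
    have "((\<lambda>t. \<eta> (t *\<^sub>R i + x)) has_derivative (\<lambda>s. grad \<eta> (t *\<^sub>R i + x) \<bullet> (s *\<^sub>R i))) (at t)"
      by (rule has_derivative_compose[OF _ grad_works[OF \<eta>]]) (auto intro!: derivative_eq_intros)
    then show ?thesis by (simp add: has_field_derivative_def mult.commute[of "_ \<bullet> _"] mult_commute_abs)
  qed
  have Fint: "(LINT x|lborel. F n x) = 0" for n
    unfolding F_def
    by (simp add: Bochner_Integration.integral_diff integrable_lborel_translate \<eta>int integral_lborel_translate)
  have "(\<lambda>n. LINT x|lborel. F n x) \<longlonglongrightarrow> (LINT x|lborel. grad \<eta> x \<bullet> i)"
  proof (rule integral_dominated_convergence[where w = "\<lambda>x. indicator (cball 0 (R + 1)) x *\<^sub>R M"])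
    show "integrable lborel (\<lambda>x::'a. indicat_real (cball 0 (R + 1)) x *\<^sub>R M)"
      by (rule borel_integrable_compact) auto
    show "AE x in lborel. (\<lambda>n. F n x) \<longlonglongrightarrow> grad \<eta> x \<bullet> i"
    proof (rule AE_I2)
      fix x
      have "((\<lambda>h. (\<eta> ((0 + h) *\<^sub>R i + x) - \<eta> (0 *\<^sub>R i + x)) / h) \<longlongrightarrow> grad \<eta> (0 *\<^sub>R i + x) \<bullet> i) (at 0)"
        using line[of x 0] unfolding DERIV_def .
      moreover have "filterlim (\<lambda>n. 1 / real (Suc n)) (at 0) sequentially"
        unfolding filterlim_at using LIMSEQ_inverse_real_of_nat
        by (auto intro!: always_eventually simp: inverse_eq_divide)
      ultimately have "(\<lambda>n. (\<eta> ((0 + 1 / real (Suc n)) *\<^sub>R i + x) - \<eta> (0 *\<^sub>R i + x)) / (1 / real (Suc n)))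
          \<longlonglongrightarrow> grad \<eta> (0 *\<^sub>R i + x) \<bullet> i"
        by (rule filterlim_compose)
      then show "(\<lambda>n. F n x) \<longlonglongrightarrow> grad \<eta> x \<bullet> i"
        by (simp add: F_def mult.commute)
    qed
    show "AE x in lborel. norm (F n x) \<le> indicat_real (cball 0 (R + 1)) x *\<^sub>R M" for n
    proof (rule AE_I2)
      fix x :: 'a
      let ?h = "1 / real (Suc n)"
      have h: "0 < ?h" "?h \<le> 1" by (auto simp: field_simps)
      show "norm (F n x) \<le> indicat_real (cball 0 (R + 1)) x *\<^sub>R M"
      proof (cases "x \<in> cball 0 (R + 1)")
        case True
        obtain z where z: "0 < z" "z < ?h" "\<eta> (?h *\<^sub>R i + x) - \<eta> (0 *\<^sub>R i + x) = (?h - 0) * (grad \<eta> (z *\<^sub>R i + x) \<bullet> i)"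
          using MVT2[OF h(1), of "\<lambda>t. \<eta> (t *\<^sub>R i + x)" "\<lambda>t. grad \<eta> (t *\<^sub>R i + x) \<bullet> i"] line by blast
        then have "F n x = grad \<eta> (z *\<^sub>R i + x) \<bullet> i" by (simp add: F_def)
        then show ?thesis using True M by simp
      next
        case False
        have "R + 1 < norm x" using False by simp
        moreover have "norm x \<le> norm (?h *\<^sub>R i + x) + norm (?h *\<^sub>R i)"
          by (metis add.commute add_diff_cancel_right' norm_triangle_sub norm_triangle_ineq4)
        moreover have "norm (?h *\<^sub>R i) \<le> 1" using h i by (simp add: norm_scaleR)
        ultimately have "R < norm x" "R < norm (?h *\<^sub>R i + x)" by linarith+
        then have "x \<notin> K" "?h *\<^sub>R i + x \<notin> K"
          using R unfolding subset_iff mem_cball_0 by (meson not_le)+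
        then have "F n x = 0" using K(2) by (simp add: F_def)
        then show ?thesis using False by simp
      qed
    qed
    show "(\<lambda>x. grad \<eta> x \<bullet> i) \<in> borel_measurable lborel" "F n \<in> borel_measurable lborel" for n
      unfolding F_def by measurable
  qed
  then have "(\<lambda>n::nat. 0) \<longlonglongrightarrow> (LINT x|lborel. grad \<eta> x \<bullet> i)"
    by (simp only: Fint)
  then show ?thesis by (rule LIMSEQ_unique[OF _ tendsto_const])
qed

lemma integral_lebesgue_on_support:
  fixes f :: "'a::euclidean_space \<Rightarrow> real"
  assumes S: "S \<in> sets lebesgue" and f: "f \<in> borel_measurable borel" and "\<And>x. x \<notin> S \<Longrightarrow> f x = 0"
  shows "(LINT x|lebesgue_on S. f x) = (LINT x|lborel. f x)"
proof -
  have "(\<lambda>x. if x \<in> S then f x else 0) = f" using assms(3) by auto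
  then have "(LINT x|lebesgue_on S. f x) = (LINT x|lebesgue. f x)"
    using Lebesgue_Measure.integral_restrict_UNIV[OF S, of f] by simp
  then show ?thesis using f by (simp add: integral_completion)
qed

lemma integrable_lebesgue_on_compact_support:
  fixes f :: "'a::euclidean_space \<Rightarrow> 'b::euclidean_space"
  assumes S: "S \<in> sets lebesgue" and "continuous_on UNIV f" "compact K" "\<And>x. x \<notin> K \<Longrightarrow> f x = 0"
  shows "integrable (lebesgue_on S) f"
proof -
  have "integrable lborel f" by (rule integrable_continuous_compact_support) (use assms in auto)
  then have "integrable (lebesgue_on UNIV) f"
    by (simp add: lebesgue_on_UNIV_eq integrable_completion)
  then show ?thesis by (rule integrable_lebesgue_on_subset[rotated -1]) (use S in auto)
qed

text \<open>The product of a smooth function and a test function has compact support in the domain, so the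
  integral of each of its partial derivatives is zero; the product rule then is integration by parts.\<close>

lemma has_weak_grad_smooth:
  fixes \<eta> :: "'a::euclidean_space \<Rightarrow> real"
  assumes \<Omega>: "open \<Omega>" and \<eta>: "smooth \<eta>"
  shows "has_weak_grad \<Omega> \<eta> (grad \<eta>)"
  unfolding has_weak_grad_def
proof (intro conjI ballI)
  have S: "\<Omega> \<in> sets lebesgue" using \<Omega> by auto
  show "loc_integrable \<Omega> \<eta>" "loc_integrable \<Omega> (grad \<eta>)"
    using \<eta> by (auto intro!: loc_integrable_continuous smooth_continuous continuous_on_grad)
  fix \<phi> :: "'a \<Rightarrow> real" and i :: 'a assume \<phi>: "\<phi> \<in> test_functions \<Omega>" and i: "i \<in> Basis"
  have sm: "smooth \<phi>" using \<phi> by (rule test_functions_smooth)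
  obtain K where K: "compact K" "K \<subseteq> \<Omega>" "\<And>x. x \<notin> K \<Longrightarrow> \<phi> x = 0"
    using test_functions_support[OF \<phi>] by metis
  have g0: "x \<notin> K \<Longrightarrow> grad \<phi> x = 0" for x using grad_eq_0_outside[OF K(1,3)] .
  have "0 = (LINT x|lborel. grad (\<lambda>x. \<eta> x * \<phi> x) x \<bullet> i)"
    by (rule integral_partial_derivative_eq_0[symmetric]) (use \<eta> sm K i in \<open>auto intro: smooth_mult\<close>)
  also have "\<dots> = (LINT x|lebesgue_on \<Omega>. grad (\<lambda>x. \<eta> x * \<phi> x) x \<bullet> i)"
  proof (rule integral_lebesgue_on_support[symmetric, OF S])
    show "(\<lambda>x. grad (\<lambda>x. \<eta> x * \<phi> x) x \<bullet> i) \<in> borel_measurable borel"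
      by (intro borel_measurable_continuous_onI continuous_intros continuous_on_grad smooth_mult \<eta> sm)
    fix x assume "x \<notin> \<Omega>"
    then show "grad (\<lambda>x. \<eta> x * \<phi> x) x \<bullet> i = 0"
      using K by (subst grad_eq_0_outside[OF K(1)]) auto
  qed
  also have "\<dots> = (LINT x|lebesgue_on \<Omega>. \<eta> x * (grad \<phi> x \<bullet> i) + (grad \<eta> x \<bullet> i) * \<phi> x)"
    by (simp add: grad_mult[OF \<eta> sm] inner_add_left mult.commute)
  also have "\<dots> = (LINT x|lebesgue_on \<Omega>. \<eta> x * (grad \<phi> x \<bullet> i)) + (LINT x|lebesgue_on \<Omega>. (grad \<eta> x \<bullet> i) * \<phi> x)"
  proof (rule Bochner_Integration.integral_add)
    show "integrable (lebesgue_on \<Omega>) (\<lambda>x. \<eta> x * (grad \<phi> x \<bullet> i))"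
      using g0 by (intro integrable_lebesgue_on_compact_support[OF S _ K(1)] continuous_intros
        smooth_continuous \<eta> continuous_on_grad sm) auto
    show "integrable (lebesgue_on \<Omega>) (\<lambda>x. (grad \<eta> x \<bullet> i) * \<phi> x)"
      using K by (intro integrable_lebesgue_on_compact_support[OF S _ K(1)] continuous_intros
        smooth_continuous \<eta> continuous_on_grad sm) auto
  qed
  finally show "(LINT x|lebesgue_on \<Omega>. \<eta> x * frechet_derivative \<phi> (at x) i)
      = - (LINT x|lebesgue_on \<Omega>. (grad \<eta> x \<bullet> i) * \<phi> x)"
    using i by (simp add: grad_inner)
qed

section \<open>Weak gradients\<close>

text \<open>Multiplying flat functions of the \<open>n\<close>-fold distances to the faces of a box gives smooth functions
  supported in the box, and \<open>flat 1\<close> tends to \<open>1\<close> at infinity.\<close>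

lemma box_bump:
  fixes a b :: "'a::euclidean_space"
  assumes "cbox a b \<subseteq> \<Omega>"
  obtains \<phi> where "\<And>n. \<phi> n \<in> test_functions \<Omega>" "\<And>n x. \<bar>\<phi> n x\<bar> \<le> 1"
    "\<And>n x. x \<notin> cbox a b \<Longrightarrow> \<phi> n x = 0"
    "\<And>x. (\<lambda>n::nat. \<phi> n x) \<longlonglongrightarrow> indicator (box a b) x"
proof -
  define \<phi> where "\<phi> n x = (\<Prod>i\<in>Basis. flat 1 (real n * (x \<bullet> i - a \<bullet> i)) * flat 1 (real n * (b \<bullet> i - x \<bullet> i)))"
    for n :: nat and x
  have sm: "smooth (\<phi> n)" for n
  proof -
    have "\<phi> n = (\<lambda>x. \<Prod>i\<in>Basis. flat 1 ((real n *\<^sub>R i) \<bullet> x + (- real n * (a \<bullet> i)))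
        * flat 1 ((- real n *\<^sub>R i) \<bullet> x + real n * (b \<bullet> i)))"
      by (auto simp: \<phi>_def fun_eq_iff algebra_simps inner_commute)
    then show ?thesis by (simp only:) (intro smooth_prod smooth_mult smooth_flat)
  qed
  have zero: "\<phi> n x = 0" if x: "x \<notin> cbox a b" for n x
  proof -
    obtain i where i: "i \<in> Basis" "x \<bullet> i < a \<bullet> i \<or> b \<bullet> i < x \<bullet> i"
      using x unfolding mem_box by (meson not_le)
    then have "flat 1 (real n * (x \<bullet> i - a \<bullet> i)) * flat 1 (real n * (b \<bullet> i - x \<bullet> i)) = 0"
      by (auto simp: flat_def mult_le_0_iff)
    then show ?thesis unfolding \<phi>_def using i(1) by (intro prod_zero) auto
  qed
  have le1: "\<bar>\<phi> n x\<bar> \<le> 1" for n x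
    unfolding \<phi>_def abs_prod
    by (intro prod_le_1) (auto simp: abs_mult flat_1_bounds intro!: mult_le_one)
  have lim: "(\<lambda>n. \<phi> n x) \<longlonglongrightarrow> indicator (box a b) x" for x
  proof -
    have "(\<lambda>n. \<phi> n x) \<longlonglongrightarrow> (\<Prod>i\<in>Basis. (if x \<bullet> i - a \<bullet> i > 0 then 1 else 0) * (if b \<bullet> i - x \<bullet> i > 0 then 1 else 0))"
      unfolding \<phi>_def by (intro tendsto_prod tendsto_mult flat_1_scaled_tendsto)
    also have "(\<Prod>i\<in>Basis. (if x \<bullet> i - a \<bullet> i > 0 then 1 else 0) * (if b \<bullet> i - x \<bullet> i > 0 then 1 else 0)) = indicat_real (box a b) x"
    proof (cases "x \<in> box a b")
      case True
      then show ?thesis by (simp add: mem_box)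
    next
      case False
      then obtain i where "i \<in> Basis" "\<not> (a \<bullet> i < x \<bullet> i \<and> x \<bullet> i < b \<bullet> i)" by (auto simp: mem_box)
      then have "(\<Prod>i\<in>Basis. (if x \<bullet> i - a \<bullet> i > 0 then 1 else 0) * (if b \<bullet> i - x \<bullet> i > 0 then 1 else (0::real))) = 0"
        by (intro prod_zero) auto
      then show ?thesis using False by simp
    qed
    finally show ?thesis .
  qed
  show ?thesis
  proof
    show "\<phi> n \<in> test_functions \<Omega>" for n
      by (rule test_functionsI[OF sm compact_cbox assms zero])
  qed (use zero le1 lim in auto)
qed

text \<open>The boxes generate the Borel sets and are closed under intersection, so the integral over every
  Borel set vanishes.\<close>

lemma AE_eq_0_of_box_integrals:
  fixes f :: "'a::euclidean_space \<Rightarrow> real"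
  assumes f: "integrable lborel f"
    and box: "\<And>a b. (LINT x|lborel. indicator (box a b) x * f x) = 0"
    and all: "(LINT x|lborel. f x) = 0"
  shows "AE x in lborel. f x = 0"
proof (rule density_unique_real[OF f, of "\<lambda>_. 0"])
  let ?G = "range (\<lambda>(a, b). box a b :: 'a set)"
  have sb: "sets borel = sigma_sets UNIV ?G"
    by (subst borel_eq_box) (simp add: sets_measure_of)
  have st: "Int_stable ?G"
    by (auto simp: Int_stable_def box_Int_box)
  have sub: "?G \<subseteq> Pow UNIV" by simp
  fix A :: "'a set" assume "A \<in> sets lborel"
  then have "A \<in> sigma_sets UNIV ?G" using sb by simp
  with st sub have "set_lebesgue_integral lborel A f = 0"
  proof (induction rule: sigma_sets_induct_disjoint)
    case (basic A)
    then show ?case using box by (auto simp: set_lebesgue_integral_def)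
  next
    case empty
    then show ?case by (simp add: set_lebesgue_integral_def)
  next
    case (compl A)
    have A: "A \<in> sets borel" using compl sb by simp
    have "set_lebesgue_integral lborel (UNIV - A) f = (LINT x|lborel. f x - indicator A x *\<^sub>R f x)"
      unfolding set_lebesgue_integral_def
      by (intro Bochner_Integration.integral_cong) (auto simp: indicator_def)
    also have "\<dots> = (LINT x|lborel. f x) - set_lebesgue_integral lborel A f"
      unfolding set_lebesgue_integral_def
      using A by (intro Bochner_Integration.integral_diff f integrable_mult_indicator) auto
    finally show ?case using compl all by simp
  next
    case (union A)
    have A: "A i \<in> sets lborel" for i using union sb by auto
    have "set_lebesgue_integral lborel (\<Union>i. A i) f = (\<Sum>i. set_lebesgue_integral lborel (A i) f)"
    proof (rule lebesgue_integral_countable_add[OF A])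
      show "i \<noteq> j \<Longrightarrow> A i \<inter> A j = {}" for i j
        using union by (auto simp: disjoint_family_on_def)
      show "set_integrable lborel (\<Union>i. A i) f"
        unfolding set_integrable_def using A by (intro integrable_mult_indicator f) auto
    qed
    then show ?case using union by simp
  qed
  then show "set_lebesgue_integral lborel A f = set_lebesgue_integral lborel A (\<lambda>_. 0)"
    by (simp add: set_lebesgue_integral_def)
qed simp

lemma integral_box_eq_0_of_test:
  fixes g :: "'a::euclidean_space \<Rightarrow> real"
  assumes \<Omega>: "open \<Omega>" and g: "loc_integrable \<Omega> g"
    and test: "\<And>\<phi>. \<phi> \<in> test_functions \<Omega> \<Longrightarrow> (LINT x|lebesgue_on \<Omega>. g x * \<phi> x) = 0"
    and ab: "cbox a b \<subseteq> \<Omega>"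
  shows "(LINT x|lebesgue_on (box a b). g x) = 0"
proof -
  obtain \<phi> where \<phi>: "\<And>n. \<phi> n \<in> test_functions \<Omega>" "\<And>n x. \<bar>\<phi> n x\<bar> \<le> 1"
    "\<And>n x. x \<notin> cbox a b \<Longrightarrow> \<phi> n x = 0"
    "\<And>x. (\<lambda>n::nat. \<phi> n x) \<longlonglongrightarrow> indicator (box a b) x"
    using box_bump[OF ab] by metis
  have S: "\<Omega> \<in> sets lebesgue" using \<Omega> by auto
  have gi: "integrable (lebesgue_on (cbox a b)) g"
    using g ab by (auto simp: loc_integrable_def)
  have gm: "g \<in> borel_measurable (lebesgue_on (cbox a b))"
    using gi by blast
  have \<phi>m: "\<phi> n \<in> borel_measurable (lebesgue_on (cbox a b))" for n
    by (rule continuous_imp_measurable_on_sets_lebesgue)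
      (auto intro!: smooth_continuous test_functions_smooth[OF \<phi>(1)])
  have z: "(LINT x|lebesgue_on (cbox a b). g x * \<phi> n x) = 0" for n
  proof -
    have "(\<lambda>x. if x \<in> cbox a b then g x * \<phi> n x else 0) = (\<lambda>x. g x * \<phi> n x)"
      using \<phi>(3) by (auto simp: fun_eq_iff)
    then show ?thesis
      using integral_restrict[OF ab _ S, of "\<lambda>x. g x * \<phi> n x"] test[OF \<phi>(1)[of n]] by simp
  qed
  have "(\<lambda>n. LINT x|lebesgue_on (cbox a b). g x * \<phi> n x)
      \<longlonglongrightarrow> (LINT x|lebesgue_on (cbox a b). g x * indicator (box a b) x)"
  proof (rule integral_dominated_convergence[where w = "\<lambda>x. \<bar>g x\<bar>"])
    show "AE x in lebesgue_on (cbox a b). (\<lambda>n. g x * \<phi> n x) \<longlonglongrightarrow> g x * indicator (box a b) x"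
      by (intro AE_I2 tendsto_mult tendsto_const \<phi>)
    show "AE x in lebesgue_on (cbox a b). norm (g x * \<phi> n x) \<le> \<bar>g x\<bar>" for n
      using \<phi>(2)[of n] by (intro AE_I2) (auto simp: abs_mult intro!: mult_left_le)
    show "(\<lambda>x. g x * indicat_real (box a b) x) \<in> borel_measurable (lebesgue_on (cbox a b))"
      by (intro borel_measurable_times gm borel_measurable_indicator)
        (simp add: sets_restrict_space_iff box_subset_cbox)
  qed (use gi gm \<phi>m in auto)
  then have "(\<lambda>n::nat. 0) \<longlonglongrightarrow> (LINT x|lebesgue_on (cbox a b). g x * indicator (box a b) x)"
    by (simp only: z)
  then have "(LINT x|lebesgue_on (cbox a b). g x * indicator (box a b) x) = 0"
    by (rule LIMSEQ_unique[OF _ tendsto_const])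
  moreover have "(\<lambda>x. g x * indicator (box a b) x) = (\<lambda>x. if x \<in> box a b then g x else 0)"
    by (auto simp: indicator_def)
  ultimately show ?thesis
    using integral_restrict[OF box_subset_cbox[of a b], of g] by simp
qed

text \<open>The fundamental lemma of the calculus of variations. Testing with bumps that converge to the
  indicator of a box shows that all integrals of \<open>g\<close> over boxes in the domain vanish, and the domain
  is a countable union of such boxes. The Borel representative \<open>f1\<close> is needed since the generator
  argument works for the Borel sets only.\<close>

lemma AE_eq_0_of_test:
  fixes g :: "'a::euclidean_space \<Rightarrow> real"
  assumes \<Omega>: "open \<Omega>" and g: "loc_integrable \<Omega> g"
    and test: "\<And>\<phi>. \<phi> \<in> test_functions \<Omega> \<Longrightarrow> (LINT x|lebesgue_on \<Omega>. g x * \<phi> x) = 0"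
  shows "AE x in lebesgue_on \<Omega>. g x = 0"
proof -
  have cb: "AE x in lebesgue. x \<in> cbox c d \<longrightarrow> g x = 0" if cd: "cbox c d \<subseteq> \<Omega>" for c d
  proof -
    define f0 where "f0 x = (if x \<in> box c d then g x else 0)" for x
    have gi: "integrable (lebesgue_on (cbox c d)) g"
      using g cd by (auto simp: loc_integrable_def)
    then have "integrable (lebesgue_on (box c d)) g"
      by (rule integrable_lebesgue_on_subset[rotated -1]) (auto simp: box_subset_cbox Diff_eq_empty_iff)
    then have f0i: "integrable lebesgue f0"
      unfolding f0_def by (subst Lebesgue_Measure.integrable_restrict_UNIV) auto
    then obtain f1 where f1: "f1 \<in> borel_measurable lborel" "AE x in lborel. f0 x = f1 x"
      using completion_ex_borel_measurable_real[of f0 lborel] by auto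
    have f1': "AE x in lebesgue. f0 x = f1 x" using f1(2) by (rule AE_completion)
    have f1m: "f1 \<in> borel_measurable lebesgue" using f1(1) by (simp add: measurable_completion)
    have "integrable lebesgue f1"
      using integrable_cong_AE[OF _ f1m f1'] f0i by auto
    then have f1i: "integrable lborel f1" using f1(1) by (simp add: integrable_completion)
    have f0box: "(LINT x|lebesgue. indicator (box a b) x * f0 x) = 0" for a b
    proof -
      obtain p q where pq: "box a b \<inter> box c d = box p q" using box_Int_box[of a b c d] by blast
      have "(\<lambda>x. indicator (box a b) x * f0 x) = (\<lambda>x. if x \<in> box p q then g x else 0)"
        using pq by (auto simp: f0_def fun_eq_iff indicator_def)
      then have "(LINT x|lebesgue. indicator (box a b) x * f0 x) = (LINT x|lebesgue_on (box p q). g x)"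
        by (simp add: Lebesgue_Measure.integral_restrict_UNIV)
      also have "\<dots> = 0"
      proof (cases "box p q = {}")
        case False
        then have "cbox p q = closure (box p q)" by simp
        also have "\<dots> \<subseteq> closure (cbox c d)" using pq box_subset_cbox by (intro closure_mono) blast
        finally have "cbox p q \<subseteq> \<Omega>" using cd by simp
        from integral_box_eq_0_of_test[OF \<Omega> g _ this] show ?thesis using test by blast
      qed simp
      finally show ?thesis .
    qed
    have "AE x in lborel. f1 x = 0"
    proof (rule AE_eq_0_of_box_integrals[OF f1i])
      fix a b :: 'a
      have "(LINT x|lborel. indicator (box a b) x * f1 x) = (LINT x|lebesgue. indicator (box a b) x * f1 x)"
        using f1(1) by (intro integral_completion[symmetric]) auto
      also have "\<dots> = (LINT x|lebesgue. indicator (box a b) x * f0 x)"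
      proof (rule integral_cong_AE)
        show "AE x in lebesgue. indicat_real (box a b) x * f1 x = indicat_real (box a b) x * f0 x"
          using f1' by eventually_elim simp
      qed (use f1m f0i in \<open>auto intro!: borel_measurable_times borel_measurable_indicator\<close>)
      finally show "(LINT x|lborel. indicator (box a b) x * f1 x) = 0" using f0box by simp
    next
      have "(LINT x|lborel. f1 x) = (LINT x|lebesgue. f1 x)"
        using f1(1) by (intro integral_completion[symmetric]) auto
      also have "\<dots> = (LINT x|lebesgue. indicator (box c d) x * f0 x)"
      proof (rule integral_cong_AE)
        show "AE x in lebesgue. f1 x = indicat_real (box c d) x * f0 x"
          using f1' by eventually_elim (auto simp: f0_def indicator_def split: if_splits)
      qed (use f1m f0i in \<open>auto intro!: borel_measurable_times borel_measurable_indicator\<close>)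
      finally show "(LINT x|lborel. f1 x) = 0" using f0box by simp
    qed
    then have "AE x in lebesgue. f1 x = 0" by (rule AE_completion)
    moreover have "AE x in lebesgue. x \<notin> cbox c d - box c d"
      by (rule AE_notin_negligible[OF negligible_frontier_interval])
    ultimately show ?thesis using f1'
      by eventually_elim (auto simp: f0_def)
  qed
  obtain D where D: "countable D" "D \<subseteq> Pow \<Omega>" "\<And>X. X \<in> D \<Longrightarrow> \<exists>a b. X = cbox a b" "\<Union>D = \<Omega>"
    using open_countable_Union_open_cbox[OF \<Omega>] by metis
  have "AE x in lebesgue. \<forall>X\<in>D. x \<in> X \<longrightarrow> g x = 0"
  proof (rule AE_ball_countable'[OF _ D(1)])
    fix X assume "X \<in> D"
    then obtain c d where "X = cbox c d" "cbox c d \<subseteq> \<Omega>" using D by blast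
    then show "AE x in lebesgue. x \<in> X \<longrightarrow> g x = 0" using cb by simp
  qed
  then have "AE x in lebesgue. x \<in> \<Omega> \<longrightarrow> g x = 0"
    by eventually_elim (use D(4) in blast)
  then show ?thesis using \<Omega> by (simp add: AE_restrict_space_iff)
qed

lemma integrable_loc_integrable_scaleR:
  fixes f :: "'a::euclidean_space \<Rightarrow> 'b::euclidean_space"
  assumes \<Omega>: "open \<Omega>" and f: "loc_integrable \<Omega> f" and \<psi>: "continuous_on UNIV \<psi>"
    and K: "compact K" "K \<subseteq> \<Omega>" "\<And>x. x \<notin> K \<Longrightarrow> \<psi> x = 0"
  shows "integrable (lebesgue_on \<Omega>) (\<lambda>x. \<psi> x *\<^sub>R f x)"
proof -
  have KL: "K \<in> sets lebesgue" using K(1) by (simp add: lmeasurable_compact fmeasurableD)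
  have fi: "integrable (lebesgue_on K) f" using f K by (auto simp: loc_integrable_def)
  have \<psi>K: "continuous_on K \<psi>" using \<psi> continuous_on_subset by blast
  then have "bounded (\<psi> ` K)" using K(1) by (simp add: compact_continuous_image compact_imp_bounded)
  then obtain B where B: "\<And>x. x \<in> K \<Longrightarrow> norm (\<psi> x) \<le> B" by (auto simp: bounded_iff)
  have "integrable (lebesgue_on K) (\<lambda>x. \<psi> x *\<^sub>R f x)"
  proof (rule Bochner_Integration.integrable_bound)
    show "integrable (lebesgue_on K) (\<lambda>x. B *\<^sub>R f x)" using fi by simp
    show "(\<lambda>x. \<psi> x *\<^sub>R f x) \<in> borel_measurable (lebesgue_on K)"
      using fi continuous_imp_measurable_on_sets_lebesgue[OF \<psi>K KL]
      by (intro borel_measurable_scaleR) auto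
    show "AE x in lebesgue_on K. norm (\<psi> x *\<^sub>R f x) \<le> norm (B *\<^sub>R f x)"
      using B by (intro AE_I2) (fastforce intro!: mult_right_mono)
  qed
  then have "integrable lebesgue (\<lambda>x. if x \<in> K then \<psi> x *\<^sub>R f x else 0)"
    using KL by (simp add: Lebesgue_Measure.integrable_restrict_UNIV)
  moreover have "(\<lambda>x. if x \<in> K then \<psi> x *\<^sub>R f x else 0) = (\<lambda>x. \<psi> x *\<^sub>R f x)"
    using K(3) by auto
  ultimately have "integrable (lebesgue_on UNIV) (\<lambda>x. \<psi> x *\<^sub>R f x)"
    by (simp add: lebesgue_on_UNIV_eq)
  then show ?thesis by (rule integrable_lebesgue_on_subset[rotated -1]) (use \<Omega> in auto)
qed

lemma test_function_partial:
  assumes "\<phi> \<in> test_functions \<Omega>" "i \<in> Basis"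
  shows "(\<lambda>x. frechet_derivative \<phi> (at x) i) \<in> test_functions \<Omega>"
proof -
  obtain K where K: "compact K" "K \<subseteq> \<Omega>" "\<And>x. x \<notin> K \<Longrightarrow> \<phi> x = 0"
    using test_functions_support[OF assms(1)] by metis
  show ?thesis
  proof (rule test_functionsI[OF _ K(1,2)])
    show "smooth (\<lambda>x. frechet_derivative \<phi> (at x) i)"
      using assms by (intro smooth_partial test_functions_smooth)
    show "frechet_derivative \<phi> (at x) i = 0" if "x \<notin> K" for x
      using grad_eq_0_outside[OF K(1,3) that] grad_inner[OF assms(2), of \<phi> x] by simp
  qed
qed

lemma integrable_loc_integrable_test:
  fixes f :: "'a::euclidean_space \<Rightarrow> real"
  assumes \<Omega>: "open \<Omega>" and f: "loc_integrable \<Omega> f" and \<phi>: "\<phi> \<in> test_functions \<Omega>"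
  shows "integrable (lebesgue_on \<Omega>) (\<lambda>x. f x * \<phi> x)"
proof -
  obtain K where K: "compact K" "K \<subseteq> \<Omega>" "\<And>x. x \<notin> K \<Longrightarrow> \<phi> x = 0"
    using test_functions_support[OF \<phi>] by metis
  have "integrable (lebesgue_on \<Omega>) (\<lambda>x. \<phi> x *\<^sub>R f x)"
    by (rule integrable_loc_integrable_scaleR[OF \<Omega> f _ K])
      (auto intro: smooth_continuous test_functions_smooth[OF \<phi>])
  then show ?thesis by (simp add: mult.commute)
qed

lemma loc_integrable_inner:
  "loc_integrable \<Omega> g \<Longrightarrow> loc_integrable \<Omega> (\<lambda>x. g x \<bullet> i)"
  by (auto simp: loc_integrable_def)

lemma loc_integrable_lincomb:
  "loc_integrable \<Omega> f \<Longrightarrow> loc_integrable \<Omega> g \<Longrightarrow> loc_integrable \<Omega> (\<lambda>x. a *\<^sub>R f x + b *\<^sub>R g x)"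
  by (auto simp: loc_integrable_def)

text \<open>The two functions need only agree almost everywhere. This covers both the linearity of the
  chosen gradient and the comparison with a classical gradient on a cell.\<close>

lemma has_weak_grad_unique:
  assumes \<Omega>: "open \<Omega>" and g: "has_weak_grad \<Omega> u g" and g': "has_weak_grad \<Omega> u' g'"
    and uu': "AE x in lebesgue_on \<Omega>. u x = u' x"
  shows "AE x in lebesgue_on \<Omega>. g x = g' x"
proof -
  have *: "AE x in lebesgue_on \<Omega>. g x \<bullet> i - g' x \<bullet> i = 0" if i: "i \<in> Basis" for i
  proof (rule AE_eq_0_of_test[OF \<Omega>])
    have l: "loc_integrable \<Omega> u" "loc_integrable \<Omega> u'" "loc_integrable \<Omega> (\<lambda>x. g x \<bullet> i)" "loc_integrable \<Omega> (\<lambda>x. g' x \<bullet> i)"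
      using g g' by (auto simp: has_weak_grad_def loc_integrable_inner)
    show "loc_integrable \<Omega> (\<lambda>x. g x \<bullet> i - g' x \<bullet> i)"
      using loc_integrable_lincomb[OF l(3,4), of 1 "-1"] by simp
    fix \<phi> assume \<phi>: "\<phi> \<in> test_functions \<Omega>"
    note I = integrable_loc_integrable_test[OF \<Omega> _ \<phi>]
    note J = integrable_loc_integrable_test[OF \<Omega> _ test_function_partial[OF \<phi> i]]
    have "(LINT x|lebesgue_on \<Omega>. (g x \<bullet> i - g' x \<bullet> i) * \<phi> x)
      = (LINT x|lebesgue_on \<Omega>. (g x \<bullet> i) * \<phi> x) - (LINT x|lebesgue_on \<Omega>. (g' x \<bullet> i) * \<phi> x)"
      unfolding left_diff_distrib by (rule Bochner_Integration.integral_diff[OF I[OF l(3)] I[OF l(4)]])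
    also have "\<dots> = (LINT x|lebesgue_on \<Omega>. u' x * frechet_derivative \<phi> (at x) i)
        - (LINT x|lebesgue_on \<Omega>. u x * frechet_derivative \<phi> (at x) i)"
      using g g' \<phi> i by (simp add: has_weak_grad_def)
    also have "(LINT x|lebesgue_on \<Omega>. u' x * frechet_derivative \<phi> (at x) i)
        = (LINT x|lebesgue_on \<Omega>. u x * frechet_derivative \<phi> (at x) i)"
      by (rule integral_cong_AE) (use J[OF l(1)] J[OF l(2)] uu' in auto)
    finally show "(LINT x|lebesgue_on \<Omega>. (g x \<bullet> i - g' x \<bullet> i) * \<phi> x) = 0" by simp
  qed
  have "AE x in lebesgue_on \<Omega>. \<forall>i\<in>Basis. g x \<bullet> i - g' x \<bullet> i = 0"
    by (rule AE_ball_countable'[OF *]) (auto intro: countable_finite)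
  then show ?thesis by eventually_elim (auto intro: euclidean_eqI)
qed

lemma has_weak_grad_lincomb:
  assumes \<Omega>: "open \<Omega>" and g: "has_weak_grad \<Omega> u g" and k: "has_weak_grad \<Omega> v k"
  shows "has_weak_grad \<Omega> (\<lambda>x. a * u x + b * v x) (\<lambda>x. a *\<^sub>R g x + b *\<^sub>R k x)"
  unfolding has_weak_grad_def
proof (intro conjI ballI)
  have l: "loc_integrable \<Omega> u" "loc_integrable \<Omega> g" "loc_integrable \<Omega> v" "loc_integrable \<Omega> k"
    using g k by (auto simp: has_weak_grad_def)
  show "loc_integrable \<Omega> (\<lambda>x. a * u x + b * v x)" "loc_integrable \<Omega> (\<lambda>x. a *\<^sub>R g x + b *\<^sub>R k x)"
    using loc_integrable_lincomb[OF l(1,3), of a b] loc_integrable_lincomb[OF l(2,4), of a b] by simp_all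
  fix \<phi> :: "'a \<Rightarrow> real" and i :: 'a assume \<phi>: "\<phi> \<in> test_functions \<Omega>" and i: "i \<in> Basis"
  let ?D = "\<lambda>x. frechet_derivative \<phi> (at x) i"
  note I = integrable_loc_integrable_test[OF \<Omega> _ \<phi>]
  note J = integrable_loc_integrable_test[OF \<Omega> _ test_function_partial[OF \<phi> i]]
  have "(LINT x|lebesgue_on \<Omega>. (a * u x + b * v x) * ?D x)
      = (LINT x|lebesgue_on \<Omega>. a * (u x * ?D x) + b * (v x * ?D x))"
    by (simp add: algebra_simps)
  also have "\<dots> = a * (LINT x|lebesgue_on \<Omega>. u x * ?D x) + b * (LINT x|lebesgue_on \<Omega>. v x * ?D x)"
    using J[OF l(1)] J[OF l(3)] by (simp add: Bochner_Integration.integral_add)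
  also have "\<dots> = - (a * (LINT x|lebesgue_on \<Omega>. (g x \<bullet> i) * \<phi> x) + b * (LINT x|lebesgue_on \<Omega>. (k x \<bullet> i) * \<phi> x))"
    using g k \<phi> i by (simp add: has_weak_grad_def)
  also have "a * (LINT x|lebesgue_on \<Omega>. (g x \<bullet> i) * \<phi> x) + b * (LINT x|lebesgue_on \<Omega>. (k x \<bullet> i) * \<phi> x)
      = (LINT x|lebesgue_on \<Omega>. a * ((g x \<bullet> i) * \<phi> x) + b * ((k x \<bullet> i) * \<phi> x))"
    using I[OF loc_integrable_inner[OF l(2), of i]] I[OF loc_integrable_inner[OF l(4), of i]]
    by (simp add: Bochner_Integration.integral_add)
  finally show "(LINT x|lebesgue_on \<Omega>. (a * u x + b * v x) * ?D x)
      = - (LINT x|lebesgue_on \<Omega>. ((a *\<^sub>R g x + b *\<^sub>R k x) \<bullet> i) * \<phi> x)"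
    by (simp add: inner_add_left algebra_simps)
qed

lemma has_weak_grad_subset:
  assumes \<Omega>: "open \<Omega>" and S: "open S" "S \<subseteq> \<Omega>" and g: "has_weak_grad \<Omega> u g"
  shows "has_weak_grad S u g"
  unfolding has_weak_grad_def
proof (intro conjI ballI)
  show "loc_integrable S u" "loc_integrable S g"
    using g S by (auto simp: has_weak_grad_def loc_integrable_def)
  fix \<phi> :: "'a \<Rightarrow> real" and i :: 'a assume \<phi>: "\<phi> \<in> test_functions S" and i: "i \<in> Basis"
  have \<phi>': "\<phi> \<in> test_functions \<Omega>" using \<phi> test_functions_mono[OF S(2)] by blast
  have *: "(LINT x|lebesgue_on S. w x * \<psi> x) = (LINT x|lebesgue_on \<Omega>. w x * \<psi> x)"
    if "\<psi> \<in> test_functions S" for w \<psi> :: "'a \<Rightarrow> real"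
  proof -
    have "\<psi> x = 0" if "x \<notin> S" for x
      using \<open>\<psi> \<in> test_functions S\<close> that by (auto simp: test_functions_def)
    then have "(\<lambda>x. if x \<in> S then w x * \<psi> x else 0) = (\<lambda>x. w x * \<psi> x)" by auto
    then show ?thesis
      using integral_restrict[OF S(2), of "\<lambda>x. w x * \<psi> x"] \<Omega> S by simp
  qed
  show "(LINT x|lebesgue_on S. u x * frechet_derivative \<phi> (at x) i) = - (LINT x|lebesgue_on S. (g x \<bullet> i) * \<phi> x)"
    unfolding *[OF \<phi>] *[OF test_function_partial[OF \<phi> i]]
    using g \<phi>' i by (simp add: has_weak_grad_def)
qed

lemma has_weak_grad_wgrad: "has_weak_grad \<Omega> u g \<Longrightarrow> has_weak_grad \<Omega> u (wgrad \<Omega> u)"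
  unfolding wgrad_def by (rule someI[of "has_weak_grad \<Omega> u" g])

lemma wgrad_eq_AE:
  assumes "open \<Omega>" "has_weak_grad \<Omega> u g"
  shows "AE x in lebesgue_on \<Omega>. wgrad \<Omega> u x = g x"
  by (rule has_weak_grad_unique[OF assms(1) has_weak_grad_wgrad[OF assms(2)] assms(2)]) simp

section \<open>Functions vanishing on the boundary\<close>

text \<open>The chosen gradient is only known to be locally integrable; that it is square integrable follows
  from its agreement almost everywhere with a square integrable gradient.\<close>

lemma H1D:
  assumes "open \<Omega>" "u \<in> H1 \<Omega>"
  shows "u \<in> L2 \<Omega>" "has_weak_grad \<Omega> u (wgrad \<Omega> u)" "wgrad \<Omega> u \<in> L2 \<Omega>"
proof -
  show "u \<in> L2 \<Omega>" using assms by (simp add: H1_def)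
  obtain g where g: "g \<in> L2 \<Omega>" "has_weak_grad \<Omega> u g" using assms by (auto simp: H1_def)
  show "has_weak_grad \<Omega> u (wgrad \<Omega> u)" using g(2) by (rule has_weak_grad_wgrad)
  have ae: "AE x in lebesgue_on \<Omega>. g x = wgrad \<Omega> u x"
    using wgrad_eq_AE[OF assms(1) g(2)] by eventually_elim simp
  have S: "\<Omega> \<in> sets lebesgue" using assms(1) by auto
  have "(\<lambda>x. if x \<in> \<Omega> then g x else 0) \<in> borel_measurable lebesgue"
    using L2_measurable[OF g(1)] S borel_measurable_if by blast
  moreover have "AE x in lebesgue. (if x \<in> \<Omega> then g x else 0) = (if x \<in> \<Omega> then wgrad \<Omega> u x else 0)"
    using ae S by (auto simp: AE_restrict_space_iff elim: eventually_mono)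
  ultimately have "(\<lambda>x. if x \<in> \<Omega> then wgrad \<Omega> u x else 0) \<in> borel_measurable lebesgue"
    by (rule borel_measurable_AE)
  then have "wgrad \<Omega> u \<in> borel_measurable (lebesgue_on \<Omega>)"
    using S borel_measurable_if by blast
  then show "wgrad \<Omega> u \<in> L2 \<Omega>" by (rule L2_cong_AE[OF g(1) _ ae])
qed

lemma test_functions_L2:
  assumes "open \<Omega>" "\<phi> \<in> test_functions \<Omega>"
  shows "\<phi> \<in> L2 \<Omega>" "grad \<phi> \<in> L2 \<Omega>"
proof -
  have S: "\<Omega> \<in> sets lebesgue" using assms by auto
  obtain K where K: "compact K" "K \<subseteq> \<Omega>" "\<And>x. x \<notin> K \<Longrightarrow> \<phi> x = 0"
    using test_functions_support[OF assms(2)] by metis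
  have c: "continuous_on A \<phi>" "continuous_on A (grad \<phi>)" for A
    using test_functions_smooth[OF assms(2)] by (auto intro: smooth_continuous continuous_on_grad)
  show "\<phi> \<in> L2 \<Omega>" unfolding L2_def
  proof (safe intro!: integrable_lebesgue_on_compact_support[OF S _ K(1)] continuous_intros c)
    show "\<phi> \<in> borel_measurable (lebesgue_on \<Omega>)" by (rule continuous_imp_measurable_on_sets_lebesgue[OF c(1) S])
  qed (use K in auto)
  show "grad \<phi> \<in> L2 \<Omega>" unfolding L2_def
  proof (safe intro!: integrable_lebesgue_on_compact_support[OF S _ K(1)] continuous_intros c)
    show "grad \<phi> \<in> borel_measurable (lebesgue_on \<Omega>)" by (rule continuous_imp_measurable_on_sets_lebesgue[OF c(2) S])
    show "grad \<phi> x \<bullet> grad \<phi> x = 0" if "x \<notin> K" for x using grad_eq_0_outside[OF K(1,3) that] by simp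
  qed
qed

lemma h1norm_diff_test:
  assumes \<Omega>: "open \<Omega>" and u: "u \<in> L2 \<Omega>" "has_weak_grad \<Omega> u g" "g \<in> L2 \<Omega>"
    and \<phi>: "\<phi> \<in> test_functions \<Omega>"
  shows "h1norm \<Omega> \<Omega> (\<lambda>x. u x - \<phi> x)
    = sqrt ((l2norm \<Omega> (\<lambda>x. u x - \<phi> x))\<^sup>2 + (l2norm \<Omega> (\<lambda>x. g x - grad \<phi> x))\<^sup>2)"
proof -
  have w: "has_weak_grad \<Omega> (\<lambda>x. u x - \<phi> x) (\<lambda>x. g x - grad \<phi> x)"
    using has_weak_grad_lincomb[OF \<Omega> u(2) has_weak_grad_smooth[OF \<Omega> test_functions_smooth[OF \<phi>]], of 1 "-1"]
    by simp
  have G: "(\<lambda>x. g x - grad \<phi> x) \<in> L2 \<Omega>"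
    using u(3) test_functions_L2(2)[OF \<Omega> \<phi>] by (rule L2_diff)
  have "(\<lambda>x. u x - \<phi> x) \<in> H1 \<Omega>"
    using w G u(1) test_functions_L2(1)[OF \<Omega> \<phi>] by (auto simp: H1_def)
  then have "l2norm \<Omega> (wgrad \<Omega> (\<lambda>x. u x - \<phi> x)) = l2norm \<Omega> (\<lambda>x. g x - grad \<phi> x)"
    by (intro l2norm_cong_AE H1D(3)[OF \<Omega>] G wgrad_eq_AE[OF \<Omega> w])
  then show ?thesis by (simp add: h1norm_def h1semi_def)
qed

lemma H10I:
  assumes \<Omega>: "open \<Omega>" and u: "u \<in> L2 \<Omega>" "has_weak_grad \<Omega> u g" "g \<in> L2 \<Omega>"
    and \<phi>: "\<And>n. \<phi> n \<in> test_functions \<Omega>"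
    and lim: "(\<lambda>n. l2norm \<Omega> (\<lambda>x. u x - \<phi> n x)) \<longlonglongrightarrow> 0"
      "(\<lambda>n. l2norm \<Omega> (\<lambda>x. g x - grad (\<phi> n) x)) \<longlonglongrightarrow> 0"
  shows "u \<in> H10 \<Omega>"
proof -
  have "(\<lambda>n. sqrt ((l2norm \<Omega> (\<lambda>x. u x - \<phi> n x))\<^sup>2 + (l2norm \<Omega> (\<lambda>x. g x - grad (\<phi> n) x))\<^sup>2))
      \<longlonglongrightarrow> sqrt (0\<^sup>2 + 0\<^sup>2)"
    by (intro tendsto_intros lim)
  then have "(\<lambda>n. h1norm \<Omega> \<Omega> (\<lambda>x. u x - \<phi> n x)) \<longlonglongrightarrow> 0"
    by (simp add: h1norm_diff_test[OF \<Omega> u \<phi>])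
  moreover have "u \<in> H1 \<Omega>" using u by (auto simp: H1_def)
  ultimately show ?thesis using \<phi> by (auto simp: H10_def)
qed

lemma H10D:
  assumes \<Omega>: "open \<Omega>" and u: "u \<in> H10 \<Omega>"
  obtains \<phi> where "\<And>n::nat. \<phi> n \<in> test_functions \<Omega>"
    "(\<lambda>n. l2norm \<Omega> (\<lambda>x. u x - \<phi> n x)) \<longlonglongrightarrow> 0"
    "(\<lambda>n. l2norm \<Omega> (\<lambda>x. wgrad \<Omega> u x - grad (\<phi> n) x)) \<longlonglongrightarrow> 0"
proof -
  have uH: "u \<in> H1 \<Omega>" using u by (simp add: H10_def)
  obtain \<phi> where \<phi>: "\<And>n::nat. \<phi> n \<in> test_functions \<Omega>" "(\<lambda>n. h1norm \<Omega> \<Omega> (\<lambda>x. u x - \<phi> n x)) \<longlonglongrightarrow> 0"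
    using u by (auto simp: H10_def)
  have le: "l2norm \<Omega> (\<lambda>x. u x - \<phi> n x) \<le> h1norm \<Omega> \<Omega> (\<lambda>x. u x - \<phi> n x)"
    "l2norm \<Omega> (\<lambda>x. wgrad \<Omega> u x - grad (\<phi> n) x) \<le> h1norm \<Omega> \<Omega> (\<lambda>x. u x - \<phi> n x)" for n
    unfolding h1norm_diff_test[OF \<Omega> H1D[OF \<Omega> uH] \<phi>(1)] by (auto intro!: real_le_rsqrt)
  show ?thesis
  proof
    show "(\<lambda>n. l2norm \<Omega> (\<lambda>x. u x - \<phi> n x)) \<longlonglongrightarrow> 0"
      by (rule tendsto_sandwich[OF _ _ tendsto_const \<phi>(2)]) (auto simp: le)
    show "(\<lambda>n. l2norm \<Omega> (\<lambda>x. wgrad \<Omega> u x - grad (\<phi> n) x)) \<longlonglongrightarrow> 0"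
      by (rule tendsto_sandwich[OF _ _ tendsto_const \<phi>(2)]) (auto simp: le)
  qed (rule \<phi>)
qed

lemma H10_imp_H1: "u \<in> H10 \<Omega> \<Longrightarrow> u \<in> H1 \<Omega>"
  by (simp add: H10_def)

lemma grad_lincomb:
  "smooth f \<Longrightarrow> smooth g \<Longrightarrow> grad (\<lambda>x. a * f x + b * g x) x = a *\<^sub>R grad f x + b *\<^sub>R grad g x"
  by (rule grad_eqI) (auto intro!: derivative_eq_intros grad_works simp: inner_add_left)

lemma H10_lincomb:
  assumes \<Omega>: "open \<Omega>" and u: "u \<in> H10 \<Omega>" and v: "v \<in> H10 \<Omega>"
  shows "(\<lambda>x. a * u x + b * v x) \<in> H10 \<Omega>"
proof -
  note U = H1D[OF \<Omega> H10_imp_H1[OF u]] and V = H1D[OF \<Omega> H10_imp_H1[OF v]]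
  obtain \<phi> where \<phi>: "\<And>n::nat. \<phi> n \<in> test_functions \<Omega>"
    "(\<lambda>n. l2norm \<Omega> (\<lambda>x. u x - \<phi> n x)) \<longlonglongrightarrow> 0"
    "(\<lambda>n. l2norm \<Omega> (\<lambda>x. wgrad \<Omega> u x - grad (\<phi> n) x)) \<longlonglongrightarrow> 0"
    using H10D[OF \<Omega> u] by metis
  obtain \<psi> where \<psi>: "\<And>n::nat. \<psi> n \<in> test_functions \<Omega>"
    "(\<lambda>n. l2norm \<Omega> (\<lambda>x. v x - \<psi> n x)) \<longlonglongrightarrow> 0"
    "(\<lambda>n. l2norm \<Omega> (\<lambda>x. wgrad \<Omega> v x - grad (\<psi> n) x)) \<longlonglongrightarrow> 0"
    using H10D[OF \<Omega> v] by metis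
  note T = test_functions_L2[OF \<Omega> \<phi>(1)] test_functions_L2[OF \<Omega> \<psi>(1)]
  let ?\<chi> = "\<lambda>n x. a * \<phi> n x + b * \<psi> n x"
  have comb: "(\<lambda>n. l2norm \<Omega> (\<lambda>x. (a *\<^sub>R F x + b *\<^sub>R G x) - (a *\<^sub>R F' n x + b *\<^sub>R G' n x))) \<longlonglongrightarrow> 0"
    if L: "F \<in> L2 \<Omega>" "G \<in> L2 \<Omega>" "\<And>n. F' n \<in> L2 \<Omega>" "\<And>n. G' n \<in> L2 \<Omega>"
    and l: "(\<lambda>n. l2norm \<Omega> (\<lambda>x. F x - F' n x)) \<longlonglongrightarrow> 0" "(\<lambda>n. l2norm \<Omega> (\<lambda>x. G x - G' n x)) \<longlonglongrightarrow> 0"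
    for F G :: "'a \<Rightarrow> 'b::euclidean_space" and F' G' :: "nat \<Rightarrow> 'a \<Rightarrow> 'b"
  proof (rule tendsto_sandwich[OF _ _ tendsto_const])
    have "(\<lambda>n. \<bar>a\<bar> * l2norm \<Omega> (\<lambda>x. F x - F' n x) + \<bar>b\<bar> * l2norm \<Omega> (\<lambda>x. G x - G' n x)) \<longlonglongrightarrow> \<bar>a\<bar> * 0 + \<bar>b\<bar> * 0"
      by (intro tendsto_intros l)
    then show "(\<lambda>n. \<bar>a\<bar> * l2norm \<Omega> (\<lambda>x. F x - F' n x) + \<bar>b\<bar> * l2norm \<Omega> (\<lambda>x. G x - G' n x)) \<longlonglongrightarrow> 0" by simp
    have "l2norm \<Omega> (\<lambda>x. (a *\<^sub>R F x + b *\<^sub>R G x) - (a *\<^sub>R F' n x + b *\<^sub>R G' n x))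
        \<le> \<bar>a\<bar> * l2norm \<Omega> (\<lambda>x. F x - F' n x) + \<bar>b\<bar> * l2norm \<Omega> (\<lambda>x. G x - G' n x)" for n
      using l2norm_triangle[OF L2_scaleR[OF L2_diff[OF L(1) L(3)[of n]], of a] L2_scaleR[OF L2_diff[OF L(2) L(4)[of n]], of b]]
      unfolding l2norm_scaleR by (simp add: algebra_simps)
    then show "\<forall>\<^sub>F n in sequentially. l2norm \<Omega> (\<lambda>x. (a *\<^sub>R F x + b *\<^sub>R G x) - (a *\<^sub>R F' n x + b *\<^sub>R G' n x))
        \<le> \<bar>a\<bar> * l2norm \<Omega> (\<lambda>x. F x - F' n x) + \<bar>b\<bar> * l2norm \<Omega> (\<lambda>x. G x - G' n x)" by simp
  qed simp
  show ?thesis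
  proof (rule H10I[OF \<Omega>])
    show "has_weak_grad \<Omega> (\<lambda>x. a * u x + b * v x) (\<lambda>x. a *\<^sub>R wgrad \<Omega> u x + b *\<^sub>R wgrad \<Omega> v x)"
      by (rule has_weak_grad_lincomb[OF \<Omega> U(2) V(2)])
    show "?\<chi> n \<in> test_functions \<Omega>" for n
      by (intro test_functions_add test_functions_mult_smooth smooth_const \<phi> \<psi>)
    show "(\<lambda>n. l2norm \<Omega> (\<lambda>x. a * u x + b * v x - ?\<chi> n x)) \<longlonglongrightarrow> 0"
      using comb[OF U(1) V(1) T(1,3) \<phi>(2) \<psi>(2)] by simp
    have "grad (?\<chi> n) = (\<lambda>x. a *\<^sub>R grad (\<phi> n) x + b *\<^sub>R grad (\<psi> n) x)" for n
      by (rule ext) (intro grad_lincomb test_functions_smooth[OF \<phi>(1)] test_functions_smooth[OF \<psi>(1)])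
    then show "(\<lambda>n. l2norm \<Omega> (\<lambda>x. a *\<^sub>R wgrad \<Omega> u x + b *\<^sub>R wgrad \<Omega> v x - grad (?\<chi> n) x)) \<longlonglongrightarrow> 0"
      using comb[OF U(3) V(3) T(2,4) \<phi>(3) \<psi>(3)] by simp
  qed (use U V in auto)
qed

lemma wgrad_lincomb_AE:
  assumes \<Omega>: "open \<Omega>" and "u \<in> H1 \<Omega>" "v \<in> H1 \<Omega>"
  shows "AE x in lebesgue_on \<Omega>. wgrad \<Omega> (\<lambda>x. a * u x + b * v x) x = a *\<^sub>R wgrad \<Omega> u x + b *\<^sub>R wgrad \<Omega> v x"
  using has_weak_grad_lincomb[OF \<Omega> H1D(2)[OF \<Omega> assms(2)] H1D(2)[OF \<Omega> assms(3)]]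
  by (rule wgrad_eq_AE[OF \<Omega>])

lemma wgrad_diff_AE:
  assumes \<Omega>: "open \<Omega>" and "u \<in> H1 \<Omega>" "v \<in> H1 \<Omega>"
  shows "AE x in lebesgue_on \<Omega>. wgrad \<Omega> (\<lambda>x. u x - v x) x = wgrad \<Omega> u x - wgrad \<Omega> v x"
  using wgrad_lincomb_AE[OF assms, of 1 "-1"] by simp

lemma H10_diff:
  assumes \<Omega>: "open \<Omega>" and u: "u \<in> H10 \<Omega>" and v: "v \<in> H10 \<Omega>"
  shows "(\<lambda>x. u x - v x) \<in> H10 \<Omega>"
  using H10_lincomb[OF assms, of 1 "-1"] by simp

lemma H10_zero:
  assumes "open \<Omega>"
  shows "(\<lambda>x. 0) \<in> H10 \<Omega>"
proof -
  have g: "grad (\<lambda>x. 0 :: real) = (\<lambda>x. 0)"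
    using grad_affine[of 0 0] by (auto simp: fun_eq_iff)
  have "has_weak_grad \<Omega> (\<lambda>x. 0) (\<lambda>x. 0)"
    using has_weak_grad_smooth[OF assms smooth_const[of 0]] unfolding g .
  moreover have "(\<lambda>x. 0) \<in> test_functions \<Omega>"
    by (rule test_functionsI[of _ "{}"]) auto
  ultimately show ?thesis
    using assms by (intro H10I[of \<Omega> _ "\<lambda>x. 0" "\<lambda>n x. 0"]) (auto simp: g l2norm_def l2inner_def)
qed

text \<open>The tool for showing that a concrete function vanishes on the boundary. The last conclusion is
  inherited from the test functions, whose gradients have mean zero.\<close>

lemma H10_bounded_limit:
  fixes \<phi> :: "nat \<Rightarrow> 'a::euclidean_space \<Rightarrow> real"
  assumes \<Omega>: "open \<Omega>" "bounded \<Omega>" and \<phi>: "\<And>n. \<phi> n \<in> test_functions \<Omega>"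
    and lim: "\<And>x. (\<lambda>n. \<phi> n x) \<longlonglongrightarrow> u x" "\<And>x. (\<lambda>n. grad (\<phi> n) x) \<longlonglongrightarrow> G x"
    and bd: "\<And>n x. x \<in> \<Omega> \<Longrightarrow> \<bar>\<phi> n x\<bar> \<le> B" "\<And>n x. x \<in> \<Omega> \<Longrightarrow> norm (grad (\<phi> n) x) \<le> B"
  shows "u \<in> H10 \<Omega>" "has_weak_grad \<Omega> u G" "G \<in> L2 \<Omega>" "(LINT x|lebesgue_on \<Omega>. G x \<bullet> a) = 0"
proof -
  have S: "\<Omega> \<in> sets lebesgue" using \<Omega> by auto
  have sm: "smooth (\<phi> n)" for n by (rule test_functions_smooth[OF \<phi>])
  have m: "\<phi> n \<in> borel_measurable borel" "grad (\<phi> n) \<in> borel_measurable borel" for n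
    using sm by (auto intro: borel_measurable_continuous_onI smooth_continuous continuous_on_grad)
  have um: "u \<in> borel_measurable borel" by (rule borel_measurable_LIMSEQ_metric[OF m(1) lim(1)])
  have Gm: "G \<in> borel_measurable borel" by (rule borel_measurable_LIMSEQ_metric[OF m(2) lim(2)])
  have leb: "f \<in> borel_measurable (lebesgue_on A)" if "f \<in> borel_measurable borel"
    for f :: "'a \<Rightarrow> 'b::euclidean_space" and A
    using that by (intro measurable_restrict_space1 measurable_completion) simp
  have ub: "\<bar>u x\<bar> \<le> B" if "x \<in> \<Omega>" for x
    by (rule LIMSEQ_le_const2[OF tendsto_rabs[OF lim(1)]]) (use bd that in auto)
  have Gb: "norm (G x) \<le> B" if "x \<in> \<Omega>" for x
    by (rule LIMSEQ_le_const2[OF tendsto_norm[OF lim(2)]]) (use bd that in auto)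
  have fin: "finite_measure (lebesgue_on \<Omega>)"
    using S \<Omega> by (simp add: bounded_set_imp_lmeasurable finite_measure_lebesgue_on)
  have uL: "u \<in> L2 \<Omega>" by (rule L2_bounded[OF S \<Omega>(2) leb[OF um]]) (use ub in auto)
  show GL: "G \<in> L2 \<Omega>" by (rule L2_bounded[OF S \<Omega>(2) leb[OF Gm]]) (use Gb in auto)
  have loc: "loc_integrable \<Omega> f" if "f \<in> borel_measurable borel" "\<And>x. x \<in> \<Omega> \<Longrightarrow> norm (f x) \<le> B"
    for f :: "'a \<Rightarrow> 'b::euclidean_space"
    unfolding loc_integrable_def
  proof (intro allI impI)
    fix K :: "'a set" assume K: "compact K \<and> K \<subseteq> \<Omega>"
    interpret finite_measure "lebesgue_on K"
      using K by (simp add: lmeasurable_compact finite_measure_lebesgue_on)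
    show "integrable (lebesgue_on K) f"
      by (rule integrable_const_bound[of _ B]) (use that K leb in \<open>auto intro!: AE_I2\<close>)
  qed
  show wg: "has_weak_grad \<Omega> u G"
    unfolding has_weak_grad_def
  proof (intro conjI ballI)
    show "loc_integrable \<Omega> u" "loc_integrable \<Omega> G" using um Gm ub Gb by (auto intro!: loc)
    fix \<psi> :: "'a \<Rightarrow> real" and i :: 'a assume \<psi>: "\<psi> \<in> test_functions \<Omega>" and i: "i \<in> Basis"
    let ?D = "\<lambda>x. frechet_derivative \<psi> (at x) i"
    have D: "?D \<in> test_functions \<Omega>" by (rule test_function_partial[OF \<psi> i])
    have *: "(\<lambda>n. LINT x|lebesgue_on \<Omega>. f n x * \<theta> x) \<longlonglongrightarrow> (LINT x|lebesgue_on \<Omega>. f0 x * \<theta> x)"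
      if \<theta>: "\<theta> \<in> test_functions \<Omega>" and f: "\<And>n. f n \<in> borel_measurable borel" "f0 \<in> borel_measurable borel"
        "\<And>x. (\<lambda>n. f n x) \<longlonglongrightarrow> f0 x" "\<And>n x. x \<in> \<Omega> \<Longrightarrow> \<bar>f n x\<bar> \<le> B"
      for f and f0 \<theta> :: "'a \<Rightarrow> real"
    proof (rule integral_dominated_convergence[where w = "\<lambda>x. B * \<bar>\<theta> x\<bar>"])
      have \<theta>m: "\<theta> \<in> borel_measurable borel"
        using test_functions_smooth[OF \<theta>] by (intro borel_measurable_continuous_onI smooth_continuous)
      have "integrable (lebesgue_on \<Omega>) \<theta>"
        using integrable_loc_integrable_test[OF \<Omega>(1) loc_integrable_continuous \<theta>, of "\<lambda>_. 1"] by simp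
      then show "integrable (lebesgue_on \<Omega>) (\<lambda>x. B * \<bar>\<theta> x\<bar>)" by simp
      show "AE x in lebesgue_on \<Omega>. (\<lambda>n. f n x * \<theta> x) \<longlonglongrightarrow> f0 x * \<theta> x"
        by (intro AE_I2 tendsto_mult f tendsto_const)
      show "AE x in lebesgue_on \<Omega>. norm (f n x * \<theta> x) \<le> B * \<bar>\<theta> x\<bar>" for n
        using f(4) by (intro AE_I2) (auto simp: abs_mult intro!: mult_right_mono)
      show "(\<lambda>x. f0 x * \<theta> x) \<in> borel_measurable (lebesgue_on \<Omega>)"
        "(\<lambda>x. f n x * \<theta> x) \<in> borel_measurable (lebesgue_on \<Omega>)" for n
        using f \<theta>m by (auto intro!: leb)
    qed
    have 1: "(\<lambda>n. LINT x|lebesgue_on \<Omega>. \<phi> n x * ?D x) \<longlonglongrightarrow> (LINT x|lebesgue_on \<Omega>. u x * ?D x)"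
      by (rule *[OF D m(1) um lim(1) bd(1)])
    have gi: "\<bar>grad (\<phi> n) x \<bullet> i\<bar> \<le> B" if "x \<in> \<Omega>" for n x
      using Basis_le_norm[OF i] bd(2)[OF that] order_trans by blast
    have 2: "(\<lambda>n. LINT x|lebesgue_on \<Omega>. (grad (\<phi> n) x \<bullet> i) * \<psi> x) \<longlonglongrightarrow> (LINT x|lebesgue_on \<Omega>. (G x \<bullet> i) * \<psi> x)"
      by (rule *[OF \<psi>]) (use m Gm lim gi in \<open>auto intro!: tendsto_intros\<close>)
    have "(LINT x|lebesgue_on \<Omega>. \<phi> n x * ?D x) = - (LINT x|lebesgue_on \<Omega>. (grad (\<phi> n) x \<bullet> i) * \<psi> x)" for n
      using has_weak_grad_smooth[OF \<Omega>(1) sm[of n]] \<psi> i by (simp add: has_weak_grad_def)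
    then have "(\<lambda>n. LINT x|lebesgue_on \<Omega>. \<phi> n x * ?D x) \<longlonglongrightarrow> - (LINT x|lebesgue_on \<Omega>. (G x \<bullet> i) * \<psi> x)"
      using tendsto_minus[OF 2] by simp
    with 1 show "(LINT x|lebesgue_on \<Omega>. u x * ?D x) = - (LINT x|lebesgue_on \<Omega>. (G x \<bullet> i) * \<psi> x)"
      by (rule LIMSEQ_unique)
  qed
  show "u \<in> H10 \<Omega>"
  proof (rule H10I[OF \<Omega>(1) uL wg GL \<phi>])
    show "(\<lambda>n. l2norm \<Omega> (\<lambda>x. u x - \<phi> n x)) \<longlonglongrightarrow> 0"
    proof (rule l2norm_tendsto_0_bounded[OF S \<Omega>(2)])
      show "(\<lambda>n. u x - \<phi> n x) \<longlonglongrightarrow> 0" for x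
        using tendsto_diff[OF tendsto_const[of "u x"] lim(1)[of x]] by simp
      show "norm (u x - \<phi> n x) \<le> B + B" if "x \<in> \<Omega>" for n x
        using ub[OF that] bd(1)[OF that, of n] by (simp add: abs_le_iff)
    qed (use um m in \<open>auto intro!: leb\<close>)
    show "(\<lambda>n. l2norm \<Omega> (\<lambda>x. G x - grad (\<phi> n) x)) \<longlonglongrightarrow> 0"
    proof (rule l2norm_tendsto_0_bounded[OF S \<Omega>(2)])
      show "(\<lambda>n. G x - grad (\<phi> n) x) \<longlonglongrightarrow> 0" for x
        using tendsto_diff[OF tendsto_const[of "G x"] lim(2)[of x]] by simp
      show "norm (G x - grad (\<phi> n) x) \<le> B + B" if "x \<in> \<Omega>" for n x
        using norm_triangle_ineq4[of "G x" "grad (\<phi> n) x"] Gb[OF that] bd(2)[OF that, of n] by linarith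
    qed (use Gm m in \<open>auto intro!: leb\<close>)
  qed
  have z: "(LINT x|lebesgue_on \<Omega>. grad (\<phi> n) x \<bullet> a) = 0" for n
  proof -
    obtain K where K: "compact K" "K \<subseteq> \<Omega>" "\<And>x. x \<notin> K \<Longrightarrow> \<phi> n x = 0"
      using test_functions_support[OF \<phi>] by metis
    have g0: "grad (\<phi> n) x = 0" if "x \<notin> K" for x
      by (rule grad_eq_0_outside[OF K(1,3) that])
    then have g0': "grad (\<phi> n) x = 0" if "x \<notin> \<Omega>" for x
      using K(2) that by blast
    have gi: "integrable lborel (\<lambda>x. grad (\<phi> n) x \<bullet> i)" for i
      by (rule integrable_continuous_compact_support[OF _ K(1)])
        (use g0 sm in \<open>auto intro!: continuous_intros continuous_on_grad\<close>)
    have "(LINT x|lebesgue_on \<Omega>. grad (\<phi> n) x \<bullet> a) = (LINT x|lborel. grad (\<phi> n) x \<bullet> a)"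
      by (rule integral_lebesgue_on_support[OF S])
        (use g0' m in auto)
    also have "\<dots> = (LINT x|lborel. (\<Sum>i\<in>Basis. (a \<bullet> i) * (grad (\<phi> n) x \<bullet> i)))"
      by (subst euclidean_inner) (simp add: mult.commute)
    also have "\<dots> = (\<Sum>i\<in>Basis. (a \<bullet> i) * (LINT x|lborel. grad (\<phi> n) x \<bullet> i))"
      using gi by (simp add: Bochner_Integration.integral_sum)
    also have "\<dots> = 0"
      using integral_partial_derivative_eq_0[OF sm[of n] K(1,3)] by simp
    finally show ?thesis .
  qed
  have "(\<lambda>n. LINT x|lebesgue_on \<Omega>. grad (\<phi> n) x \<bullet> a) \<longlonglongrightarrow> (LINT x|lebesgue_on \<Omega>. G x \<bullet> a)"
  proof (rule integral_dominated_convergence[where w = "\<lambda>x. B * norm a"])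
    show "integrable (lebesgue_on \<Omega>) (\<lambda>x. B * norm a)"
      using fin finite_measure.integrable_const by blast
    show "AE x in lebesgue_on \<Omega>. (\<lambda>n. grad (\<phi> n) x \<bullet> a) \<longlonglongrightarrow> G x \<bullet> a"
      by (intro AE_I2 tendsto_intros lim)
    show "AE x in lebesgue_on \<Omega>. norm (grad (\<phi> n) x \<bullet> a) \<le> B * norm a" for n
    proof (rule AE_I2)
      fix x assume "x \<in> space (lebesgue_on \<Omega>)"
      then have "norm (grad (\<phi> n) x) * norm a \<le> B * norm a" using bd(2) by (intro mult_right_mono) auto
      then show "norm (grad (\<phi> n) x \<bullet> a) \<le> B * norm a"
        using Cauchy_Schwarz_ineq2[of "grad (\<phi> n) x" a] by simp
    qed
  qed (use Gm m in \<open>auto intro!: leb\<close>)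
  then have "(\<lambda>n::nat. 0) \<longlonglongrightarrow> (LINT x|lebesgue_on \<Omega>. G x \<bullet> a)" by (simp only: z)
  then show "(LINT x|lebesgue_on \<Omega>. G x \<bullet> a) = 0" by (rule LIMSEQ_unique[OF _ tendsto_const])
qed

section \<open>The convective term\<close>

lemma L2_inner_bounded:
  fixes \<beta> F :: "'a::euclidean_space \<Rightarrow> 'b::euclidean_space"
  assumes \<beta>: "\<beta> \<in> borel_measurable (lebesgue_on S)" "AE x in lebesgue_on S. norm (\<beta> x) \<le> B" "0 \<le> B"
    and F: "F \<in> L2 S"
  shows "(\<lambda>x. \<beta> x \<bullet> F x) \<in> L2 S" "l2norm S (\<lambda>x. \<beta> x \<bullet> F x) \<le> B * l2norm S F"
proof -
  have m: "(\<lambda>x. \<beta> x \<bullet> F x) \<in> borel_measurable (lebesgue_on S)"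
    using \<beta>(1) L2_measurable[OF F] by auto
  have le: "AE x in lebesgue_on S. norm (\<beta> x \<bullet> F x) \<le> B * norm (F x)"
    using \<beta>(2)
  proof eventually_elim
    case (elim x)
    have "norm (\<beta> x \<bullet> F x) \<le> norm (\<beta> x) * norm (F x)" using Cauchy_Schwarz_ineq2 by simp
    also have "\<dots> \<le> B * norm (F x)" using elim by (intro mult_right_mono) auto
    finally show ?case .
  qed
  have "integrable (lebesgue_on S) (\<lambda>x. (\<beta> x \<bullet> F x) \<bullet> (\<beta> x \<bullet> F x))"
  proof (rule Bochner_Integration.integrable_bound)
    show "integrable (lebesgue_on S) (\<lambda>x. B\<^sup>2 * (F x \<bullet> F x))" using F by (auto simp: L2_def)
    show "AE x in lebesgue_on S. norm ((\<beta> x \<bullet> F x) \<bullet> (\<beta> x \<bullet> F x)) \<le> norm (B\<^sup>2 * (F x \<bullet> F x))"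
      using le
    proof eventually_elim
      case (elim x)
      then have "(norm (\<beta> x \<bullet> F x))\<^sup>2 \<le> (B * norm (F x))\<^sup>2" by (intro power_mono) auto
      then show ?case by (simp add: power_mult_distrib power2_norm_eq_inner flip: power2_eq_square)
    qed
  qed (use m in auto)
  then show L: "(\<lambda>x. \<beta> x \<bullet> F x) \<in> L2 S" using m by (simp add: L2_def)
  show "l2norm S (\<lambda>x. \<beta> x \<bullet> F x) \<le> B * l2norm S F"
    by (rule l2norm_le_bound[OF L F \<beta>(3) le])
qed

text \<open>For a test function \<open>\<phi>\<close> the integrand \<open>(\<beta> \<cdot> \<nabla>\<phi>) \<phi>\<close> is \<open>\<beta> \<cdot> \<nabla>(\<phi>\<^sup>2) / 2\<close>, and \<open>\<phi>\<^sup>2\<close> is again a test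
  function, so that the weak divergence of \<open>\<beta>\<close> appears. The general case follows by density.\<close>

lemma convection_skew:
  fixes \<beta> :: "'a::euclidean_space \<Rightarrow> 'a"
  assumes \<Omega>: "open \<Omega>"
    and \<beta>: "\<beta> \<in> borel_measurable (lebesgue_on \<Omega>)" "AE x in lebesgue_on \<Omega>. norm (\<beta> x) \<le> B" "0 \<le> B"
    and G: "\<And>i. i \<in> Basis \<Longrightarrow> has_weak_grad \<Omega> (\<lambda>x. \<beta> x \<bullet> i) (G i)"
    and div: "AE x in lebesgue_on \<Omega>. (\<Sum>i\<in>Basis. G i x \<bullet> i) = 0"
    and w: "w \<in> H10 \<Omega>"
  shows "l2inner \<Omega> (\<lambda>x. \<beta> x \<bullet> wgrad \<Omega> w x) w = 0"
proof -
  let ?b = "\<lambda>F v. l2inner \<Omega> (\<lambda>x. \<beta> x \<bullet> F x) v"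
  have test: "?b (grad \<phi>) \<phi> = 0" if \<phi>: "\<phi> \<in> test_functions \<Omega>" for \<phi>
  proof -
    have sm: "smooth \<phi>" by (rule test_functions_smooth[OF \<phi>])
    have sq: "(\<lambda>x. \<phi> x * \<phi> x) \<in> test_functions \<Omega>" by (rule test_functions_mult_smooth[OF sm \<phi>])
    have g: "grad (\<lambda>x. \<phi> x * \<phi> x) x = (2 * \<phi> x) *\<^sub>R grad \<phi> x" for x
      by (simp add: grad_mult[OF sm sm] flip: scaleR_2)
    have li: "loc_integrable \<Omega> (\<lambda>x. \<beta> x \<bullet> i)" "loc_integrable \<Omega> (\<lambda>x. G i x \<bullet> i)" if "i \<in> Basis" for i
      using G[OF that] by (auto simp: has_weak_grad_def intro: loc_integrable_inner)
    have "2 * ?b (grad \<phi>) \<phi> = (LINT x|lebesgue_on \<Omega>. \<beta> x \<bullet> grad (\<lambda>x. \<phi> x * \<phi> x) x)"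
      by (simp add: l2inner_def g flip: integral_mult_right_zero) (simp add: mult_ac)
    also have "\<dots> = (LINT x|lebesgue_on \<Omega>. (\<Sum>i\<in>Basis. (\<beta> x \<bullet> i) * frechet_derivative (\<lambda>x. \<phi> x * \<phi> x) (at x) i))"
      by (subst euclidean_inner) (simp add: grad_inner)
    also have "\<dots> = (\<Sum>i\<in>Basis. (LINT x|lebesgue_on \<Omega>. (\<beta> x \<bullet> i) * frechet_derivative (\<lambda>x. \<phi> x * \<phi> x) (at x) i))"
      by (intro Bochner_Integration.integral_sum integrable_loc_integrable_test[OF \<Omega>] li test_function_partial[OF sq])
    also have "\<dots> = (\<Sum>i\<in>Basis. - (LINT x|lebesgue_on \<Omega>. (G i x \<bullet> i) * (\<phi> x * \<phi> x)))"
      using G sq by (intro sum.cong) (auto simp: has_weak_grad_def)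
    also have "\<dots> = - (LINT x|lebesgue_on \<Omega>. (\<Sum>i\<in>Basis. (G i x \<bullet> i) * (\<phi> x * \<phi> x)))"
      unfolding sum_negf
      by (intro arg_cong[where f = uminus] Bochner_Integration.integral_sum[symmetric]
          integrable_loc_integrable_test[OF \<Omega>] li sq)
    also have "(LINT x|lebesgue_on \<Omega>. (\<Sum>i\<in>Basis. (G i x \<bullet> i) * (\<phi> x * \<phi> x))) = 0"
    proof (rule integral_eq_zero_AE)
      show "AE x in lebesgue_on \<Omega>. (\<Sum>i\<in>Basis. (G i x \<bullet> i) * (\<phi> x * \<phi> x)) = 0"
        using div by eventually_elim (simp flip: sum_distrib_right)
    qed
    finally show ?thesis by simp
  qed
  note W = H1D[OF \<Omega> H10_imp_H1[OF w]]
  obtain \<phi> where \<phi>: "\<And>n::nat. \<phi> n \<in> test_functions \<Omega>"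
    "(\<lambda>n. l2norm \<Omega> (\<lambda>x. w x - \<phi> n x)) \<longlonglongrightarrow> 0"
    "(\<lambda>n. l2norm \<Omega> (\<lambda>x. wgrad \<Omega> w x - grad (\<phi> n) x)) \<longlonglongrightarrow> 0"
    using H10D[OF \<Omega> w] by metis
  define p q where "p n = l2norm \<Omega> (\<lambda>x. w x - \<phi> n x)"
    and "q n = l2norm \<Omega> (\<lambda>x. wgrad \<Omega> w x - grad (\<phi> n) x)" for n
  have bb: "\<bar>?b F v\<bar> \<le> B * l2norm \<Omega> F * l2norm \<Omega> v" if "F \<in> L2 \<Omega>" "v \<in> L2 \<Omega>" for F v
  proof -
    have "\<bar>?b F v\<bar> \<le> l2norm \<Omega> (\<lambda>x. \<beta> x \<bullet> F x) * l2norm \<Omega> v"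
      by (rule l2inner_Cauchy_Schwarz[OF L2_inner_bounded(1)[OF \<beta> that(1)] that(2)])
    also have "\<dots> \<le> B * l2norm \<Omega> F * l2norm \<Omega> v"
      by (intro mult_right_mono L2_inner_bounded(2)[OF \<beta> that(1)]) simp
    finally show ?thesis .
  qed
  have est: "\<bar>?b (wgrad \<Omega> w) w\<bar> \<le> B * q n * l2norm \<Omega> w + B * l2norm \<Omega> (wgrad \<Omega> w) * p n + B * q n * p n" for n
  proof -
    let ?E = "\<lambda>x. wgrad \<Omega> w x - grad (\<phi> n) x" and ?e = "\<lambda>x. w x - \<phi> n x"
    note T = test_functions_L2[OF \<Omega> \<phi>(1), of n]
    have E: "?E \<in> L2 \<Omega>" "?e \<in> L2 \<Omega>" using W T by auto
    note b = L2_inner_bounded(1)[OF \<beta> W(3)] L2_inner_bounded(1)[OF \<beta> T(2)]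
    have dl: "?b ?E v = ?b (wgrad \<Omega> w) v - ?b (grad (\<phi> n)) v" if "v \<in> L2 \<Omega>" for v
      unfolding inner_diff_right by (rule l2inner_diff_left[OF b that])
    have dr: "?b F ?e = ?b F w - ?b F (\<phi> n)" if "(\<lambda>x. \<beta> x \<bullet> F x) \<in> L2 \<Omega>" for F
      by (rule l2inner_diff_right[OF W(1) T(1) that])
    have "?b (wgrad \<Omega> w) w = ?b ?E w + ?b (wgrad \<Omega> w) ?e - ?b ?E ?e"
      unfolding dl[OF W(1)] dl[OF E(2)] dr[OF b(1)] dr[OF b(2)] using test[OF \<phi>(1), of n] by simp
    then show ?thesis
      using bb[OF E(1) W(1)] bb[OF W(3) E(2)] bb[OF E] unfolding p_def q_def by linarith
  qed
  have "(\<lambda>n. B * q n * l2norm \<Omega> w + B * l2norm \<Omega> (wgrad \<Omega> w) * p n + B * q n * p n)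
      \<longlonglongrightarrow> B * 0 * l2norm \<Omega> w + B * l2norm \<Omega> (wgrad \<Omega> w) * 0 + B * 0 * 0"
    by (intro tendsto_intros \<phi>(2,3)[folded p_def q_def])
  then have "\<bar>?b (wgrad \<Omega> w) w\<bar> \<le> B * 0 * l2norm \<Omega> w + B * l2norm \<Omega> (wgrad \<Omega> w) * 0 + B * 0 * 0"
    by (rule LIMSEQ_le_const) (use est in auto)
  then show ?thesis by simp
qed

section \<open>Simplices and their bubble functions\<close>

locale full_simplex =
  fixes T :: "'a::euclidean_space set"
  assumes simplex: "int DIM('a) simplex T"
begin

abbreviation "V \<equiv> vertices T"

lemma vertices_props: "finite V" "\<not> affine_dependent V" "card V = Suc DIM('a)" "convex hull V = T"
proof -
  obtain C where C: "finite C" "\<not> affine_dependent C" "int (card C) = int DIM('a) + 1" "T = convex hull C"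
    using simplex by (auto simp: Polytope.simplex)
  have "V = C"
    unfolding vertices_def C(4) by (simp add: extreme_point_of_convex_hull_affine_independent[OF C(2)])
  then show "finite V" "\<not> affine_dependent V" "card V = Suc DIM('a)" "convex hull V = T"
    using C by simp_all
qed

lemma compact: "compact T"
  using vertices_props by (metis finite_imp_compact_convex_hull)

lemma convex: "convex T"
  using vertices_props(4) convex_convex_hull by metis

lemma lebesgue: "T \<in> sets lebesgue"
  using compact by (simp add: lmeasurable_compact fmeasurableD)

lemma negligible_diff_interior: "negligible (T - interior T)"
  by (rule negligible_subset[OF negligible_convex_frontier[OF convex]])
    (auto simp: frontier_def closure_subset[THEN subsetD])

text \<open>The affine independence of the vertices, in the form in which barycentric coordinates use it.\<close>

lemma coefficients_unique:
  assumes "\<And>v. v \<notin> V \<Longrightarrow> c v = 0" "sum c V = sum d V" "(\<Sum>v\<in>V. c v *\<^sub>R v) = (\<Sum>v\<in>V. d v *\<^sub>R v)"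
    "\<And>v. v \<notin> V \<Longrightarrow> d v = 0"
  shows "c = d"
proof (rule ccontr)
  assume "c \<noteq> d"
  then obtain v where "c v \<noteq> d v" by auto
  moreover from this have "v \<in> V" using assms(1,4)[of v] by force
  moreover have "(\<Sum>v\<in>V. c v - d v) = 0" using assms by (simp add: sum_subtractf)
  moreover have "(\<Sum>v\<in>V. (c v - d v) *\<^sub>R v) = 0"
    using assms by (simp add: sum_subtractf scaleR_diff_left)
  ultimately have "affine_dependent V"
    unfolding affine_dependent_explicit_finite[OF vertices_props(1)] by (intro exI[of _ "\<lambda>v. c v - d v"]) auto
  then show False using vertices_props(2) by simp
qed

lemma barycentric_props:
  "v \<notin> V \<Longrightarrow> barycentric T x v = 0" "(\<Sum>v\<in>V. barycentric T x v) = 1"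
  "(\<Sum>v\<in>V. barycentric T x v *\<^sub>R v) = x"
proof -
  let ?P = "\<lambda>c. (\<forall>v. v \<notin> V \<longrightarrow> c v = 0) \<and> (\<Sum>v\<in>V. c v) = 1 \<and> (\<Sum>v\<in>V. c v *\<^sub>R v) = x"
  have "x \<in> affine hull V"
    using affine_independent_span_eq[OF vertices_props(2,3)] by simp
  then obtain u where u: "sum u V = 1" "(\<Sum>v\<in>V. u v *\<^sub>R v) = x"
    using affine_hull_finite[OF vertices_props(1)] by auto
  have ex: "?P (\<lambda>v. if v \<in> V then u v else 0)"
    using u by simp
  have un: "c = d" if "?P c" "?P d" for c d
    using that by (intro coefficients_unique) auto
  have "\<exists>!c. ?P c"
    by (rule ex1I[where P = ?P, OF ex]) (rule un[OF _ ex])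
  then have "?P (barycentric T x)"
    unfolding barycentric_def by (rule theI')
  then show "v \<notin> V \<Longrightarrow> barycentric T x v = 0" "(\<Sum>v\<in>V. barycentric T x v) = 1"
    "(\<Sum>v\<in>V. barycentric T x v *\<^sub>R v) = x" by auto
qed

lemma barycentric_eqI:
  assumes "\<And>v. v \<notin> V \<Longrightarrow> c v = 0" "sum c V = 1" "(\<Sum>v\<in>V. c v *\<^sub>R v) = x"
  shows "barycentric T x = c"
  by (rule coefficients_unique) (use assms barycentric_props in auto)

text \<open>By uniqueness of the coefficients the coordinates of an affine combination are the affine
  combination of the coordinates; \<open>comb\<close> states this for combinations of \<open>x\<close>, \<open>y\<close> and \<open>0\<close>.\<close>

lemma barycentric_affine: "\<exists>a c. \<forall>x. barycentric T x v = a \<bullet> x + c"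
proof -
  define f where "f x = barycentric T x v - barycentric T 0 v" for x
  have comb: "barycentric T (r *\<^sub>R x + s *\<^sub>R y)
      = (\<lambda>v. r * barycentric T x v + s * barycentric T y v + (1 - r - s) * barycentric T 0 v)" for r s x y
  proof (rule barycentric_eqI)
    show "(\<Sum>v\<in>V. r * barycentric T x v + s * barycentric T y v + (1 - r - s) * barycentric T 0 v) = 1"
      by (simp add: sum.distrib barycentric_props flip: sum_distrib_left)
    show "(\<Sum>v\<in>V. (r * barycentric T x v + s * barycentric T y v + (1 - r - s) * barycentric T 0 v) *\<^sub>R v)
        = r *\<^sub>R x + s *\<^sub>R y"
      by (simp add: scaleR_add_left sum.distrib barycentric_props flip: scaleR_scaleR scaleR_sum_right)
  qed (simp add: barycentric_props)
  have "linear f"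
  proof (rule linearI)
    show "f (x + y) = f x + f y" for x y
      using comb[of 1 x 1 y] by (simp add: f_def)
    show "f (r *\<^sub>R x) = r *\<^sub>R f x" for r x
      using comb[of r x 0 x] by (simp add: f_def algebra_simps)
  qed
  then interpret linear f .
  define a where "a = (\<Sum>i\<in>Basis. f i *\<^sub>R i)"
  have "f x = a \<bullet> x" for x
  proof -
    have "f x = f (\<Sum>i\<in>Basis. (x \<bullet> i) *\<^sub>R i)" by (simp add: euclidean_representation)
    also have "\<dots> = a \<bullet> x"
      by (simp add: a_def sum scaleR inner_sum_left inner_commute[of x] mult.commute)
    finally show ?thesis .
  qed
  then have "barycentric T x v = a \<bullet> x + barycentric T 0 v" for x
    by (metis f_def diff_add_cancel)
  then show ?thesis by blast
qed

text \<open>The gradient of the barycentric coordinate at \<open>v\<close>.\<close>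

definition slope :: "'a \<Rightarrow> 'a" where
  "slope v = (SOME a. \<exists>c. \<forall>x. barycentric T x v = a \<bullet> x + c)"

definition offset :: "'a \<Rightarrow> real" where
  "offset v = barycentric T 0 v"

lemma barycentric_eq: "barycentric T x v = slope v \<bullet> x + offset v"
proof -
  obtain c where c: "\<forall>x. barycentric T x v = slope v \<bullet> x + c"
    using someI_ex[OF barycentric_affine[of v]] unfolding slope_def by blast
  from c have "offset v = c" by (simp add: offset_def)
  with c show ?thesis by simp
qed

lemma mem_iff: "x \<in> T \<longleftrightarrow> (\<forall>v\<in>V. 0 \<le> barycentric T x v)"
proof
  assume "x \<in> T"
  then have "x \<in> convex hull V" by (simp only: vertices_props(4))
  then obtain u where u: "\<forall>v\<in>V. 0 \<le> u v" "sum u V = 1" "(\<Sum>v\<in>V. u v *\<^sub>R v) = x"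
    unfolding convex_hull_finite[OF vertices_props(1)] by blast
  have "barycentric T x = (\<lambda>v. if v \<in> V then u v else 0)"
    by (rule barycentric_eqI) (use u in auto)
  then show "\<forall>v\<in>V. 0 \<le> barycentric T x v" using u by simp
next
  assume "\<forall>v\<in>V. 0 \<le> barycentric T x v"
  then have "x \<in> convex hull V"
    unfolding convex_hull_finite[OF vertices_props(1)] using barycentric_props by blast
  then show "x \<in> T" by (simp only: vertices_props(4))
qed

lemma mem_interior_iff: "x \<in> interior T \<longleftrightarrow> (\<forall>v\<in>V. 0 < barycentric T x v)"
proof -
  have int: "interior T = {y. \<exists>u. (\<forall>x\<in>V. 0 < u x) \<and> sum u V = 1 \<and> (\<Sum>x\<in>V. u x *\<^sub>R x) = y}"
    using interior_convex_hull_explicit_minimal[OF vertices_props(2)]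
    unfolding vertices_props(3,4) by simp
  show ?thesis
  proof
    assume "x \<in> interior T"
    then obtain u where u: "\<forall>v\<in>V. 0 < u v" "sum u V = 1" "(\<Sum>v\<in>V. u v *\<^sub>R v) = x"
      using int by auto
    have "barycentric T x = (\<lambda>v. if v \<in> V then u v else 0)"
      by (rule barycentric_eqI) (use u in auto)
    then show "\<forall>v\<in>V. 0 < barycentric T x v" using u by simp
  next
    assume "\<forall>v\<in>V. 0 < barycentric T x v"
    then show "x \<in> interior T" unfolding int using barycentric_props by blast
  qed
qed

lemma interior_nonempty: "interior T \<noteq> {}"
proof -
  let ?c = "\<lambda>v. if v \<in> V then 1 / real (card V) else 0"
  have "V \<noteq> {}" using vertices_props(3) by auto
  have "barycentric T (\<Sum>v\<in>V. ?c v *\<^sub>R v) = ?c"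
    by (rule barycentric_eqI) (use vertices_props(1) \<open>V \<noteq> {}\<close> in auto)
  then have "(\<Sum>v\<in>V. ?c v *\<^sub>R v) \<in> interior T"
    unfolding mem_interior_iff using vertices_props(1,3) by auto
  then show ?thesis by blast
qed

text \<open>Outside the simplex some coordinate is negative, so the positive parts build in the extension by zero.\<close>

lemma bubble_eq: "bubble T x = (\<Prod>v\<in>V. max 0 (barycentric T x v))"
proof (cases "x \<in> T")
  case True
  then show ?thesis using mem_iff by (auto simp: bubble_def intro!: prod.cong)
next
  case False
  then obtain v where "v \<in> V" "barycentric T x v < 0" using mem_iff by force
  then have "(\<Prod>v\<in>V. max 0 (barycentric T x v)) = 0"
    using vertices_props(1) by (intro prod_zero) (auto intro: bexI[of _ v])
  with False show ?thesis by (simp add: bubble_def)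
qed

lemma bubble_eq_0:
  assumes "x \<notin> interior T"
  shows "bubble T x = 0"
proof -
  obtain v where "v \<in> V" "barycentric T x v \<le> 0"
    using assms unfolding mem_interior_iff by (auto simp: not_less)
  then show ?thesis
    unfolding bubble_eq using vertices_props(1) by (intro prod_zero bexI[of _ v]) auto
qed

lemma bubble_pos: "x \<in> interior T \<Longrightarrow> 0 < bubble T x"
  unfolding bubble_eq mem_interior_iff by (intro prod_pos) auto

lemma continuous_bubble: "continuous_on A (bubble T)"
  unfolding bubble_eq[abs_def] barycentric_eq by (intro continuous_intros)

text \<open>The almost everywhere gradient of the product of positive parts in \<open>bubble_eq\<close>, with the
  derivative of the positive part at \<open>0\<close> set to \<open>0\<close>. This choice makes it the pointwise limit of the
  gradients of the approximations, and zero off the interior.\<close>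

definition bubble_grad :: "'a \<Rightarrow> 'a" where
  "bubble_grad x = (\<Sum>v\<in>V. ((if barycentric T x v > 0 then 1 else 0)
      * (\<Prod>w\<in>V - {v}. max 0 (barycentric T x w))) *\<^sub>R slope v)"

lemma bubble_grad_eq_0:
  assumes "x \<notin> interior T"
  shows "bubble_grad x = 0"
proof -
  obtain w where w: "w \<in> V" "barycentric T x w \<le> 0"
    using assms unfolding mem_interior_iff by (auto simp: not_less)
  have "(if barycentric T x v > 0 then 1 else 0) * (\<Prod>w\<in>V - {v}. max 0 (barycentric T x w)) = 0" if "v \<in> V" for v
  proof (cases "v = w")
    case False
    then have "(\<Prod>w\<in>V - {v}. max 0 (barycentric T x w)) = 0"
      using w vertices_props(1) by (intro prod_zero) (auto intro!: bexI[of _ w])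
    then show ?thesis by simp
  qed (use w in simp)
  then show ?thesis unfolding bubble_grad_def by (intro sum.neutral ballI) (simp only: scaleR_zero_left)
qed

end

subsection \<open>Smooth approximation of the positive part\<close>

text \<open>With \<open>k(y) = y exp(-1/y)\<close> for \<open>y > 0\<close> and \<open>m = n + 1\<close> this is \<open>k(m t - 1) / m\<close>. The derivative
  \<open>(1 + 1/y) exp(-1/y)\<close> of \<open>k\<close> lies between \<open>0\<close> and \<open>1\<close> and tends to \<open>1\<close>, and the shift by \<open>1\<close> makes
  the function vanish for \<open>t \<le> 1/m\<close>, which gives compact supports.\<close>

definition spos :: "nat \<Rightarrow> real \<Rightarrow> real" where
  "spos n t = (real (Suc n) * t - 1) * flat 1 (real (Suc n) * t - 1) / real (Suc n)"

definition spos' :: "nat \<Rightarrow> real \<Rightarrow> real" where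
  "spos' n t = flat [:1, 1:] (real (Suc n) * t - 1)"

lemma spos_has_derivative: "(spos n has_real_derivative spos' n t) (at t)"
proof -
  let ?y = "real (Suc n) * t - 1"
  have D: "(flat 1 has_real_derivative flat [:0, 0, 1:] ?y) (at ?y)"
    using flat_has_derivative[of 1 ?y] by simp
  have "((\<lambda>t. flat 1 (real (Suc n) * t - 1)) has_real_derivative flat [:0, 0, 1:] ?y * real (Suc n)) (at t)"
    by (rule DERIV_chain2[where f = "flat 1" and g = "\<lambda>t. real (Suc n) * t - 1", OF D]) (auto intro!: derivative_eq_intros)
  then have "(spos n has_real_derivative
      (?y * (flat [:0, 0, 1:] ?y * real (Suc n)) + real (Suc n) * flat 1 ?y) / real (Suc n)) (at t)"
    unfolding spos_def[abs_def] by (auto intro!: derivative_eq_intros)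
  moreover have "(?y * (flat [:0, 0, 1:] ?y * real (Suc n)) + real (Suc n) * flat 1 ?y) / real (Suc n)
      = ?y * flat [:0, 0, 1:] ?y + flat 1 ?y"
    by (simp add: field_simps)
  moreover have "?y * flat [:0, 0, 1:] ?y + flat 1 ?y = spos' n t"
  proof -
    have "y * flat [:0, 0, 1:] y + flat 1 y = flat [:1, 1:] y" for y :: real
      by (simp add: flat_def field_simps)
    then show ?thesis unfolding spos'_def .
  qed
  ultimately show ?thesis by simp
qed

lemma smooth_spos: "smooth (\<lambda>x. spos n (a \<bullet> x + c))"
proof -
  let ?m = "real (Suc n)"
  have eq: "?m * (a \<bullet> x + c) - 1 = (?m *\<^sub>R a) \<bullet> x + (?m * c - 1)" for x
    by (simp add: algebra_simps)
  have "(\<lambda>x. spos n (a \<bullet> x + c))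
      = (\<lambda>x. ((?m *\<^sub>R a) \<bullet> x + (?m * c - 1)) * flat 1 ((?m *\<^sub>R a) \<bullet> x + (?m * c - 1)) * (1 / ?m))"
    unfolding spos_def eq by simp
  then show ?thesis by (simp only:) (intro smooth_mult smooth_flat smooth_affine smooth_const)
qed

lemma spos_eq_0: "real (Suc n) * t \<le> 1 \<Longrightarrow> spos n t = 0"
  by (simp add: spos_def flat_def)

lemma spos_bounds: "0 \<le> spos n t" "spos n t \<le> max 0 t"
proof -
  let ?m = "real (Suc n)"
  show "0 \<le> spos n t"
  proof (cases "?m * t \<le> 1")
    case False
    then show ?thesis unfolding spos_def by (intro divide_nonneg_nonneg mult_nonneg_nonneg flat_1_bounds) auto
  qed (simp add: spos_eq_0)
  show "spos n t \<le> max 0 t"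
  proof (cases "?m * t \<le> 1")
    case False
    then have "(?m * t - 1) * flat 1 (?m * t - 1) \<le> (?m * t - 1) * 1"
      by (intro mult_left_mono flat_1_bounds) auto
    also have "(?m * t - 1) * 1 \<le> ?m * t" by simp
    finally have "(?m * t - 1) * flat 1 (?m * t - 1) \<le> ?m * t" .
    then have "spos n t \<le> t" unfolding spos_def by (simp add: divide_le_eq mult.commute del: of_nat_Suc)
    then show ?thesis by simp
  qed (simp add: spos_eq_0)
qed

lemma spos'_bounds: "0 \<le> spos' n t" "spos' n t \<le> 1"
proof -
  let ?y = "real (Suc n) * t - 1"
  show "0 \<le> spos' n t" by (auto simp: spos'_def flat_def)
  show "spos' n t \<le> 1"
  proof (cases "?y \<le> 0")
    case False
    have "(1 + 1 / ?y) * exp (- 1 / ?y) \<le> exp (1 / ?y) * exp (- 1 / ?y)"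
      by (intro mult_right_mono exp_ge_add_one_self) auto
    also have "\<dots> = 1" by (simp flip: exp_add)
    finally show ?thesis using False by (simp add: spos'_def flat_def)
  qed (simp add: spos'_def flat_def)
qed

lemma flat_tendsto_at_top:
  "(flat 1 \<longlongrightarrow> 1) at_top" "(flat [:1, 1:] \<longlongrightarrow> 1) at_top"
proof -
  have i: "((\<lambda>y::real. inverse y) \<longlongrightarrow> 0) at_top"
    by (rule tendsto_inverse_0_at_top[OF filterlim_ident])
  have "((\<lambda>y::real. exp (- inverse y)) \<longlongrightarrow> exp (- 0)) at_top"
    by (intro tendsto_intros i)
  moreover have "eventually (\<lambda>y. exp (- inverse y) = flat 1 y) at_top"
    using eventually_gt_at_top[of "0::real"] by eventually_elim (simp add: flat_def inverse_eq_divide)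
  ultimately show "(flat 1 \<longlongrightarrow> 1) at_top"
    by (simp add: Lim_transform_eventually)
  have "((\<lambda>y::real. (1 + inverse y) * exp (- inverse y)) \<longlongrightarrow> (1 + 0) * exp (- 0)) at_top"
    by (intro tendsto_intros i)
  moreover have "eventually (\<lambda>y. (1 + inverse y) * exp (- inverse y) = flat [:1, 1:] y) at_top"
    using eventually_gt_at_top[of "0::real"] by eventually_elim (simp add: flat_def inverse_eq_divide)
  ultimately show "(flat [:1, 1:] \<longlongrightarrow> 1) at_top"
    by (simp add: Lim_transform_eventually)
qed

lemma spos_tendsto:
  "(\<lambda>n. spos n t) \<longlonglongrightarrow> max 0 t" "(\<lambda>n. spos' n t) \<longlonglongrightarrow> (if t > 0 then 1 else 0)"
proof -
  have "(\<lambda>n. spos n t) \<longlonglongrightarrow> max 0 t \<and> (\<lambda>n. spos' n t) \<longlonglongrightarrow> (if t > 0 then 1 else 0)"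
  proof (cases "t > 0")
    case True
    have "filterlim (\<lambda>n. real (Suc n)) at_top sequentially"
      by (rule filterlim_compose[OF filterlim_real_sequentially filterlim_Suc])
    then have "filterlim (\<lambda>n. t * real (Suc n)) at_top sequentially"
      by (rule filterlim_tendsto_pos_mult_at_top[OF tendsto_const True])
    then have "filterlim (\<lambda>n. -1 + t * real (Suc n)) at_top sequentially"
      by (rule filterlim_tendsto_add_at_top[OF tendsto_const])
    then have f: "filterlim (\<lambda>n. real (Suc n) * t - 1) at_top sequentially"
      by (simp add: mult.commute)
    have "(\<lambda>n. (t - inverse (real (Suc n))) * flat 1 (real (Suc n) * t - 1)) \<longlonglongrightarrow> (t - 0) * 1"
      by (intro tendsto_intros LIMSEQ_inverse_real_of_nat filterlim_compose[OF flat_tendsto_at_top(1) f])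
    moreover have "(\<lambda>n. (t - inverse (real (Suc n))) * flat 1 (real (Suc n) * t - 1)) = (\<lambda>n. spos n t)"
      by (auto simp: spos_def fun_eq_iff field_simps)
    moreover have "(\<lambda>n. spos' n t) \<longlonglongrightarrow> 1"
      unfolding spos'_def by (rule filterlim_compose[OF flat_tendsto_at_top(2) f])
    ultimately show ?thesis using True by simp
  next
    case False
    then have "real (Suc n) * t \<le> 0" for n by (simp add: mult_le_0_iff)
    then have "real (Suc n) * t \<le> 1" for n by (rule order_trans) simp
    then have "spos n t = 0" "spos' n t = 0" for n
      by (simp_all add: spos_eq_0 spos'_def flat_def)
    with False show ?thesis by simp
  qed
  then show "(\<lambda>n. spos n t) \<longlonglongrightarrow> max 0 t" "(\<lambda>n. spos' n t) \<longlonglongrightarrow> (if t > 0 then 1 else 0)" by auto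
qed

context full_simplex
begin

text \<open>Replacing the positive part of every barycentric coordinate by \<open>spos\<close> gives test functions,
  since the points of the simplex at which all coordinates are at least \<open>1/(n+1)\<close> form a compact subset
  of its interior. The bounds \<open>M\<close> and \<open>B\<close> hold on the bounded domain and do not depend on \<open>n\<close>.\<close>

lemma bubble_H10:
  assumes \<Omega>: "open \<Omega>" "bounded \<Omega>" "interior T \<subseteq> \<Omega>"
  shows "bubble T \<in> H10 \<Omega>" "has_weak_grad \<Omega> (bubble T) bubble_grad" "bubble_grad \<in> L2 \<Omega>"
    "(LINT x|lebesgue_on \<Omega>. bubble_grad x \<bullet> a) = 0"
proof -
  let ?b = "\<lambda>v x. barycentric T x v"
  define \<phi> where "\<phi> n x = (\<Prod>v\<in>V. spos n (?b v x))" for n x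
  have sm: "smooth (\<phi> n)" for n
    unfolding \<phi>_def[abs_def] barycentric_eq by (intro smooth_prod smooth_spos)
  have gr: "grad (\<phi> n) x = (\<Sum>v\<in>V. (spos' n (?b v x) * (\<Prod>w\<in>V - {v}. spos n (?b w x))) *\<^sub>R slope v)" for n x
  proof (rule grad_eqI)
    have "((\<lambda>x. spos n (?b v x)) has_derivative (\<lambda>h. spos' n (?b v x) * (slope v \<bullet> h))) (at x)" for v
    proof -
      have "(spos n has_derivative (\<lambda>h. spos' n (?b v x) * h)) (at (slope v \<bullet> x + offset v))"
        using spos_has_derivative[of n "?b v x"] by (simp add: has_field_derivative_def barycentric_eq)
      then have "((\<lambda>x. spos n (slope v \<bullet> x + offset v)) has_derivative (\<lambda>h. spos' n (?b v x) * (slope v \<bullet> h))) (at x)"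
        by (rule has_derivative_compose[where f = "\<lambda>x. slope v \<bullet> x + offset v" and f' = "\<lambda>h. slope v \<bullet> h", rotated])
          (auto intro!: derivative_eq_intros)
      then show ?thesis by (simp add: barycentric_eq)
    qed
    then have "(\<phi> n has_derivative (\<lambda>h. \<Sum>v\<in>V. spos' n (?b v x) * (slope v \<bullet> h) * (\<Prod>w\<in>V - {v}. spos n (?b w x)))) (at x)"
      unfolding \<phi>_def[abs_def] by (rule has_derivative_prod)
    moreover have "(\<lambda>h. \<Sum>v\<in>V. spos' n (?b v x) * (slope v \<bullet> h) * (\<Prod>w\<in>V - {v}. spos n (?b w x)))
        = (\<lambda>h. (\<Sum>v\<in>V. (spos' n (?b v x) * (\<Prod>w\<in>V - {v}. spos n (?b w x))) *\<^sub>R slope v) \<bullet> h)"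
      by (auto simp: fun_eq_iff inner_sum_left intro!: sum.cong)
    ultimately show "(\<phi> n has_derivative (\<lambda>h. (\<Sum>v\<in>V. (spos' n (?b v x) * (\<Prod>w\<in>V - {v}. spos n (?b w x))) *\<^sub>R slope v) \<bullet> h)) (at x)"
      by simp
  qed
  have test: "\<phi> n \<in> test_functions \<Omega>" for n
  proof -
    let ?K = "{x. \<forall>v\<in>V. 1 / real (Suc n) \<le> ?b v x}"
    have "?K = (\<Inter>v\<in>V. {x. 1 / real (Suc n) \<le> ?b v x})" by auto
    moreover have "closed {x. 1 / real (Suc n) \<le> ?b v x}" for v
      unfolding barycentric_eq by (intro closed_Collect_le continuous_intros)
    ultimately have "closed ?K" by (simp only:) (intro closed_INT ballI)
    have int: "?K \<subseteq> interior T"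
    proof
      fix x assume "x \<in> ?K"
      moreover have "0 < 1 / real (Suc n)" by simp
      ultimately have "\<forall>v\<in>V. 0 < ?b v x" using less_le_trans by blast
      then show "x \<in> interior T" by (simp add: mem_interior_iff)
    qed
    have "bounded ?K"
      by (rule bounded_subset[OF compact_imp_bounded[OF compact]]) (use int interior_subset in blast)
    with \<open>closed ?K\<close> have "compact ?K" by (simp add: compact_eq_bounded_closed)
    then show ?thesis
    proof (rule test_functionsI[OF sm])
      show "?K \<subseteq> \<Omega>" using int \<Omega> by blast
      show "\<phi> n x = 0" if x: "x \<notin> ?K" for x
      proof -
        obtain v where v: "v \<in> V" "?b v x < 1 / real (Suc n)" using x by (auto simp: not_le)
        then have "real (Suc n) * ?b v x \<le> 1" by (simp add: field_simps)
        then have "spos n (?b v x) = 0" by (rule spos_eq_0)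
        then show ?thesis unfolding \<phi>_def using v(1) vertices_props(1) by (intro prod_zero) auto
      qed
    qed
  qed
  have lim1: "(\<lambda>n. \<phi> n x) \<longlonglongrightarrow> bubble T x" for x
    unfolding \<phi>_def bubble_eq by (intro tendsto_prod spos_tendsto)
  have lim2: "(\<lambda>n. grad (\<phi> n) x) \<longlonglongrightarrow> bubble_grad x" for x
    unfolding gr bubble_grad_def
    by (intro tendsto_sum tendsto_scaleR tendsto_mult tendsto_prod spos_tendsto tendsto_const)
  obtain R where R: "R > 0" "\<And>x. x \<in> \<Omega> \<Longrightarrow> norm x \<le> R"
    using \<Omega>(2) bounded_pos by blast
  define M where "M = 1 + (\<Sum>v\<in>V. norm (slope v) * R + \<bar>offset v\<bar>)"
  have nn: "0 \<le> norm (slope v) * R + \<bar>offset v\<bar>" for v using R(1) by simp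
  have M1: "1 \<le> M" unfolding M_def using nn by (simp add: sum_nonneg)
  have bM: "spos n (?b v x) \<le> M" if "x \<in> \<Omega>" "v \<in> V" for n v x
  proof -
    have "?b v x \<le> norm (slope v) * norm x + \<bar>offset v\<bar>"
      unfolding barycentric_eq using norm_cauchy_schwarz[of "slope v" x] by linarith
    also have "\<dots> \<le> norm (slope v) * R + \<bar>offset v\<bar>"
      using R(2)[OF that(1)] by (simp add: mult_left_mono)
    also have "\<dots> \<le> M"
      unfolding M_def using member_le_sum[OF that(2) _ vertices_props(1), of "\<lambda>v. norm (slope v) * R + \<bar>offset v\<bar>"] nn by simp
    finally show ?thesis using spos_bounds(2)[of n "?b v x"] M1 by simp
  qed
  have pM: "(\<Prod>w\<in>I. spos n (?b w x)) \<le> M ^ card V" if "x \<in> \<Omega>" "I \<subseteq> V" for I n x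
  proof -
    have "(\<Prod>w\<in>I. spos n (?b w x)) \<le> (\<Prod>w\<in>I. M)"
      by (intro prod_mono) (use that bM spos_bounds in auto)
    also have "\<dots> \<le> M ^ card V"
      using M1 card_mono[OF vertices_props(1) that(2)] by (simp add: power_increasing)
    finally show ?thesis .
  qed
  define B where "B = M ^ card V * (1 + (\<Sum>v\<in>V. norm (slope v)))"
  have MB: "M ^ card V \<le> B"
    unfolding B_def using M1 by (simp add: mult_le_cancel_left1 sum_nonneg)
  have bd1: "\<bar>\<phi> n x\<bar> \<le> B" if "x \<in> \<Omega>" for n x
  proof -
    have "0 \<le> \<phi> n x" unfolding \<phi>_def by (intro prod_nonneg) (simp add: spos_bounds)
    moreover have "\<phi> n x \<le> B" using pM[OF that order_refl, of n] MB by (simp add: \<phi>_def)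
    ultimately show ?thesis by simp
  qed
  have bd2: "norm (grad (\<phi> n) x) \<le> B" if "x \<in> \<Omega>" for n x
  proof -
    have "norm (grad (\<phi> n) x) \<le> (\<Sum>v\<in>V. M ^ card V * norm (slope v))"
      unfolding gr
    proof (rule order_trans[OF norm_sum], rule sum_mono)
      fix v assume "v \<in> V"
      have p0: "0 \<le> (\<Prod>w\<in>V - {v}. spos n (?b w x))" by (intro prod_nonneg) (simp add: spos_bounds)
      have "spos' n (?b v x) * (\<Prod>w\<in>V - {v}. spos n (?b w x)) \<le> 1 * M ^ card V"
        by (intro mult_mono spos'_bounds pM that p0) auto
      then have "norm (spos' n (?b v x) * (\<Prod>w\<in>V - {v}. spos n (?b w x))) \<le> M ^ card V"
        using p0 spos'_bounds(1) by (simp add: abs_mult)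
      then show "norm ((spos' n (?b v x) * (\<Prod>w\<in>V - {v}. spos n (?b w x))) *\<^sub>R slope v) \<le> M ^ card V * norm (slope v)"
        unfolding norm_scaleR real_norm_def by (rule mult_right_mono) simp
    qed
    also have "\<dots> = M ^ card V * (\<Sum>v\<in>V. norm (slope v))" by (simp add: sum_distrib_left)
    also have "\<dots> \<le> B" unfolding B_def using M1 by (intro mult_left_mono) auto
    finally show ?thesis .
  qed
  note L = H10_bounded_limit[OF \<Omega>(1,2) test lim1 lim2 bd1 bd2]
  show "bubble T \<in> H10 \<Omega>" "has_weak_grad \<Omega> (bubble T) bubble_grad" "bubble_grad \<in> L2 \<Omega>"
    "(LINT x|lebesgue_on \<Omega>. bubble_grad x \<bullet> a) = 0"
    using L by auto
qed

end

section \<open>Meshes of a Lipschitz domain\<close>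

text \<open>A Lipschitz domain lies locally on one side of its boundary, so its closure has no further
  interior points. This is what puts the interior of a cell into the domain.\<close>

lemma interior_closure_subset_lipschitz:
  fixes \<Omega> :: "'a::euclidean_space set"
  assumes \<Omega>: "open \<Omega>" and lip: "lipschitz_boundary \<Omega>"
  shows "interior (closure \<Omega>) \<subseteq> \<Omega>"
proof
  fix x assume x: "x \<in> interior (closure \<Omega>)"
  show "x \<in> \<Omega>"
  proof (rule ccontr)
    assume nx: "x \<notin> \<Omega>"
    then have fx: "x \<in> frontier \<Omega>"
      using x interior_subset \<Omega> by (auto simp: frontier_def interior_open)
    obtain U e g L where U: "open U" "x \<in> U" and e: "norm e = 1"
      and g: "L-lipschitz_on {z. z \<bullet> e = 0} (g :: 'a \<Rightarrow> real)"
      and eq: "\<Omega> \<inter> U = {y \<in> U. g (y - (y \<bullet> e) *\<^sub>R e) < y \<bullet> e}"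
      using lip[unfolded lipschitz_boundary_def, rule_format, OF fx] by (elim exE conjE) (rule that)
    have ee: "e \<bullet> e = 1" using e by (simp add: norm_eq_1)
    let ?p = "\<lambda>y. y - (y \<bullet> e) *\<^sub>R e"
    have gp: "continuous_on UNIV (\<lambda>y. g (?p y))"
      by (rule continuous_on_compose2[OF lipschitz_on_continuous_on[OF g]])
        (auto intro!: continuous_intros simp: inner_diff_left ee)
    let ?N = "interior (closure \<Omega>) \<inter> U \<inter> {y. y \<bullet> e < g (?p y)}"
    have "open ?N"
      using U(1) by (intro open_Int open_interior open_Collect_less gp continuous_intros) auto
    moreover have "?N \<inter> \<Omega> = {}" using eq by force
    ultimately have N: "?N \<inter> closure \<Omega> = {}"
      using open_Int_closure_eq_empty by blast
    have "open (interior (closure \<Omega>) \<inter> U)" using U(1) by (intro open_Int open_interior)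
    then obtain r where r: "r > 0" "ball x r \<subseteq> interior (closure \<Omega>) \<inter> U"
      using x U(2) open_contains_ball by blast
    let ?y = "x - (r / 2) *\<^sub>R e"
    have "?y \<in> ball x r" using r(1) e by (simp add: dist_norm)
    then have y: "?y \<in> interior (closure \<Omega>) \<inter> U" using r(2) by blast
    have "x \<bullet> e \<le> g (?p x)" using eq nx U(2) by force
    moreover have p: "?p ?y = ?p x" by (simp add: inner_diff_left ee algebra_simps)
    moreover have "?y \<bullet> e < x \<bullet> e" using r(1) by (simp add: inner_diff_left ee)
    ultimately have "?y \<bullet> e < g (?p ?y)" unfolding p by linarith
    then have "?y \<in> ?N" using y by blast
    then show False using N interior_subset by blast
  qed
qed

locale mesh =
  fixes \<Omega> :: "'a::euclidean_space set" and \<T> :: "'a set set"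
  assumes domain: "polytopal_lipschitz_domain \<Omega>" and triangulation: "triangulation_of \<Omega> \<T>"
begin

lemma domain_facts: "open \<Omega>" "bounded \<Omega>" "\<Omega> \<noteq> {}" "\<Omega> \<in> sets lebesgue"
  using domain by (auto simp: polytopal_lipschitz_domain_def)

lemma finite_cells: "finite \<T>"
  using triangulation by (simp add: triangulation_of_def triangulation_def)

lemma cells_nonempty: "\<T> \<noteq> {}"
proof
  assume "\<T> = {}"
  then have "closure \<Omega> = {}" using triangulation by (simp add: triangulation_of_def)
  then show False using domain_facts(3) closure_subset by blast
qed

lemma cell: "T \<in> \<T> \<Longrightarrow> full_simplex T"
  using triangulation by (simp add: triangulation_of_def full_simplex_def)

lemma interior_cell: "T \<in> \<T> \<Longrightarrow> interior T \<subseteq> \<Omega>"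
  using triangulation interior_closure_subset_lipschitz[OF domain_facts(1)] domain
    interior_mono[of T "closure \<Omega>"]
  unfolding triangulation_of_def polytopal_lipschitz_domain_def by blast

lemma cell_lebesgue: "T \<in> \<T> \<Longrightarrow> T \<in> sets lebesgue"
  using full_simplex.lebesgue cell by blast

lemma negligible_cell_diff: "T \<in> \<T> \<Longrightarrow> negligible (T - \<Omega>)"
  by (rule negligible_subset[OF full_simplex.negligible_diff_interior[OF cell]])
    (use interior_cell in auto)

text \<open>Two cells meet in a common face, and for different cells of the same dimension this is a proper
  face, which does not reach the interior.\<close>

lemma interior_cell_disjoint:
  assumes "T \<in> \<T>" "T' \<in> \<T>" "T \<noteq> T'"
  shows "interior T \<inter> T' = {}"
proof -
  have f: "T \<inter> T' face_of T" "T' \<inter> T face_of T'"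
    using assms triangulation by (auto simp: triangulation_of_def triangulation_def)
  have dim: "aff_dim T = int DIM('a)" "aff_dim T' = int DIM('a)"
    using assms aff_dim_simplex full_simplex.simplex[OF cell] by blast+
  have "T \<inter> T' \<noteq> T"
  proof
    assume "T \<inter> T' = T"
    then have "T face_of T'" using f(2) by (simp add: Int_commute)
    then have "aff_dim T < aff_dim T'"
      using face_of_aff_dim_lt[OF full_simplex.convex[OF cell[OF assms(2)]]] assms(3) by blast
    then show False using dim by simp
  qed
  then have "T \<inter> T' \<inter> interior T = {}" by (rule face_of_disjoint_interior[OF f(1)])
  then show ?thesis using interior_subset by blast
qed

lemma negligible_cell_Int:
  assumes "T \<in> \<T>" "T' \<in> \<T>" "T \<noteq> T'"
  shows "negligible (T \<inter> T')"
  by (rule negligible_subset[OF full_simplex.negligible_diff_interior[OF cell[OF assms(1)]]])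
    (use interior_cell_disjoint[OF assms] in auto)

lemma L2_cell: "T \<in> \<T> \<Longrightarrow> f \<in> L2 \<Omega> \<Longrightarrow> f \<in> L2 T"
  by (rule L2_subset[OF cell_lebesgue domain_facts(4) negligible_cell_diff])

lemma AE_cell: "T \<in> \<T> \<Longrightarrow> AE x in lebesgue_on \<Omega>. P x \<Longrightarrow> AE x in lebesgue_on T. P x"
  by (rule AE_lebesgue_on_subset[OF cell_lebesgue domain_facts(4) negligible_cell_diff])

lemma l2norm_cell_le: "T \<in> \<T> \<Longrightarrow> f \<in> L2 \<Omega> \<Longrightarrow> l2norm T f \<le> l2norm \<Omega> f"
  by (rule l2norm_subset_le[OF cell_lebesgue domain_facts(4) negligible_cell_diff])

lemma sum_l2norm_cells_le:
  assumes "f \<in> L2 \<Omega>"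
  shows "(\<Sum>T\<in>\<T>. (l2norm T f)\<^sup>2) \<le> (l2norm \<Omega> f)\<^sup>2"
  unfolding l2norm_power2 l2inner_def
  by (rule sum_integral_le_of_almost_disjoint[OF finite_cells cell_lebesgue domain_facts(4) negligible_cell_diff
        negligible_cell_Int]) (use assms in \<open>auto simp: L2_def\<close>)

lemma AE_interior_cell:
  assumes "T \<in> \<T>"
  shows "AE x in lebesgue_on T. x \<in> interior T"
proof -
  have "AE x in lebesgue. x \<notin> T - interior T"
    by (rule AE_notin_negligible[OF full_simplex.negligible_diff_interior[OF cell[OF assms]]])
  then have "AE x in lebesgue. x \<in> T \<longrightarrow> x \<in> interior T" by eventually_elim auto
  then show ?thesis using cell_lebesgue[OF assms] by (simp add: AE_restrict_space_iff)
qed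

section \<open>The discrete spaces and the projection\<close>

lemma Vh_H10: "w \<in> Vh \<Omega> \<T> \<Longrightarrow> w \<in> H10 \<Omega>"
  by (simp add: Vh_def)

lemma Vh_diff:
  assumes "v \<in> Vh \<Omega> \<T>" "w \<in> Vh \<Omega> \<T>"
  shows "(\<lambda>x. v x - w x) \<in> Vh \<Omega> \<T>"
proof -
  have "\<exists>a c. AE x in lebesgue_on T. v x - w x = a \<bullet> x + c" if T: "T \<in> \<T>" for T
  proof -
    obtain a c a' c' where "AE x in lebesgue_on T. v x = a \<bullet> x + c" "AE x in lebesgue_on T. w x = a' \<bullet> x + c'"
      using assms T by (auto simp: Vh_def) blast
    then have "AE x in lebesgue_on T. v x - w x = (a - a') \<bullet> x + (c - c')"
      by eventually_elim (simp add: inner_diff_left)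
    then show ?thesis by blast
  qed
  then show ?thesis using H10_diff[OF domain_facts(1)] assms by (simp add: Vh_def)
qed

text \<open>Uniqueness of the weak gradient on the interior of the cell, where the function agrees almost
  everywhere with an affine one.\<close>

lemma wgrad_Vh:
  assumes w: "w \<in> Vh \<Omega> \<T>" and T: "T \<in> \<T>"
  obtains a where "AE x in lebesgue_on T. wgrad \<Omega> w x = a"
proof -
  obtain a c where ac: "AE x in lebesgue_on T. w x = a \<bullet> x + c"
    using w T by (auto simp: Vh_def)
  let ?I = "interior T"
  have I: "?I \<in> sets lebesgue" "T \<in> sets lebesgue" "open ?I" "?I \<subseteq> T"
    using cell_lebesgue[OF T] by (auto simp: interior_subset)
  have e: "negligible (?I - T)" using I(4) by (simp add: Diff_eq_empty_iff[THEN iffD2])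
  have aff: "grad (\<lambda>x. a \<bullet> x + c) = (\<lambda>x. a)" by (simp add: grad_affine fun_eq_iff)
  have "AE x in lebesgue_on ?I. wgrad \<Omega> w x = a"
  proof (rule has_weak_grad_unique[OF I(3)])
    show "has_weak_grad ?I w (wgrad \<Omega> w)"
      by (rule has_weak_grad_subset[OF domain_facts(1) I(3) interior_cell[OF T] H1D(2)[OF domain_facts(1) H10_imp_H1[OF Vh_H10[OF w]]]])
    show "has_weak_grad ?I (\<lambda>x. a \<bullet> x + c) (\<lambda>x. a)"
      using has_weak_grad_smooth[OF I(3) smooth_affine[of a c]] unfolding aff .
    show "AE x in lebesgue_on ?I. w x = a \<bullet> x + c"
      by (rule AE_lebesgue_on_subset[OF I(1,2) e ac])
  qed
  then have "AE x in lebesgue_on T. wgrad \<Omega> w x = a"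
    by (rule AE_lebesgue_on_subset[OF I(2,1) full_simplex.negligible_diff_interior[OF cell[OF T]]])
  then show ?thesis by (rule that)
qed

definition bubbles :: "('a set \<Rightarrow> real) \<Rightarrow> 'a \<Rightarrow> real" where
  "bubbles k x = (\<Sum>T\<in>\<T>. k T * bubble T x)"

definition bubbles_grad :: "('a set \<Rightarrow> real) \<Rightarrow> 'a \<Rightarrow> 'a" where
  "bubbles_grad k x = (\<Sum>T\<in>\<T>. k T *\<^sub>R full_simplex.bubble_grad T x)"

lemma Vb_eq: "Vb \<T> = range bubbles"
  by (simp add: Vb_def bubbles_def[abs_def])

lemma bubbles_H10: "bubbles k \<in> H10 \<Omega> \<and> has_weak_grad \<Omega> (bubbles k) (bubbles_grad k)"
proof -
  have "(\<lambda>x. \<Sum>T\<in>F. k T * bubble T x) \<in> H10 \<Omega> \<and>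
      has_weak_grad \<Omega> (\<lambda>x. \<Sum>T\<in>F. k T * bubble T x) (\<lambda>x. \<Sum>T\<in>F. k T *\<^sub>R full_simplex.bubble_grad T x)"
    if "finite F" "F \<subseteq> \<T>" for F
    using that
  proof (induction F rule: finite_induct)
    case empty
    have "grad (\<lambda>x::'a. 0 :: real) = (\<lambda>x. 0)"
      using grad_affine[of "0::'a" 0] by (auto simp: fun_eq_iff)
    then show ?case
      using H10_zero[OF domain_facts(1)] has_weak_grad_smooth[OF domain_facts(1) smooth_const[of 0]] by simp
  next
    case (insert T F)
    have T: "T \<in> \<T>" using insert by simp
    note B = full_simplex.bubble_H10[OF cell[OF T] domain_facts(1,2) interior_cell[OF T]]
    have IH: "(\<lambda>x. \<Sum>T\<in>F. k T * bubble T x) \<in> H10 \<Omega>"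
      "has_weak_grad \<Omega> (\<lambda>x. \<Sum>T\<in>F. k T * bubble T x) (\<lambda>x. \<Sum>T\<in>F. k T *\<^sub>R full_simplex.bubble_grad T x)"
      using insert by auto
    show ?case
      using H10_lincomb[OF domain_facts(1) B(1) IH(1), of "k T" 1] has_weak_grad_lincomb[OF domain_facts(1) B(2) IH(2), of "k T" 1]
      by (simp add: sum.insert[OF insert(1,2)])
  qed
  from this[OF finite_cells order_refl] show ?thesis
    by (simp add: bubbles_def[abs_def] bubbles_grad_def[abs_def])
qed

lemma bubbles_cell:
  assumes T: "T \<in> \<T>" and x: "x \<in> interior T"
  shows "bubbles k x = k T * bubble T x" "bubbles_grad k x = k T *\<^sub>R full_simplex.bubble_grad T x"
proof -
  have out: "x \<notin> interior T'" if "T' \<in> \<T> - {T}" for T'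
    using interior_cell_disjoint[OF T, of T'] that x interior_subset by blast
  then have "bubble T' x = 0" "full_simplex.bubble_grad T' x = 0" if "T' \<in> \<T> - {T}" for T'
    using full_simplex.bubble_eq_0[OF cell] full_simplex.bubble_grad_eq_0[OF cell] that by auto
  then show "bubbles k x = k T * bubble T x" "bubbles_grad k x = k T *\<^sub>R full_simplex.bubble_grad T x"
    unfolding bubbles_def bubbles_grad_def by (simp_all add: sum.remove[OF finite_cells T])
qed

lemma bubbles_diff: "bubbles k x - bubbles l x = bubbles (\<lambda>T. k T - l T) x"
  by (simp add: bubbles_def sum_subtractf algebra_simps)

text \<open>A bubble that is affine on its cell vanishes at all vertices, hence on the whole cell.\<close>

lemma bubbles_in_Vh_eq_0:
  assumes "bubbles k \<in> Vh \<Omega> \<T>" and T: "T \<in> \<T>"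
  shows "k T = 0"
proof -
  interpret full_simplex T by (rule cell[OF T])
  obtain a c where ac: "AE x in lebesgue_on T. bubbles k x = a \<bullet> x + c"
    using assms by (auto simp: Vh_def)
  let ?h = "\<lambda>x. k T * bubble T x - (a \<bullet> x + c)"
  have cont: "continuous_on UNIV ?h" by (intro continuous_intros continuous_bubble)
  have h0: "AE x in lebesgue. x \<in> interior T \<longrightarrow> ?h x = 0"
  proof -
    have "AE x in lebesgue. x \<in> T \<longrightarrow> bubbles k x = a \<bullet> x + c"
      using ac lebesgue by (simp add: AE_restrict_space_iff)
    then show ?thesis
      by eventually_elim (use bubbles_cell[OF T] interior_subset in force)
  qed
  let ?W = "interior T \<inter> {x. ?h x \<noteq> 0}"
  have "open ?W" by (intro open_Int open_interior open_Collect_neq cont continuous_intros)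
  moreover have "negligible ?W"
  proof -
    have "{x \<in> space lebesgue. \<not> (x \<in> interior T \<longrightarrow> ?h x = 0)} \<in> null_sets lebesgue"
      using h0 unfolding completion.AE_iff_null_sets .
    then show ?thesis by (simp add: negligible_iff_null_sets Int_def)
  qed
  ultimately have "?W = {}" using open_not_negligible by blast
  then have "interior T \<subseteq> {x. ?h x = 0}" by auto
  moreover have "closed {x. ?h x = 0}" by (intro closed_Collect_eq cont continuous_intros)
  ultimately have "closure (interior T) \<subseteq> {x. ?h x = 0}" by (rule closure_minimal)
  moreover have "closure (interior T) = T"
    using convex_closure_interior[OF convex interior_nonempty] closure_closed[OF compact_imp_closed[OF compact]]
    by simp
  ultimately have h: "k T * bubble T x = a \<bullet> x + c" if "x \<in> T" for x using that by auto
  have vert: "a \<bullet> v + c = 0" if v: "v \<in> V" for v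
  proof -
    have b: "barycentric T v = (\<lambda>w. if w = v then 1 else 0)"
      using vertices_props(1) v
      by (intro barycentric_eqI) (auto simp: if_distrib[of "\<lambda>r. r *\<^sub>R _"] cong: if_cong)
    have vT: "v \<in> T" unfolding mem_iff b by simp
    have "card V \<noteq> 1" using vertices_props(3) by simp
    then have "V \<noteq> {v}" by auto
    then obtain w where "w \<in> V" "w \<noteq> v" using v by blast
    then have "v \<notin> interior T" unfolding mem_interior_iff b by auto
    then show ?thesis using h[OF vT] bubble_eq_0 by simp
  qed
  obtain x where x: "x \<in> interior T" using interior_nonempty by blast
  have "a \<bullet> x + c = a \<bullet> (\<Sum>v\<in>V. barycentric T x v *\<^sub>R v) + c * (\<Sum>v\<in>V. barycentric T x v)"
    by (simp add: barycentric_props)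
  also have "\<dots> = (\<Sum>v\<in>V. barycentric T x v * (a \<bullet> v + c))"
    by (simp add: inner_sum_right sum_distrib_left sum.distrib algebra_simps)
  also have "\<dots> = 0" using vert by simp
  finally have "k T * bubble T x = 0" using h x interior_subset by fastforce
  then show ?thesis using bubble_pos[OF x] by simp
qed

lemma decomposition_unique:
  assumes v: "v \<in> Vh \<Omega> \<T>" and v': "v' \<in> Vh \<Omega> \<T>" and b: "b \<in> Vb \<T>" and b': "b' \<in> Vb \<T>"
    and eq: "\<And>x. v x + b x = v' x + b' x"
  shows "v = v'"
proof -
  obtain k l where k: "b = bubbles k" "b' = bubbles l" using b b' by (auto simp: Vb_eq)
  have "(\<lambda>x. v x - v' x) = bubbles (\<lambda>T. l T - k T)"
  proof
    fix x show "v x - v' x = bubbles (\<lambda>T. l T - k T) x"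
      using eq[of x] bubbles_diff[of l x k] by (simp add: k)
  qed
  then have B: "bubbles (\<lambda>T. l T - k T) \<in> Vh \<Omega> \<T>" using Vh_diff[OF v v'] by simp
  have "bubbles (\<lambda>T. l T - k T) x = 0" for x
    unfolding bubbles_def using bubbles_in_Vh_eq_0[OF B] by (intro sum.neutral) auto
  with \<open>(\<lambda>x. v x - v' x) = _\<close> show ?thesis by (metis eq_iff_diff_eq_0 ext)
qed

text \<open>Every admissible splitting computes the projection; linearity of \<open>\<kappa>\<close> on differences follows by
  subtracting splittings.\<close>

lemma kappa_eqI:
  assumes v: "v \<in> Vh \<Omega> \<T>" and b: "b \<in> Vb \<T>" and w: "w = (\<lambda>x. v x + b x)"
  shows "kappa \<Omega> \<T> w = v"
  unfolding kappa_def
proof (rule the_equality)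
  show "v \<in> Vh \<Omega> \<T> \<and> (\<exists>vb\<in>Vb \<T>. w = (\<lambda>x. v x + vb x))" using assms by blast
  fix v' assume "v' \<in> Vh \<Omega> \<T> \<and> (\<exists>vb\<in>Vb \<T>. w = (\<lambda>x. v' x + vb x))"
  then obtain b' where "v' \<in> Vh \<Omega> \<T>" "b' \<in> Vb \<T>" "w = (\<lambda>x. v' x + b' x)" by blast
  then show "v' = v" using decomposition_unique[OF _ v _ b] w by (metis (no_types))
qed

lemma kappa_decomposition:
  assumes "w \<in> Vhb \<Omega> \<T>"
  obtains k where "kappa \<Omega> \<T> w \<in> Vh \<Omega> \<T>" "w = (\<lambda>x. kappa \<Omega> \<T> w x + bubbles k x)"
proof -
  obtain v b where vb: "v \<in> Vh \<Omega> \<T>" "b \<in> Vb \<T>" "w = (\<lambda>x. v x + b x)"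
    using assms by (auto simp: Vhb_def)
  moreover have "kappa \<Omega> \<T> w = v" by (rule kappa_eqI[OF vb])
  moreover obtain k where "b = bubbles k" using vb(2) by (auto simp: Vb_eq)
  ultimately show ?thesis using that by simp
qed

lemma diff_decomposition:
  assumes u: "u \<in> Vhb \<Omega> \<T>" and v: "v \<in> Vhb \<Omega> \<T>"
  shows "(\<lambda>x. u x - v x) \<in> Vhb \<Omega> \<T>"
    "kappa \<Omega> \<T> (\<lambda>x. u x - v x) = (\<lambda>x. kappa \<Omega> \<T> u x - kappa \<Omega> \<T> v x)"
proof -
  obtain k where k: "kappa \<Omega> \<T> u \<in> Vh \<Omega> \<T>" "u = (\<lambda>x. kappa \<Omega> \<T> u x + bubbles k x)"
    using kappa_decomposition[OF u] by metis
  obtain l where l: "kappa \<Omega> \<T> v \<in> Vh \<Omega> \<T>" "v = (\<lambda>x. kappa \<Omega> \<T> v x + bubbles l x)"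
    using kappa_decomposition[OF v] by metis
  let ?d = "\<lambda>x. kappa \<Omega> \<T> u x - kappa \<Omega> \<T> v x" and ?b = "bubbles (\<lambda>T. k T - l T)"
  have d: "?d \<in> Vh \<Omega> \<T>" by (rule Vh_diff[OF k(1) l(1)])
  have b: "?b \<in> Vb \<T>" by (simp add: Vb_eq)
  have eq: "(\<lambda>x. u x - v x) = (\<lambda>x. ?d x + ?b x)"
  proof
    fix x show "u x - v x = ?d x + ?b x"
      using fun_cong[OF k(2), of x] fun_cong[OF l(2), of x] bubbles_diff[of k x l] by linarith
  qed
  show "(\<lambda>x. u x - v x) \<in> Vhb \<Omega> \<T>" 
    unfolding Vhb_def mem_Collect_eq by (intro exI conjI) (rule eq, rule d, rule b)
  show "kappa \<Omega> \<T> (\<lambda>x. u x - v x) = ?d" by (rule kappa_eqI[OF d b eq])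
qed

lemma Vhb_H10:
  assumes "w \<in> Vhb \<Omega> \<T>"
  shows "w \<in> H10 \<Omega>"
proof -
  obtain k where k: "kappa \<Omega> \<T> w \<in> Vh \<Omega> \<T>" "w = (\<lambda>x. kappa \<Omega> \<T> w x + bubbles k x)"
    using kappa_decomposition[OF assms] by metis
  have "(\<lambda>x. 1 * kappa \<Omega> \<T> w x + 1 * bubbles k x) \<in> H10 \<Omega>"
    by (rule H10_lincomb[OF domain_facts(1) Vh_H10[OF k(1)]]) (use bubbles_H10 in blast)
  then show ?thesis using k(2) by simp
qed

text \<open>On a cell the gradient of the affine part is constant, and the gradient of the bubble has mean
  zero. The two are orthogonal, so dropping the bubble cannot increase the seminorm.\<close>

lemma kappa_h1semi_le:
  assumes w: "w \<in> Vhb \<Omega> \<T>" and T: "T \<in> \<T>"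
  shows "h1semi \<Omega> T (kappa \<Omega> \<T> w) \<le> h1semi \<Omega> T w"
proof -
  interpret full_simplex T by (rule cell[OF T])
  let ?v = "kappa \<Omega> \<T> w" and ?I = "interior T"
  obtain k where k: "?v \<in> Vh \<Omega> \<T>" "w = (\<lambda>x. ?v x + bubbles k x)"
    using kappa_decomposition[OF w] by metis
  obtain a where a: "AE x in lebesgue_on T. wgrad \<Omega> ?v x = a"
    using wgrad_Vh[OF k(1) T] by metis
  note V = H1D[OF domain_facts(1) H10_imp_H1[OF Vh_H10[OF k(1)]]]
  note W = H1D[OF domain_facts(1) H10_imp_H1[OF Vhb_H10[OF w]]]
  note B = bubble_H10[OF domain_facts(1,2) interior_cell[OF T]]
  have "has_weak_grad \<Omega> (\<lambda>x. 1 * ?v x + 1 * bubbles k x) (\<lambda>x. 1 *\<^sub>R wgrad \<Omega> ?v x + 1 *\<^sub>R bubbles_grad k x)"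
    by (rule has_weak_grad_lincomb[OF domain_facts(1) V(2)]) (use bubbles_H10 in blast)
  then have "has_weak_grad \<Omega> w (\<lambda>x. wgrad \<Omega> ?v x + bubbles_grad k x)"
    using k(2) by simp
  then have "AE x in lebesgue_on T. wgrad \<Omega> w x = wgrad \<Omega> ?v x + bubbles_grad k x"
    by (intro AE_cell[OF T] wgrad_eq_AE[OF domain_facts(1)])
  then have wg: "AE x in lebesgue_on T. wgrad \<Omega> w x = a + k T *\<^sub>R bubble_grad x"
    using a AE_interior_cell[OF T] by eventually_elim (simp add: bubbles_cell(2)[OF T])
  have G: "bubble_grad \<in> L2 T" by (rule L2_cell[OF T B(3)])
  have A: "(\<lambda>x. a) \<in> L2 T"
    by (rule L2_bounded[OF lebesgue compact_imp_bounded[OF compact], of _ "norm a"]) auto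
  have orth: "l2inner T (\<lambda>x. a) bubble_grad = 0"
  proof -
    have "l2inner T (\<lambda>x. a) bubble_grad = l2inner ?I (\<lambda>x. a) bubble_grad"
      by (rule l2inner_cong_negligible[OF lebesgue _ negligible_diff_interior])
        (auto simp: interior_subset Diff_eq_empty_iff[THEN iffD2])
    also have "\<dots> = 0"
      using bubble_H10(4)[OF open_interior bounded_interior[OF compact_imp_bounded[OF compact]] order_refl, of a]
      by (simp add: l2inner_def inner_commute)
    finally show ?thesis .
  qed
  have kG: "(\<lambda>x. k T *\<^sub>R bubble_grad x) \<in> L2 T" using G by (rule L2_scaleR)
  have "(h1semi \<Omega> T w)\<^sup>2 = l2inner T (\<lambda>x. a + k T *\<^sub>R bubble_grad x) (\<lambda>x. a + k T *\<^sub>R bubble_grad x)"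
    unfolding h1semi_def l2norm_power2
    by (rule l2inner_cong_AE) (use wg L2_cell[OF T W(3)] L2_add[OF A kG] in auto)
  also have "\<dots> = l2inner T (\<lambda>x. a) (\<lambda>x. a) + 2 * (k T * l2inner T (\<lambda>x. a) bubble_grad)
      + l2inner T (\<lambda>x. k T *\<^sub>R bubble_grad x) (\<lambda>x. k T *\<^sub>R bubble_grad x)"
    using l2inner_scaleR_left[of T "k T" bubble_grad "\<lambda>x. a"] A kG L2_add[OF A kG]
    by (simp add: l2inner_add_left l2inner_add_right l2inner_commute[of T "\<lambda>x. a" "\<lambda>x. k T *\<^sub>R bubble_grad x"]
        l2inner_commute[of T bubble_grad "\<lambda>x. a"])
  also have "\<dots> \<ge> l2inner T (\<lambda>x. a) (\<lambda>x. a)" by (simp add: orth)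
  also have "l2inner T (\<lambda>x. a) (\<lambda>x. a) = (h1semi \<Omega> T ?v)\<^sup>2"
    unfolding h1semi_def l2norm_power2
    by (rule l2inner_cong_AE) (use a L2_cell[OF T V(3)] A in \<open>auto elim: eventually_mono\<close>)
  finally show ?thesis
    by (rule power2_le_imp_le) (simp add: h1semi_def)
qed

end

section \<open>Essential suprema and the nonlinear coefficient\<close>

lemma Linf_bounded:
  assumes "g \<in> Linf S"
  obtains B where "0 \<le> B" "AE x in lebesgue_on S. norm (g x) \<le> B"
proof -
  let ?s = "esssup (lebesgue_on S) (\<lambda>x. ereal (norm (g x)))"
  have "?s < \<infinity>" using assms by (simp add: Linf_def)
  then obtain r :: real where "?s \<le> ereal r" by (cases ?s) auto
  then have "AE x in lebesgue_on S. norm (g x) \<le> max r 0"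
    using esssup_AE[of "\<lambda>x. ereal (norm (g x))" "lebesgue_on S"]
    by (auto elim!: eventually_mono dest: order_trans)
  then show ?thesis using that[of "max r 0"] by simp
qed

lemma linfnorm_props:
  fixes g :: "'a::euclidean_space \<Rightarrow> 'b::euclidean_space"
  assumes g: "g \<in> borel_measurable (lebesgue_on S)" and B: "AE x in lebesgue_on S. norm (g x) \<le> B"
  shows "AE x in lebesgue_on S. norm (g x) \<le> linfnorm S g" "0 \<le> linfnorm S g"
proof -
  let ?s = "esssup (lebesgue_on S) (\<lambda>x. ereal (norm (g x)))"
  have m: "(\<lambda>x. ereal (norm (g x))) \<in> borel_measurable (lebesgue_on S)" using g by simp
  have AE: "AE x in lebesgue_on S. ereal (norm (g x)) \<le> ?s" by (rule esssup_AE)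
  have "?s \<le> ereal B" by (rule esssup_I[OF m]) (use B in simp)
  then consider "?s = -\<infinity>" | r where "?s = ereal r" by (cases ?s) auto
  then have "(AE x in lebesgue_on S. norm (g x) \<le> linfnorm S g) \<and> 0 \<le> linfnorm S g"
  proof cases
    case 1
    then have "AE x in lebesgue_on S. False" "linfnorm S g = 0"
      using AE by (simp_all add: linfnorm_def)
    then show ?thesis by (auto elim: eventually_mono)
  next
    case 2
    then have r: "AE x in lebesgue_on S. norm (g x) \<le> r" "linfnorm S g = r"
      using AE by (simp_all add: linfnorm_def)
    have "0 \<le> r"
    proof (rule ccontr)
      assume "\<not> 0 \<le> r"
      \<comment> \<open>a negative bound of a norm means that the set is null, where the supremum is \<open>-\<infinity>\<close>\<close>
      with r(1) have "AE x in lebesgue_on S. ereal (norm (g x)) \<le> -\<infinity>"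
        by (auto elim!: eventually_mono dest: order_trans[OF norm_ge_zero])
      then have "?s \<le> -\<infinity>" by (rule esssup_I[OF m])
      then show False using 2 by simp
    qed
    with r show ?thesis by simp
  qed
  then show "AE x in lebesgue_on S. norm (g x) \<le> linfnorm S g" "0 \<le> linfnorm S g" by auto
qed

lemma sum_products_le_sqrt: "a * c + b * d \<le> sqrt (a\<^sup>2 + b\<^sup>2) * sqrt (c\<^sup>2 + d\<^sup>2)" for a b c d :: real
proof -
  have "(a * c + b * d)\<^sup>2 \<le> (a\<^sup>2 + b\<^sup>2) * (c\<^sup>2 + d\<^sup>2)"
    using zero_le_power2[of "a * d - b * c"] by (simp add: power2_eq_square algebra_simps)
  then show ?thesis unfolding real_sqrt_mult[symmetric] by (rule real_le_rsqrt)
qed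

lemma quotient_difference_le:
  fixes r s m n a q D \<tau> :: real
  assumes "\<bar>r - s\<bar> \<le> a * D" "\<bar>m - n\<bar> \<le> D" "0 \<le> s" "s \<le> q * (n + \<tau>)" "0 \<le> m" "0 \<le> n" "0 < \<tau>"
  shows "\<bar>r / (m + \<tau>) - s / (n + \<tau>)\<bar> \<le> (a + q) * D / \<tau>"
proof -
  have p: "0 < m + \<tau>" "0 < n + \<tau>" "\<tau> \<le> m + \<tau>" using assms by auto
  have D: "0 \<le> D" using assms(2) by linarith
  have aD: "0 \<le> a * D" using assms(1) by linarith
  have s1: "0 \<le> s / (n + \<tau>)" "s / (n + \<tau>) \<le> q" using assms p by (auto simp: divide_le_eq)
  have "r / (m + \<tau>) - s / (n + \<tau>) = ((r - s) + s / (n + \<tau>) * (n - m)) / (m + \<tau>)"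
    using p by (simp add: field_simps)
  also have "\<bar>\<dots>\<bar> = \<bar>(r - s) + s / (n + \<tau>) * (n - m)\<bar> / (m + \<tau>)"
    using p by (simp add: abs_divide)
  also have "\<dots> \<le> (a * D + q * D) / (m + \<tau>)"
  proof (rule divide_right_mono)
    have "\<bar>s / (n + \<tau>) * (n - m)\<bar> = s / (n + \<tau>) * \<bar>m - n\<bar>"
      by (simp only: abs_mult abs_of_nonneg[OF s1(1)] abs_minus_commute[of n])
    also have "\<dots> \<le> q * D" using s1 assms(2) by (intro mult_mono) auto
    finally have "\<bar>s / (n + \<tau>) * (n - m)\<bar> \<le> q * D" .
    then show "\<bar>(r - s) + s / (n + \<tau>) * (n - m)\<bar> \<le> a * D + q * D" using assms(1) by linarith
  qed (use p in simp)
  also have "\<dots> \<le> (a * D + q * D) / \<tau>"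
    using p assms(7) aD D s1 by (intro divide_left_mono) auto
  finally show ?thesis by (simp add: algebra_simps)
qed

locale dynamic_diffusion = mesh \<Omega> \<T> for \<Omega> :: "'a::euclidean_space set" and \<T> +
  fixes \<epsilon> \<sigma> \<tau> :: real and \<beta> :: "'a \<Rightarrow> 'a" and f :: "'a \<Rightarrow> real" and \<mu> :: "real \<Rightarrow> real"
  assumes eps: "\<epsilon> > 0" and sigma: "\<sigma> > 0" and tau: "\<tau> > 0"
    and beta: "\<And>i. i \<in> Basis \<Longrightarrow> (\<lambda>x. \<beta> x \<bullet> i) \<in> W1inf \<Omega>"
    and div_beta: "AE x in lebesgue_on \<Omega>. wdiv \<Omega> \<beta> x = 0"
    and f: "f \<in> L2 \<Omega>"
    and mu: "\<And>T. T \<in> \<T> \<Longrightarrow> 0 < \<mu> (diameter T)"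
begin

abbreviation "G w \<equiv> wgrad \<Omega> w"

lemma beta_measurable: "\<beta> \<in> borel_measurable (lebesgue_on \<Omega>)"
  using beta by (subst borel_measurable_euclidean_space) (auto simp: W1inf_def Linf_def)

lemma beta_bounded:
  obtains B where "0 \<le> B" "AE x in lebesgue_on \<Omega>. norm (\<beta> x) \<le> B"
proof -
  have "\<forall>i\<in>Basis. \<exists>B. 0 \<le> B \<and> (AE x in lebesgue_on \<Omega>. \<bar>\<beta> x \<bullet> i\<bar> \<le> B)"
  proof
    fix i :: 'a assume "i \<in> Basis"
    then have "(\<lambda>x. \<beta> x \<bullet> i) \<in> Linf \<Omega>" using beta by (simp add: W1inf_def)
    from Linf_bounded[OF this] show "\<exists>B. 0 \<le> B \<and> (AE x in lebesgue_on \<Omega>. \<bar>\<beta> x \<bullet> i\<bar> \<le> B)" by auto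
  qed
  then obtain B where B: "\<And>i. i \<in> Basis \<Longrightarrow> 0 \<le> B i" "\<And>i. i \<in> Basis \<Longrightarrow> AE x in lebesgue_on \<Omega>. \<bar>\<beta> x \<bullet> i\<bar> \<le> B i"
    by metis
  have "AE x in lebesgue_on \<Omega>. \<forall>i\<in>Basis. \<bar>\<beta> x \<bullet> i\<bar> \<le> B i"
    by (rule AE_ball_countable'[OF B(2)]) (auto intro: countable_finite)
  then have "AE x in lebesgue_on \<Omega>. norm (\<beta> x) \<le> (\<Sum>i\<in>Basis. B i)"
    by eventually_elim (rule order_trans[OF norm_le_l1], rule sum_mono, blast)
  moreover have "0 \<le> (\<Sum>i\<in>Basis. B i)" using B(1) by (rule sum_nonneg)
  ultimately show ?thesis using that by blast
qed

lemma beta_cell: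
  assumes T: "T \<in> \<T>"
  shows "\<beta> \<in> borel_measurable (lebesgue_on T)" "AE x in lebesgue_on T. norm (\<beta> x) \<le> linfnorm T \<beta>"
    "0 \<le> linfnorm T \<beta>"
proof -
  show m: "\<beta> \<in> borel_measurable (lebesgue_on T)"
    by (rule borel_measurable_lebesgue_on_subset[OF cell_lebesgue[OF T] domain_facts(4) negligible_cell_diff[OF T] beta_measurable])
  obtain B where "AE x in lebesgue_on \<Omega>. norm (\<beta> x) \<le> B" using beta_bounded by metis
  then have "AE x in lebesgue_on T. norm (\<beta> x) \<le> B" by (rule AE_cell[OF T])
  from linfnorm_props[OF m this]
  show "AE x in lebesgue_on T. norm (\<beta> x) \<le> linfnorm T \<beta>" "0 \<le> linfnorm T \<beta>" .
qed

lemma H10_L2: "w \<in> H10 \<Omega> \<Longrightarrow> w \<in> L2 \<Omega>" "w \<in> H10 \<Omega> \<Longrightarrow> G w \<in> L2 \<Omega>"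
  using H1D[OF domain_facts(1) H10_imp_H1] by blast+

lemma convection_eq_0: "w \<in> H10 \<Omega> \<Longrightarrow> l2inner \<Omega> (\<lambda>x. \<beta> x \<bullet> G w x) w = 0"
proof -
  assume w: "w \<in> H10 \<Omega>"
  obtain B where B: "0 \<le> B" "AE x in lebesgue_on \<Omega>. norm (\<beta> x) \<le> B" using beta_bounded by metis
  show ?thesis
  proof (rule convection_skew[OF domain_facts(1) beta_measurable B(2,1) _ _ w])
    show "has_weak_grad \<Omega> (\<lambda>x. \<beta> x \<bullet> i) (G (\<lambda>x. \<beta> x \<bullet> i))" if "i \<in> Basis" for i
      using beta[OF that] has_weak_grad_wgrad by (auto simp: W1inf_def)
    show "AE x in lebesgue_on \<Omega>. (\<Sum>i\<in>Basis. G (\<lambda>x. \<beta> x \<bullet> i) x \<bullet> i) = 0"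
      using div_beta by (simp add: wdiv_def)
  qed
qed

lemma h1norm_ge: "l2norm T w \<le> h1norm \<Omega> T w" "h1semi \<Omega> T w \<le> h1norm \<Omega> T w" "0 \<le> h1norm \<Omega> T w"
  by (auto simp: h1norm_def h1semi_def intro!: real_le_rsqrt)

lemma h1semi_diff:
  assumes v: "v \<in> H10 \<Omega>" and w: "w \<in> H10 \<Omega>" and T: "T \<in> \<T>"
  shows "h1semi \<Omega> T (\<lambda>x. v x - w x) = l2norm T (\<lambda>x. G v x - G w x)"
  unfolding h1semi_def
proof (rule l2norm_cong_AE)
  show "AE x in lebesgue_on T. G (\<lambda>x. v x - w x) x = G v x - G w x"
    by (intro AE_cell[OF T] wgrad_diff_AE[OF domain_facts(1)] H10_imp_H1 v w)
qed (use v w H10_L2 H10_diff[OF domain_facts(1)] in \<open>auto intro!: L2_cell[OF T]\<close>)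

lemma h1norm_le_diff:
  assumes v: "v \<in> H10 \<Omega>" and w: "w \<in> H10 \<Omega>" and T: "T \<in> \<T>"
  shows "h1norm \<Omega> T v \<le> h1norm \<Omega> T (\<lambda>x. v x - w x) + h1norm \<Omega> T w"
proof -
  note L = L2_cell[OF T H10_L2(1)[OF v]] L2_cell[OF T H10_L2(1)[OF w]]
    L2_cell[OF T H10_L2(2)[OF v]] L2_cell[OF T H10_L2(2)[OF w]]
  have "l2norm T v \<le> l2norm T (\<lambda>x. v x - w x) + l2norm T w"
    using l2norm_triangle[OF L2_diff[OF L(1,2)] L(2)] by simp
  moreover have "h1semi \<Omega> T v \<le> h1semi \<Omega> T (\<lambda>x. v x - w x) + h1semi \<Omega> T w"
    unfolding h1semi_diff[OF assms] unfolding h1semi_def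
    using l2norm_triangle[OF L2_diff[OF L(3,4)] L(4)] by simp
  ultimately have "h1norm \<Omega> T v \<le> sqrt ((l2norm T (\<lambda>x. v x - w x) + l2norm T w)\<^sup>2
      + (h1semi \<Omega> T (\<lambda>x. v x - w x) + h1semi \<Omega> T w)\<^sup>2)"
    unfolding h1norm_def by (intro real_sqrt_le_mono add_mono power_mono) (auto simp: h1semi_def)
  also have "\<dots> \<le> h1norm \<Omega> T (\<lambda>x. v x - w x) + h1norm \<Omega> T w"
    unfolding h1norm_def by (rule real_sqrt_sum_squares_triangle_ineq)
  finally show ?thesis .
qed

lemma h1norm_minus_commute:
  assumes v: "v \<in> H10 \<Omega>" and w: "w \<in> H10 \<Omega>" and T: "T \<in> \<T>"
  shows "h1norm \<Omega> T (\<lambda>x. v x - w x) = h1norm \<Omega> T (\<lambda>x. w x - v x)"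
  using l2norm_minus[of T "\<lambda>x. v x - w x"] l2norm_minus[of T "\<lambda>x. G v x - G w x"]
  by (simp add: h1norm_def h1semi_diff[OF v w T] h1semi_diff[OF w v T])

lemma residual_L2:
  assumes w: "w \<in> H10 \<Omega>" and T: "T \<in> \<T>"
  shows "residual \<Omega> \<beta> \<sigma> f w \<in> L2 T"
proof -
  note b = beta_cell[OF T]
  note L = L2_cell[OF T H10_L2(1)[OF w]] L2_cell[OF T H10_L2(2)[OF w]] L2_cell[OF T f]
  show ?thesis unfolding residual_def[abs_def]
    by (intro L2_diff L2_add L2_mult L2_inner_bounded(1)[OF b] L)
qed

text \<open>Bounding \<open>\<parallel>f\<parallel>\<close> by \<open>\<parallel>f\<parallel> / \<tau>\<close> times the denominator of \<open>\<xi>\<^sub>T\<close> makes the quotient bounded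
  uniformly in \<open>w\<close>.\<close>

lemma residual_le:
  assumes w: "w \<in> H10 \<Omega>" and T: "T \<in> \<T>"
  shows "l2norm T (residual \<Omega> \<beta> \<sigma> f w) \<le> qT \<beta> \<sigma> f \<tau> T * (h1norm \<Omega> T w + \<tau>)"
proof -
  note b = beta_cell[OF T]
  note L = L2_cell[OF T H10_L2(1)[OF w]] L2_cell[OF T H10_L2(2)[OF w]] L2_cell[OF T f]
  note B = L2_inner_bounded[OF b L(2)]
  let ?n = "h1norm \<Omega> T w"
  have "l2norm T (residual \<Omega> \<beta> \<sigma> f w) \<le> l2norm T (\<lambda>x. \<beta> x \<bullet> G w x + \<sigma> * w x) + l2norm T f"
    unfolding residual_def[abs_def] by (intro l2norm_triangle_diff L2_add L2_mult B(1) L)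
  also have "l2norm T (\<lambda>x. \<beta> x \<bullet> G w x + \<sigma> * w x) \<le> l2norm T (\<lambda>x. \<beta> x \<bullet> G w x) + l2norm T (\<lambda>x. \<sigma> * w x)"
    by (intro l2norm_triangle L2_mult B(1) L)
  also have "l2norm T (\<lambda>x. \<beta> x \<bullet> G w x) \<le> linfnorm T \<beta> * h1semi \<Omega> T w"
    using B(2) by (simp add: h1semi_def)
  also have "\<dots> \<le> linfnorm T \<beta> * ?n" by (intro mult_left_mono h1norm_ge b(3))
  also have "l2norm T (\<lambda>x. \<sigma> * w x) \<le> \<sigma> * ?n"
    using sigma h1norm_ge(1)[of T w] by (simp add: l2norm_mult)
  finally have 1: "l2norm T (residual \<Omega> \<beta> \<sigma> f w) \<le> (linfnorm T \<beta> + \<sigma>) * ?n + l2norm T f"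
    by (simp add: algebra_simps)
  have 2: "0 \<le> (linfnorm T \<beta> + \<sigma>) * \<tau>" "0 \<le> l2norm T f / \<tau> * ?n"
    using b(3) sigma tau h1norm_ge(3) by simp_all
  have "qT \<beta> \<sigma> f \<tau> T * (?n + \<tau>)
      = (linfnorm T \<beta> + \<sigma>) * ?n + (linfnorm T \<beta> + \<sigma>) * \<tau> + l2norm T f / \<tau> * ?n + l2norm T f"
    using tau by (simp add: qT_def algebra_simps)
  with 1 2 show ?thesis by linarith
qed

lemma residual_diff_le:
  assumes v: "v \<in> H10 \<Omega>" and w: "w \<in> H10 \<Omega>" and T: "T \<in> \<T>"
  shows "\<bar>l2norm T (residual \<Omega> \<beta> \<sigma> f v) - l2norm T (residual \<Omega> \<beta> \<sigma> f w)\<bar>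
    \<le> aT \<beta> \<sigma> T * h1norm \<Omega> T (\<lambda>x. v x - w x)"
proof -
  note b = beta_cell[OF T]
  let ?R = "residual \<Omega> \<beta> \<sigma> f" and ?F = "\<lambda>x. G v x - G w x" and ?d = "\<lambda>x. v x - w x"
  note R = residual_L2[OF v T] residual_L2[OF w T]
  have F: "?F \<in> L2 T" "?d \<in> L2 T"
    using L2_cell[OF T] H10_L2 v w by (auto intro!: L2_diff)
  note B = L2_inner_bounded[OF b F(1)]
  have eq: "(\<lambda>x. ?R v x - ?R w x) = (\<lambda>x. \<beta> x \<bullet> ?F x + \<sigma> * ?d x)"
    by (simp add: residual_def fun_eq_iff algebra_simps inner_diff_right)
  have "l2norm T (\<lambda>x. ?R v x - ?R w x) \<le> l2norm T (\<lambda>x. \<beta> x \<bullet> ?F x) + l2norm T (\<lambda>x. \<sigma> * ?d x)"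
    unfolding eq by (intro l2norm_triangle L2_mult B(1) F)
  also have "\<dots> \<le> linfnorm T \<beta> * h1semi \<Omega> T ?d + \<sigma> * l2norm T ?d"
    using B(2) sigma by (simp add: h1semi_diff[OF assms] l2norm_mult)
  also have "\<dots> \<le> aT \<beta> \<sigma> T * h1norm \<Omega> T ?d"
    using sum_products_le_sqrt[of "linfnorm T \<beta>" "h1semi \<Omega> T ?d" \<sigma> "l2norm T ?d"]
    by (simp add: aT_def h1norm_def add.commute)
  finally have le: "l2norm T (\<lambda>x. ?R v x - ?R w x) \<le> aT \<beta> \<sigma> T * h1norm \<Omega> T ?d" .
  have "l2norm T (?R v) \<le> l2norm T (\<lambda>x. ?R v x - ?R w x) + l2norm T (?R w)"
    using l2norm_triangle[OF L2_diff[OF R] R(2)] by simp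
  moreover have "l2norm T (?R w) \<le> l2norm T (?R v) + l2norm T (\<lambda>x. ?R v x - ?R w x)"
    using l2norm_triangle_diff[OF R(1) L2_diff[OF R]] by simp
  ultimately show ?thesis using le by linarith
qed

lemma xi_nonneg: "T \<in> \<T> \<Longrightarrow> 0 \<le> xi \<Omega> \<epsilon> \<beta> \<sigma> f \<tau> \<mu> T w"
  unfolding xi_def chi_def using mu[of T] h1norm_ge(3)[of T w] tau by simp

text \<open>The quotient rule for differences: the numerator varies with constant \<open>aT\<close>, the denominator with
  constant \<open>1\<close>, and the quotient itself is at most \<open>qT\<close>, while the denominators are at least \<open>\<tau>\<close>.\<close>

lemma xi_Lipschitz:
  assumes v: "v \<in> H10 \<Omega>" and w: "w \<in> H10 \<Omega>" and T: "T \<in> \<T>"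
  shows "\<bar>xi \<Omega> \<epsilon> \<beta> \<sigma> f \<tau> \<mu> T v - xi \<Omega> \<epsilon> \<beta> \<sigma> f \<tau> \<mu> T w\<bar>
    \<le> chi \<epsilon> \<beta> T * \<mu> (diameter T) * ((aT \<beta> \<sigma> T + qT \<beta> \<sigma> f \<tau> T) * h1norm \<Omega> T (\<lambda>x. v x - w x) / \<tau>)"
proof -
  let ?c = "chi \<epsilon> \<beta> T * \<mu> (diameter T)"
  have c: "0 \<le> ?c" using mu[OF T] by (simp add: chi_def)
  have n: "\<bar>h1norm \<Omega> T v - h1norm \<Omega> T w\<bar> \<le> h1norm \<Omega> T (\<lambda>x. v x - w x)"
    using h1norm_le_diff[OF assms] h1norm_le_diff[OF w v T] h1norm_minus_commute[OF assms] by linarith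
  have "\<bar>?c * (l2norm T (residual \<Omega> \<beta> \<sigma> f v) / (h1norm \<Omega> T v + \<tau>))
      - ?c * (l2norm T (residual \<Omega> \<beta> \<sigma> f w) / (h1norm \<Omega> T w + \<tau>))\<bar>
    = ?c * \<bar>l2norm T (residual \<Omega> \<beta> \<sigma> f v) / (h1norm \<Omega> T v + \<tau>)
      - l2norm T (residual \<Omega> \<beta> \<sigma> f w) / (h1norm \<Omega> T w + \<tau>)\<bar>"
    unfolding right_diff_distrib[symmetric] abs_mult[of ?c] using c by (simp only: abs_of_nonneg)
  also have "\<dots> \<le> ?c * ((aT \<beta> \<sigma> T + qT \<beta> \<sigma> f \<tau> T) * h1norm \<Omega> T (\<lambda>x. v x - w x) / \<tau>)"
    by (intro mult_left_mono quotient_difference_le residual_diff_le[OF assms] n residual_le[OF w T]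
        h1norm_ge(3) tau c l2norm_nonneg)
  finally show ?thesis unfolding xi_def .
qed

section \<open>Energy estimates and uniqueness\<close>

abbreviation "\<xi> T w \<equiv> xi \<Omega> \<epsilon> \<beta> \<sigma> f \<tau> \<mu> T (kappa \<Omega> \<T> w)"
abbreviation "solution w \<equiv> dd_solution \<Omega> \<T> \<epsilon> \<beta> \<sigma> f \<tau> \<mu> w"

lemma bilin_self:
  assumes "w \<in> H10 \<Omega>"
  shows "bilin \<Omega> \<epsilon> \<beta> \<sigma> w w = \<epsilon> * (h1semi \<Omega> \<Omega> w)\<^sup>2 + \<sigma> * (l2norm \<Omega> w)\<^sup>2"
  unfolding bilin_def convection_eq_0[OF assms] by (simp add: h1semi_def l2norm_power2)

lemma bilin_diff:
  assumes u: "u \<in> H10 \<Omega>" and v: "v \<in> H10 \<Omega>" and z: "z \<in> H10 \<Omega>"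
  shows "bilin \<Omega> \<epsilon> \<beta> \<sigma> (\<lambda>x. u x - v x) z = bilin \<Omega> \<epsilon> \<beta> \<sigma> u z - bilin \<Omega> \<epsilon> \<beta> \<sigma> v z"
proof -
  obtain B where B: "0 \<le> B" "AE x in lebesgue_on \<Omega>. norm (\<beta> x) \<le> B" using beta_bounded by metis
  note b = L2_inner_bounded(1)[OF beta_measurable B(2,1)]
  let ?e = "\<lambda>x. u x - v x"
  have e: "?e \<in> H10 \<Omega>" by (rule H10_diff[OF domain_facts(1) u v])
  have AE: "AE x in lebesgue_on \<Omega>. G ?e x = G u x - G v x"
    by (intro wgrad_diff_AE[OF domain_facts(1)] H10_imp_H1 u v)
  note L = H10_L2[OF u] H10_L2[OF v] H10_L2[OF z] H10_L2[OF e]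
  have "l2inner \<Omega> (G ?e) (G z) = l2inner \<Omega> (\<lambda>x. G u x - G v x) (G z)"
    by (rule l2inner_cong_AE) (use AE L in auto)
  also have "\<dots> = l2inner \<Omega> (G u) (G z) - l2inner \<Omega> (G v) (G z)"
    by (rule l2inner_diff_left) (use L in auto)
  finally have 1: "l2inner \<Omega> (G ?e) (G z) = l2inner \<Omega> (G u) (G z) - l2inner \<Omega> (G v) (G z)" .
  have "l2inner \<Omega> (\<lambda>x. \<beta> x \<bullet> G ?e x) z = l2inner \<Omega> (\<lambda>x. \<beta> x \<bullet> G u x - \<beta> x \<bullet> G v x) z"
    by (rule l2inner_cong_AE) (use AE L b in \<open>auto simp: inner_diff_right elim: eventually_mono\<close>)
  also have "\<dots> = l2inner \<Omega> (\<lambda>x. \<beta> x \<bullet> G u x) z - l2inner \<Omega> (\<lambda>x. \<beta> x \<bullet> G v x) z"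
    by (rule l2inner_diff_left) (use L b in auto)
  finally have 2: "l2inner \<Omega> (\<lambda>x. \<beta> x \<bullet> G ?e x) z
      = l2inner \<Omega> (\<lambda>x. \<beta> x \<bullet> G u x) z - l2inner \<Omega> (\<lambda>x. \<beta> x \<bullet> G v x) z" .
  show ?thesis unfolding bilin_def 1 2 l2inner_diff_left[OF L(1,3,5)] by (simp add: algebra_simps)
qed

lemma solutionD:
  assumes "solution w"
  shows "w \<in> Vhb \<Omega> \<T>" "w \<in> H10 \<Omega>"
    "z \<in> Vhb \<Omega> \<T> \<Longrightarrow> bilin \<Omega> \<epsilon> \<beta> \<sigma> w z + Dh \<Omega> \<T> \<epsilon> \<beta> \<sigma> f \<tau> \<mu> w w z = l2inner \<Omega> f z"
  using assms Vhb_H10 by (auto simp: dd_solution_def)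

text \<open>Testing with the solution itself: the convection vanishes, the artificial diffusion has the
  right sign, and the reaction absorbs the norm of the solution on the right-hand side.\<close>

lemma solution_h1semi_le:
  assumes v: "solution v"
  shows "h1semi \<Omega> \<Omega> v \<le> l2norm \<Omega> f / (2 * sqrt \<sigma> * sqrt \<epsilon>)"
proof -
  note V = solutionD[OF v]
  let ?n = "l2norm \<Omega> v" and ?F = "l2norm \<Omega> f" and ?E = "h1semi \<Omega> \<Omega> v"
  have D: "0 \<le> Dh \<Omega> \<T> \<epsilon> \<beta> \<sigma> f \<tau> \<mu> v v v"
    unfolding Dh_def by (intro sum_nonneg mult_nonneg_nonneg xi_nonneg l2inner_nonneg)
  have "l2inner \<Omega> f v \<le> ?F * ?n"
    using l2inner_Cauchy_Schwarz[OF f H10_L2(1)[OF V(2)]] by linarith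
  then have "\<epsilon> * ?E\<^sup>2 + \<sigma> * ?n\<^sup>2 \<le> ?F * ?n"
    using V(3)[OF V(1)] D bilin_self[OF V(2)] by linarith
  then have "4 * \<sigma> * (\<epsilon> * ?E\<^sup>2 + \<sigma> * ?n\<^sup>2) \<le> 4 * \<sigma> * (?F * ?n)"
    using sigma by (intro mult_left_mono) auto
  then have "4 * \<sigma> * \<epsilon> * ?E\<^sup>2 \<le> ?F\<^sup>2 - (?F - 2 * \<sigma> * ?n)\<^sup>2"
    by (simp add: power2_eq_square algebra_simps)
  also have "\<dots> \<le> ?F\<^sup>2" by simp
  finally have "(2 * sqrt \<sigma> * sqrt \<epsilon> * ?E)\<^sup>2 \<le> ?F\<^sup>2"
    using eps sigma by (simp add: power_mult_distrib)
  then have "2 * sqrt \<sigma> * sqrt \<epsilon> * ?E \<le> ?F" by (rule power2_le_imp_le) simp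
  then show ?thesis using eps sigma by (simp add: pos_le_divide_eq mult.commute)
qed

text \<open>The error equation, tested with the error. In the difference of the diffusion terms the part
  \<open>- \<xi>\<^sub>T(\<kappa>u) |e|\<^sub>T\<^sup>2\<close> is dropped and the rest is summed by the Cauchy-Schwarz inequality over the cells.\<close>

lemma solution_unique:
  assumes kappa_stable: "\<And>T w. T \<in> \<T> \<Longrightarrow> w \<in> Vhb \<Omega> \<T> \<Longrightarrow> l2norm T (kappa \<Omega> \<T> w) \<le> C\<^sub>\<kappa> * l2norm T w"
    and C0: "C\<^sub>0 > 0" and poincare: "\<And>w. w \<in> H10 \<Omega> \<Longrightarrow> h1norm \<Omega> \<Omega> w \<le> C\<^sub>0 * h1semi \<Omega> \<Omega> w"
    and u: "solution u" and v: "solution v"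
    and small: "C\<^sub>0 * Lh \<T> \<epsilon> \<beta> \<sigma> f \<tau> \<mu> C\<^sub>\<kappa> * l2norm \<Omega> f / (2 * sqrt \<sigma> * \<epsilon> powr (3 / 2)) < 1"
  shows "AE x in lebesgue_on \<Omega>. u x = v x"
proof -
  note U = solutionD[OF u] and V = solutionD[OF v]
  define e where "e = (\<lambda>x. u x - v x)"
  have eV: "e \<in> Vhb \<Omega> \<T>" and ke: "kappa \<Omega> \<T> e = (\<lambda>x. kappa \<Omega> \<T> u x - kappa \<Omega> \<T> v x)"
    unfolding e_def using diff_decomposition[OF U(1) V(1)] by auto
  have eH: "e \<in> H10 \<Omega>" by (rule Vhb_H10[OF eV])
  have kH: "kappa \<Omega> \<T> w \<in> H10 \<Omega>" if "w \<in> Vhb \<Omega> \<T>" for w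
    using kappa_decomposition[OF that] Vh_H10 by metis
  note Le = H10_L2[OF eH] and Lu = H10_L2[OF U(2)] and Lv = H10_L2[OF V(2)]
  let ?L = "Lh \<T> \<epsilon> \<beta> \<sigma> f \<tau> \<mu> C\<^sub>\<kappa>" and ?LT = "LT \<epsilon> \<beta> \<sigma> f \<tau> \<mu> C\<^sub>\<kappa>"
  let ?E = "h1semi \<Omega> \<Omega> e" and ?N = "h1semi \<Omega> \<Omega> v" and ?F = "l2norm \<Omega> f"
  have LT0: "0 \<le> ?LT T" if T: "T \<in> \<T>" for T
    unfolding LT_def aT_def qT_def chi_def using mu[OF T] tau sigma beta_cell(3)[OF T]
    by (auto intro!: mult_nonneg_nonneg divide_nonneg_nonneg add_nonneg_nonneg)
  have LTL: "?LT T \<le> ?L" if "T \<in> \<T>" for T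
    unfolding Lh_def using finite_cells that by (intro Max_ge) auto
  have L0: "0 \<le> ?L" using LT0 LTL cells_nonempty by (meson all_not_in_conv order_trans)
  have kappa_h1: "h1norm \<Omega> T (kappa \<Omega> \<T> e) \<le> max C\<^sub>\<kappa> 1 * h1norm \<Omega> T e" if T: "T \<in> \<T>" for T
  proof -
    let ?M = "max C\<^sub>\<kappa> 1"
    have "l2norm T (kappa \<Omega> \<T> e) \<le> ?M * l2norm T e"
      using kappa_stable[OF T eV] mult_right_mono[of C\<^sub>\<kappa> ?M "l2norm T e"] by simp
    moreover have "h1semi \<Omega> T (kappa \<Omega> \<T> e) \<le> ?M * h1semi \<Omega> T e"
      using kappa_h1semi_le[OF eV T] mult_right_mono[of 1 ?M "h1semi \<Omega> T e"] by (simp add: h1semi_def)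
    ultimately have "h1norm \<Omega> T (kappa \<Omega> \<T> e) \<le> sqrt ((?M * l2norm T e)\<^sup>2 + (?M * h1semi \<Omega> T e)\<^sup>2)"
      unfolding h1norm_def by (intro real_sqrt_le_mono add_mono power_mono) (auto simp: h1semi_def)
    also have "\<dots> = ?M * h1norm \<Omega> T e"
      by (simp add: h1norm_def power_mult_distrib real_sqrt_mult flip: distrib_left)
    finally show ?thesis .
  qed
  have xi: "\<bar>\<xi> T u - \<xi> T v\<bar> \<le> ?L * h1norm \<Omega> T e" if T: "T \<in> \<T>" for T
  proof -
    let ?c = "chi \<epsilon> \<beta> T * \<mu> (diameter T)" and ?s = "aT \<beta> \<sigma> T + qT \<beta> \<sigma> f \<tau> T"
    have s: "0 \<le> ?s" "0 \<le> ?c"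
      unfolding aT_def qT_def chi_def using mu[OF T] tau sigma beta_cell(3)[OF T] by (auto intro!: add_nonneg_nonneg)
    have "\<bar>\<xi> T u - \<xi> T v\<bar> \<le> ?c * (?s * h1norm \<Omega> T (kappa \<Omega> \<T> e) / \<tau>)"
      unfolding ke by (rule xi_Lipschitz[OF kH[OF U(1)] kH[OF V(1)] T])
    also have "\<dots> \<le> ?c * (?s * (max C\<^sub>\<kappa> 1 * h1norm \<Omega> T e) / \<tau>)"
      using s tau kappa_h1[OF T] by (intro mult_left_mono divide_right_mono) auto
    also have "\<dots> = ?LT T * h1norm \<Omega> T e" by (simp add: LT_def field_simps)
    also have "\<dots> \<le> ?L * h1norm \<Omega> T e" by (intro mult_right_mono LTL[OF T] h1norm_ge(3))
    finally show ?thesis .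
  qed
  have Ge: "l2inner T (G u) (G e) = l2inner T (G v) (G e) + (h1semi \<Omega> T e)\<^sup>2" if T: "T \<in> \<T>" for T
  proof -
    have "AE x in lebesgue_on T. G u x = G v x + G e x"
      using AE_cell[OF T wgrad_diff_AE[OF domain_facts(1) H10_imp_H1[OF U(2)] H10_imp_H1[OF V(2)]]]
      by eventually_elim (simp add: e_def)
    then have "l2inner T (G u) (G e) = l2inner T (\<lambda>x. G v x + G e x) (G e)"
      by (intro l2inner_cong_AE L2_cell[OF T] L2_add Lu Lv Le) auto
    also have "\<dots> = l2inner T (G v) (G e) + l2inner T (G e) (G e)"
      by (intro l2inner_add_left L2_cell[OF T] Lv Le)
    finally show ?thesis by (simp add: h1semi_def l2norm_power2)
  qed
  have "bilin \<Omega> \<epsilon> \<beta> \<sigma> e e = (\<Sum>T\<in>\<T>. \<xi> T v * l2inner T (G v) (G e)) - (\<Sum>T\<in>\<T>. \<xi> T u * l2inner T (G u) (G e))"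
    using U(3)[OF eV] V(3)[OF eV] bilin_diff[OF U(2) V(2) eH] unfolding Dh_def e_def[symmetric] by linarith
  also have "\<dots> = (\<Sum>T\<in>\<T>. \<xi> T v * l2inner T (G v) (G e) - \<xi> T u * l2inner T (G u) (G e))"
    by (simp add: sum_subtractf)
  also have "\<dots> \<le> (\<Sum>T\<in>\<T>. (?L * ?N) * (h1norm \<Omega> T e * h1semi \<Omega> T e))"
  proof (rule sum_mono)
    fix T assume T: "T \<in> \<T>"
    have "\<xi> T v * l2inner T (G v) (G e) - \<xi> T u * l2inner T (G u) (G e)
        = (\<xi> T v - \<xi> T u) * l2inner T (G v) (G e) - \<xi> T u * (h1semi \<Omega> T e)\<^sup>2"
      unfolding Ge[OF T] by (simp add: algebra_simps)
    also have "\<dots> \<le> (\<xi> T v - \<xi> T u) * l2inner T (G v) (G e)"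
      using xi_nonneg[OF T, of "kappa \<Omega> \<T> u"] by simp
    also have "\<dots> \<le> \<bar>\<xi> T u - \<xi> T v\<bar> * \<bar>l2inner T (G v) (G e)\<bar>"
      by (metis abs_ge_self abs_minus_commute abs_mult)
    also have "\<dots> \<le> (?L * h1norm \<Omega> T e) * (?N * h1semi \<Omega> T e)"
    proof (rule mult_mono[OF xi[OF T]])
      have "\<bar>l2inner T (G v) (G e)\<bar> \<le> h1semi \<Omega> T v * h1semi \<Omega> T e"
        unfolding h1semi_def by (intro l2inner_Cauchy_Schwarz L2_cell[OF T] Lv Le)
      also have "\<dots> \<le> ?N * h1semi \<Omega> T e"
        unfolding h1semi_def by (intro mult_right_mono l2norm_cell_le[OF T] Lv l2norm_nonneg)
      finally show "\<bar>l2inner T (G v) (G e)\<bar> \<le> ?N * h1semi \<Omega> T e" .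
    qed (use L0 h1norm_ge(3) in auto)
    finally show "\<xi> T v * l2inner T (G v) (G e) - \<xi> T u * l2inner T (G u) (G e)
        \<le> (?L * ?N) * (h1norm \<Omega> T e * h1semi \<Omega> T e)" by (simp add: mult_ac)
  qed
  also have "\<dots> = (?L * ?N) * (\<Sum>T\<in>\<T>. h1norm \<Omega> T e * h1semi \<Omega> T e)"
    by (simp add: sum_distrib_left)
  also have "\<dots> \<le> (?L * ?N) * (h1norm \<Omega> \<Omega> e * ?E)"
  proof (rule mult_left_mono)
    have semi: "(\<Sum>T\<in>\<T>. (h1semi \<Omega> T e)\<^sup>2) \<le> ?E\<^sup>2"
      unfolding h1semi_def by (rule sum_l2norm_cells_le[OF Le(2)])
    have full: "(\<Sum>T\<in>\<T>. (h1norm \<Omega> T e)\<^sup>2) \<le> (h1norm \<Omega> \<Omega> e)\<^sup>2"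
      using add_mono[OF sum_l2norm_cells_le[OF Le(1)] semi] by (simp add: h1norm_def sum.distrib)
    have "(\<Sum>T\<in>\<T>. h1norm \<Omega> T e * h1semi \<Omega> T e) = (\<Sum>T\<in>\<T>. \<bar>h1norm \<Omega> T e\<bar> * \<bar>h1semi \<Omega> T e\<bar>)"
      using h1norm_ge(3) by (intro sum.cong) (auto simp: h1semi_def)
    also have "\<dots> \<le> L2_set (\<lambda>T. h1norm \<Omega> T e) \<T> * L2_set (\<lambda>T. h1semi \<Omega> T e) \<T>"
      by (rule L2_set_mult_ineq)
    also have "\<dots> \<le> h1norm \<Omega> \<Omega> e * ?E"
      unfolding L2_set_def
      by (intro mult_mono real_le_lsqrt) (use semi full h1norm_ge(3) in \<open>auto simp: h1semi_def intro: sum_nonneg\<close>)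
    finally show "(\<Sum>T\<in>\<T>. h1norm \<Omega> T e * h1semi \<Omega> T e) \<le> h1norm \<Omega> \<Omega> e * ?E" .
    show "0 \<le> ?L * ?N" using L0 by (simp add: h1semi_def)
  qed
  also have "\<dots> \<le> (?L * ?N) * (C\<^sub>0 * ?E * ?E)"
    using poincare[OF eH] L0 by (intro mult_left_mono mult_right_mono) (auto simp: h1semi_def)
  finally have main: "\<epsilon> * ?E\<^sup>2 + \<sigma> * (l2norm \<Omega> e)\<^sup>2 \<le> (C\<^sub>0 * ?L * ?N) * ?E\<^sup>2"
    unfolding bilin_self[OF eH] by (simp add: power2_eq_square mult_ac)
  have "C\<^sub>0 * ?L * ?N \<le> C\<^sub>0 * ?L * (?F / (2 * sqrt \<sigma> * sqrt \<epsilon>))"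
    using C0 L0 by (intro mult_left_mono solution_h1semi_le[OF v]) auto
  also have "\<dots> = \<epsilon> * (C\<^sub>0 * ?L * ?F / (2 * sqrt \<sigma> * \<epsilon> powr (3 / 2)))"
  proof -
    have "\<epsilon> powr (3 / 2) = \<epsilon> powr (1 + 1 / 2)" by simp
    also have "\<dots> = \<epsilon> * sqrt \<epsilon>"
      using eps by (subst powr_add) (simp add: powr_half_sqrt)
    finally show ?thesis using eps sigma by (simp add: field_simps)
  qed
  also have "\<dots> \<le> \<epsilon> * 1" using small eps by (intro mult_left_mono) auto
  finally have "(C\<^sub>0 * ?L * ?N) * ?E\<^sup>2 \<le> \<epsilon> * ?E\<^sup>2"
    by (intro mult_right_mono) auto
  with main have "\<sigma> * (l2norm \<Omega> e)\<^sup>2 \<le> 0" by linarith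
  then have "l2norm \<Omega> e = 0" using sigma by (simp add: mult_le_0_iff)
  then have "AE x in lebesgue_on \<Omega>. e x = 0" by (rule l2norm_eq_0_imp_AE[OF Le(1)])
  then show ?thesis by eventually_elim (simp add: e_def)
qed

end

lemma W1inf_component:
  assumes "\<And>i. (\<lambda>x. \<beta> x $ i) \<in> W1inf \<Omega>" "b \<in> Basis"
  shows "(\<lambda>x. (\<beta> x :: real ^ 'd) \<bullet> b) \<in> W1inf \<Omega>"
proof -
  obtain i where "b = axis i 1" using assms(2) by (auto simp: Basis_vec_def)
  then show ?thesis using assms(1)[of i] by (simp add: cart_eq_inner_axis)
qed

theorem theorem4p1:
  fixes \<Omega> :: "(real ^ 'd) set" and \<epsilon> \<sigma> \<tau> :: real
    and \<beta> :: "real ^ 'd \<Rightarrow> real ^ 'd" and f :: "real ^ 'd \<Rightarrow> real"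
    and H :: "real set" and \<T> :: "real \<Rightarrow> (real ^ 'd) set set"
    and \<mu> :: "real \<Rightarrow> real" and C\<^sub>\<mu> C\<^sub>\<kappa> C\<^sub>0 h :: real
    and u v :: "real ^ 'd \<Rightarrow> real"
  assumes dim: "CARD('d) \<in> {2, 3}"
    and domain: "polytopal_lipschitz_domain \<Omega>"
    and eps: "\<epsilon> > 0"
    and beta: "\<And>i. (\<lambda>x. \<beta> x $ i) \<in> W1inf \<Omega>"
    and div_beta: "AE x in lebesgue_on \<Omega>. wdiv \<Omega> \<beta> x = 0"
    and sigma: "\<sigma> > 0"
    and f: "f \<in> L2 \<Omega>"
    and mesh: "\<And>h. h \<in> H \<Longrightarrow> triangulation_of \<Omega> (\<T> h) \<and> h = mesh_size (\<T> h)"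
    and regular: "shape_regular H \<T>"
    and tau: "\<tau> > 0"
    and mu: "\<And>h T. h \<in> H \<Longrightarrow> T \<in> \<T> h \<Longrightarrow> 0 < \<mu> (diameter T) \<and> \<mu> (diameter T) \<le> C\<^sub>\<mu> * diameter T"
    and C\<kappa>_pos: "C\<^sub>\<kappa> > 0"
    and kappa_stable: "\<And>h T w. h \<in> H \<Longrightarrow> T \<in> \<T> h \<Longrightarrow> w \<in> Vhb \<Omega> (\<T> h) \<Longrightarrow>
           l2norm T (kappa \<Omega> (\<T> h) w) \<le> C\<^sub>\<kappa> * l2norm T w"
    and C0_pos: "C\<^sub>0 > 0"
    and poincare: "\<And>w. w \<in> H10 \<Omega> \<Longrightarrow> h1norm \<Omega> \<Omega> w \<le> C\<^sub>0 * h1semi \<Omega> \<Omega> w"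
    and h: "h \<in> H"
    and u: "dd_solution \<Omega> (\<T> h) \<epsilon> \<beta> \<sigma> f \<tau> \<mu> u"
    and v: "dd_solution \<Omega> (\<T> h) \<epsilon> \<beta> \<sigma> f \<tau> \<mu> v"
    and small: "C\<^sub>0 * Lh (\<T> h) \<epsilon> \<beta> \<sigma> f \<tau> \<mu> C\<^sub>\<kappa> * l2norm \<Omega> f / (2 * sqrt \<sigma> * \<epsilon> powr (3 / 2)) < 1"
  shows "AE x in lebesgue_on \<Omega>. u x = v x"
  proof -
  interpret dynamic_diffusion \<Omega> "\<T> h" \<epsilon> \<sigma> \<tau> \<beta> f \<mu>
  proof
    show "polytopal_lipschitz_domain \<Omega>" by (rule domain)
    show "triangulation_of \<Omega> (\<T> h)" using mesh[OF h] by blast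
    show "(\<lambda>x. \<beta> x \<bullet> i) \<in> W1inf \<Omega>" if "i \<in> Basis" for i
      by (rule W1inf_component[OF beta that])
    show "0 < \<mu> (diameter T)" if "T \<in> \<T> h" for T using mu[OF h that] by blast
  qed (use eps sigma tau div_beta f in auto)
  show ?thesis
    by (rule solution_unique[OF kappa_stable[OF h] C0_pos poincare u v small])
qed

end
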